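(* Let $\bullet$ denote any one of the four versions (regular, causal $c$, anticausal $ac$, bicausal $bc$) and let $\varepsilon>0$. Let $c\in C_b(\mathcal X\times\mathcal Y)$, $\mu\in\mathcal P(\mathcal X)$, $\nu\in\mathcal P(\mathcal Y)$ and $P=\mu\otimes\nu$. Then $$V_\bullet(\mu,\nu,c)=\sup_{s\in\mathcal H_\bullet:\ s\le c}\int s\,dP,$$ $$E^\varepsilon_\bullet(\mu,\nu,c)=\sup_{s\in\mathcal H_\bullet}\int s-\varepsilon\exp\Big(\frac{s-c}{\varepsilon}\Big)\,dP+\varepsilon.$$
   Context: $N\in\mathbb N$; $\mathcal X=\mathcal X_1\times\dots\times\mathcal X_N$ and $\mathcal Y=\mathcal Y_1\times\dots\times\mathcal Y_N$ are products of Polish spaces; $C_b$ denotes bounded continuous real functions. $X_t,Y_t$ are coordinate projections, $x_{1:t}=(x_1,\dots,x_t)$, $\mathcal X_{1:t}=\mathcal X_1\times\dots\times\mathcal X_t$, etc.; $\mu_t^{x_{1:t-1}}$ is (a fixed version of) the regular conditional law of $X_t$ given $X_{1:t-1}=x_{1:t-1}$ under $\mu$, and $\nu_t^{y_{1:t-1}}$ similarly. $\Pi(\mu,\nu)$ is the set of couplings. A measure $\pi\in\mathcal P(\mathcal X\times\mathcal Y)$ is causal if under $\pi$, for all $t=1,\dots,N-1$, $X_{t+1}$ is conditionally independent of $Y_{1:t}$ given $X_{1:t}$; anticausal if for all such $t$, $Y_{t+1}$ is conditionally independent of $X_{1:t}$ given $Y_{1:t}$; bicausal if both. $\Pi_c,\Pi_{ac},\Pi_{bc}$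 are the corresponding subsets of $\Pi(\mu,\nu)$; $\Pi_\bullet$ is any of $\Pi,\Pi_c,\Pi_{ac},\Pi_{bc}$. $V_\bullet(\mu,\nu,c)=\inf_{\pi\in\Pi_\bullet(\mu,\nu)}\int c\,d\pi$ and $E^\varepsilon_\bullet(\mu,\nu,c)=\inf_{\pi\in\Pi_\bullet(\mu,\nu)}\int c\,d\pi+\varepsilon D_{\rm KL}(\pi,P)$, with $D_{\rm KL}(\pi,P)=\int\log\frac{d\pi}{dP}\,d\pi$ if $\pi\ll P$ and $+\infty$ otherwise. Function spaces (functions on $\mathcal X\times\mathcal Y$): $\mathcal S_{\mathcal X}=\{(x,y)\mapsto f(x): f \text{ bounded measurable}\}$, $\mathcal S_{\mathcal Y}=\{(x,y)\mapsto g(y): g\text{ bounded measurable}\}$. $\mathcal A_{\mathcal X,\mu,1}$ is the set of bounded measurable functions of $x_1$, $\mathcal A_{\mathcal Y,\nu,1}$ that of bounded measurable functions of $y_1$. For $t=2,\dots,N$, $\mathcal A_{\mathcal X,\mu,t}$ is the set of functions $$a_t(x_{1:t},y_{1:t-1})-\int a_t(x_{1:t-1},\tilde x_t,y_{1:t-1})\,\mu_t^{x_{1:t-1}}(d\tilde x_t)$$ with $a_t:\mathcal X_{1:t}\times\mathcal Y_{1:t-1}\to\mathbb R$ bounded measurable, and $\mathcal A_{\mathcal Y,\nu,t}$ is the set of functions $$a_t(x_{1:t-1},y_{1:t})-\int a_t(x_{1:t-1},y_{1:t-1},\tilde y_t)\,\nu_t^{y_{1:t-1}}(d\tilde y_t)$$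 with $a_t:\mathcal X_{1:t-1}\times\mathcal Y_{1:t}\to\mathbb R$ bounded measurable. $\mathcal S_{\mathcal X,\mu}=\{\sum_{t=1}^Nf_t:f_t\in\mathcal A_{\mathcal X,\mu,t}\}$, $\mathcal S_{\mathcal Y,\nu}=\{\sum_{t=1}^Ng_t:g_t\in\mathcal A_{\mathcal Y,\nu,t}\}$. Finally (sums of function spaces) $\mathcal H=\mathcal S_{\mathcal X}+\mathcal S_{\mathcal Y}$ (regular case), $\mathcal H_c=\mathcal S_{\mathcal X,\mu}+\mathcal S_{\mathcal Y}$, $\mathcal H_{ac}=\mathcal S_{\mathcal X}+\mathcal S_{\mathcal Y,\nu}$, $\mathcal H_{bc}=\mathcal S_{\mathcal X,\mu}+\mathcal S_{\mathcal Y,\nu}$. *)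

theory Defs
  imports "HOL-Probability.Probability"
begin

section \<open>Products of Polish spaces\<close>

text \<open>
  The factors are abstract topologies on subsets of a common carrier type, so that they may differ
  from one another. A path \<open>x\<close> in the product of \<open>X 1, \<dots>, X n\<close> is an extensional function on
  \<open>{1..n}\<close>; its initial segment up to \<open>t\<close> is \<open>restrict x {1..t}\<close>.
\<close>

definition polish_topology :: "'a topology \<Rightarrow> bool" where
  "polish_topology T \<longleftrightarrow> completely_metrizable_space T \<and> second_countable T"

definition borel_of :: "'a topology \<Rightarrow> 'a measure" where
  "borel_of T = sigma (topspace T) {U. openin T U}"

definition path_space :: "(nat \<Rightarrow> 'a topology) \<Rightarrow> nat \<Rightarrow> (nat \<Rightarrow> 'a) measure" where
  "path_space X n = PiM {1..n} (\<lambda>t. borel_of (X t))"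

definition path_topology :: "(nat \<Rightarrow> 'a topology) \<Rightarrow> nat \<Rightarrow> (nat \<Rightarrow> 'a) topology" where
  "path_topology X n = product_topology X {1..n}"

text \<open>
  For second countable factors the product sigma-algebras used below are the Borel sigma-algebras
  of the product topologies (\<open>sets_path_space_eq_borel\<close>, \<open>sets_path_space_pair_eq_borel\<close>).
\<close>

lemma space_borel_of [simp]: "space (borel_of T) = topspace T"
  by (simp add: borel_of_def space_measure_of_conv)

lemma sets_borel_of: "sets (borel_of T) = sigma_sets (topspace T) {U. openin T U}"
  unfolding borel_of_def by (rule sets_measure_of) (auto dest: openin_subset)

lemma openin_sets_borel_of: "openin T U \<Longrightarrow> U \<in> sets (borel_of T)"
  by (simp add: sets_borel_of sigma_sets.Basic)

lemma continuous_map_measurable_borel_of: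
  assumes "continuous_map S T f"
  shows "f \<in> measurable (borel_of S) (borel_of T)"
  unfolding borel_of_def[of T]
proof (rule measurable_sigma_sets[OF refl[THEN trans]])
  show "sets (sigma (topspace T) {U. openin T U}) = sigma_sets (topspace T) {U. openin T U}"
    by (rule sets_measure_of) (auto dest: openin_subset)
next
  show "{U. openin T U} \<subseteq> Pow (topspace T)" by (auto dest: openin_subset)
  show "f \<in> space (borel_of S) \<rightarrow> topspace T"
    using assms by (simp add: continuous_map_def)
  fix U assume "U \<in> {U. openin T U}"
  then have "openin S {x \<in> topspace S. f x \<in> U}"
    using assms by (simp add: continuous_map_def)
  moreover have "f -` U \<inter> space (borel_of S) = {x \<in> topspace S. f x \<in> U}" by auto
  ultimately show "f -` U \<inter> space (borel_of S) \<in> sets (borel_of S)"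
    by (simp add: openin_sets_borel_of)
qed

definition countable_base :: "'a topology \<Rightarrow> 'a set set \<Rightarrow> bool" where
  "countable_base T B \<longleftrightarrow> countable B \<and> (\<forall>V\<in>B. openin T V) \<and>
     (\<forall>U x. openin T U \<and> x \<in> U \<longrightarrow> (\<exists>V\<in>B. x \<in> V \<and> V \<subseteq> U))"

lemma second_countable_iff_base: "second_countable T \<longleftrightarrow> (\<exists>B. countable_base T B)"
  unfolding second_countable_def countable_base_def by blast

lemma sets_borel_of_subset:
  assumes B: "countable_base T B" and M: "B \<subseteq> sets M" "space M = topspace T"
  shows "sets (borel_of T) \<subseteq> sets M"
proof -
  have "U \<in> sets M" if "openin T U" for U
  proof -
    have "U = \<Union>{V \<in> B. V \<subseteq> U}"
      using B that unfolding countable_base_def by blast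
    moreover have "countable {V \<in> B. V \<subseteq> U}"
      using B by (auto simp: countable_base_def)
    ultimately show ?thesis
      using M(1) sets.countable_Union[of "{V \<in> B. V \<subseteq> U}" M] by auto
  qed
  then show ?thesis
    unfolding sets_borel_of M(2)[symmetric] by (intro sets.sigma_sets_subset) auto
qed

lemma sets_subset_of_measurable_id:
  assumes "(\<lambda>x. x) \<in> measurable M M'" "space M = space M'"
  shows "sets M' \<subseteq> sets M"
proof
  fix A assume A: "A \<in> sets M'"
  then have "(\<lambda>x. x) -` A \<inter> space M \<in> sets M" using assms(1) by (rule measurable_sets[rotated])
  moreover have "(\<lambda>x. x) -` A \<inter> space M = A" using sets.sets_into_space[OF A] assms(2) by auto
  ultimately show "A \<in> sets M" by simp
qed

lemma countable_base_product_topology: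
  assumes "finite I" and B: "\<And>i. i \<in> I \<Longrightarrow> countable_base (X i) (B i)"
  shows "countable_base (product_topology X I) (Pi\<^sub>E I ` Pi\<^sub>E I B)"
  unfolding countable_base_def
proof (intro conjI ballI allI impI)
  show "countable (Pi\<^sub>E I ` Pi\<^sub>E I B)"
    using assms by (intro countable_image countable_PiE) (auto simp: countable_base_def)
next
  fix V assume "V \<in> Pi\<^sub>E I ` Pi\<^sub>E I B"
  then obtain F where F: "F \<in> Pi\<^sub>E I B" "V = Pi\<^sub>E I F" by auto
  have "openin (X i) (F i)" if "i \<in> I" for i
    using B[OF that] F(1) that by (auto simp: countable_base_def PiE_def Pi_def)
  then show "openin (product_topology X I) V"
    using \<open>finite I\<close> F by (simp add: openin_PiE)
next
  fix U x assume "openin (product_topology X I) U \<and> x \<in> U"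
  then obtain W where W: "\<And>i. i \<in> I \<Longrightarrow> openin (X i) (W i)" "x \<in> Pi\<^sub>E I W" "Pi\<^sub>E I W \<subseteq> U"
    unfolding openin_product_topology_alt by metis
  have "\<forall>i\<in>I. \<exists>V\<in>B i. x i \<in> V \<and> V \<subseteq> W i"
    using B W unfolding countable_base_def by (meson PiE_mem)
  then obtain F where F: "\<And>i. i \<in> I \<Longrightarrow> F i \<in> B i \<and> x i \<in> F i \<and> F i \<subseteq> W i" by metis
  have "Pi\<^sub>E I (restrict F I) \<in> Pi\<^sub>E I ` Pi\<^sub>E I B" using F by (intro imageI) auto
  moreover have "x \<in> Pi\<^sub>E I (restrict F I)" using F W(2) by (auto simp: PiE_def Pi_def)
  moreover have "Pi\<^sub>E I (restrict F I) \<subseteq> U"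
    using F W(3) by (intro subset_trans[OF PiE_mono W(3)]) auto
  ultimately show "\<exists>V\<in>Pi\<^sub>E I ` Pi\<^sub>E I B. x \<in> V \<and> V \<subseteq> U" by blast
qed

lemma countable_base_prod_topology:
  assumes "countable_base S A" "countable_base T B"
  shows "countable_base (prod_topology S T) ((\<lambda>(U, V). U \<times> V) ` (A \<times> B))"
  unfolding countable_base_def
proof (intro conjI ballI allI impI)
  show "countable ((\<lambda>(U, V). U \<times> V) ` (A \<times> B))"
    using assms by (auto simp: countable_base_def)
next
  fix V assume "V \<in> (\<lambda>(U, V). U \<times> V) ` (A \<times> B)"
  then show "openin (prod_topology S T) V"
    using assms by (auto simp: countable_base_def openin_prod_Times_iff)
next
  fix W z assume W: "openin (prod_topology S T) W \<and> z \<in> W"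
  obtain x y where z: "z = (x, y)" by (cases z)
  with W obtain U V where UV: "openin S U" "openin T V" "x \<in> U" "y \<in> V" "U \<times> V \<subseteq> W"
    unfolding openin_prod_topology_alt by blast
  obtain U' where "U' \<in> A" "x \<in> U'" "U' \<subseteq> U" using assms(1) UV by (meson countable_base_def)
  moreover obtain V' where "V' \<in> B" "y \<in> V'" "V' \<subseteq> V" using assms(2) UV by (meson countable_base_def)
  ultimately show "\<exists>V\<in>(\<lambda>(U, V). U \<times> V) ` (A \<times> B). z \<in> V \<and> V \<subseteq> W"
    using UV z by (intro bexI[of _ "U' \<times> V'"]) auto
qed

lemma second_countable_path_topology:
  assumes "\<And>t. t \<in> {1..n} \<Longrightarrow> second_countable (X t)"
  shows "second_countable (path_topology X n)"
proof -
  have "\<forall>t\<in>{1..n}. \<exists>B. countable_base (X t) B" using assms by (simp add: second_countable_iff_base)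
  then obtain B where "\<And>t. t \<in> {1..n} \<Longrightarrow> countable_base (X t) (B t)" by metis
  then show ?thesis
    using countable_base_product_topology[of "{1..n}" X B]
    by (auto simp: second_countable_iff_base path_topology_def)
qed

lemma sets_path_space_eq_borel:
  assumes "\<And>t. t \<in> {1..n} \<Longrightarrow> second_countable (X t)"
  shows "sets (path_space X n) = sets (borel_of (path_topology X n))"
proof
  have "\<forall>t\<in>{1..n}. \<exists>B. countable_base (X t) B" using assms by (simp add: second_countable_iff_base)
  then obtain B where B: "\<And>t. t \<in> {1..n} \<Longrightarrow> countable_base (X t) (B t)" by metis
  have "Pi\<^sub>E {1..n} F \<in> sets (path_space X n)" if F: "F \<in> Pi\<^sub>E {1..n} B" for F
    unfolding path_space_def
  proof (rule sets_PiM_I_finite)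
    fix t assume t: "t \<in> {1..n}"
    then have "openin (X t) (F t)" using B[OF t] PiE_mem[OF F t] by (simp add: countable_base_def)
    then show "F t \<in> sets (borel_of (X t))" by (rule openin_sets_borel_of)
  qed simp
  then show "sets (borel_of (path_topology X n)) \<subseteq> sets (path_space X n)"
    unfolding path_topology_def
    by (intro sets_borel_of_subset[OF countable_base_product_topology[OF _ B]])
       (auto simp: path_space_def space_PiM)
next
  have sp: "space (borel_of (path_topology X n)) = space (path_space X n)"
    by (simp add: path_space_def path_topology_def space_PiM)
  have "(\<lambda>x. x) \<in> measurable (borel_of (path_topology X n)) (path_space X n)"
    unfolding path_space_def
  proof (rule measurable_PiM_single')
    fix t assume "t \<in> {1..n}"
    then show "(\<lambda>x. x t) \<in> measurable (borel_of (path_topology X n)) (borel_of (X t))"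
      unfolding path_topology_def
      by (intro continuous_map_measurable_borel_of continuous_map_product_projection)
  qed (auto simp: path_topology_def)
  then show "sets (path_space X n) \<subseteq> sets (borel_of (path_topology X n))"
    using sp by (rule sets_subset_of_measurable_id)
qed

lemma sets_borel_of_prod_topology:
  assumes "second_countable S" "second_countable T"
  shows "sets (borel_of S \<Otimes>\<^sub>M borel_of T) = sets (borel_of (prod_topology S T))"
proof
  obtain A B where AB: "countable_base S A" "countable_base T B"
    using assms by (auto simp: second_countable_iff_base)
  have "U \<times> V \<in> sets (borel_of S \<Otimes>\<^sub>M borel_of T)" if "U \<in> A" "V \<in> B" for U V
    using AB that by (intro pair_measureI openin_sets_borel_of) (auto simp: countable_base_def)
  then show "sets (borel_of (prod_topology S T)) \<subseteq> sets (borel_of S \<Otimes>\<^sub>M borel_of T)"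
    by (intro sets_borel_of_subset[OF countable_base_prod_topology[OF AB]])
       (auto simp: space_pair_measure)
next
  have sp: "space (borel_of (prod_topology S T)) = space (borel_of S \<Otimes>\<^sub>M borel_of T)"
    by (simp add: space_pair_measure)
  have "(\<lambda>z. (fst z, snd z)) \<in> measurable (borel_of (prod_topology S T)) (borel_of S \<Otimes>\<^sub>M borel_of T)"
    by (intro measurable_Pair continuous_map_measurable_borel_of continuous_map_fst continuous_map_snd)
  then have "(\<lambda>z. z) \<in> measurable (borel_of (prod_topology S T)) (borel_of S \<Otimes>\<^sub>M borel_of T)"
    by simp
  then show "sets (borel_of S \<Otimes>\<^sub>M borel_of T) \<subseteq> sets (borel_of (prod_topology S T))"
    using sp by (rule sets_subset_of_measurable_id)
qed

lemma sets_path_space_pair_eq_borel: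
  assumes "\<And>t. t \<in> {1..m} \<Longrightarrow> second_countable (X t)"
      and "\<And>t. t \<in> {1..n} \<Longrightarrow> second_countable (Y t)"
  shows "sets (path_space X m \<Otimes>\<^sub>M path_space Y n) =
         sets (borel_of (prod_topology (path_topology X m) (path_topology Y n)))"
proof -
  have "sets (path_space X m \<Otimes>\<^sub>M path_space Y n) =
        sets (borel_of (path_topology X m) \<Otimes>\<^sub>M borel_of (path_topology Y n))"
    using assms by (intro sets_pair_measure_cong sets_path_space_eq_borel)
  also have "\<dots> = sets (borel_of (prod_topology (path_topology X m) (path_topology Y n)))"
    using assms by (intro sets_borel_of_prod_topology second_countable_path_topology)
  finally show ?thesis .
qed


section \<open>Conditional laws and conditional independence\<close>

text \<open>
  \<open>\<kappa>\<close> is a version of the regular conditional law, under \<open>\<mu>\<close>, of the \<open>t\<close>-th coordinate given the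
  first \<open>t - 1\<close> coordinates. The sigma-algebra generated by a map \<open>f\<close> into \<open>M'\<close> is
  \<open>vimage_algebra (space M) f M'\<close>.
\<close>

definition regular_cond_law ::
  "(nat \<Rightarrow> 'a topology) \<Rightarrow> (nat \<Rightarrow> 'a) measure \<Rightarrow> nat \<Rightarrow> ((nat \<Rightarrow> 'a) \<Rightarrow> 'a measure) \<Rightarrow> bool" where
  "regular_cond_law X \<mu> t \<kappa> \<longleftrightarrow>
     \<kappa> \<in> measurable (path_space X (t - 1)) (prob_algebra (borel_of (X t))) \<and>
     (\<forall>A\<in>sets (borel_of (X t)). AE x in \<mu>.
        measure (\<kappa> (restrict x {1..t-1})) A =
        real_cond_exp \<mu>
          (vimage_algebra (space \<mu>) (\<lambda>x. restrict x {1..t-1}) (path_space X (t - 1)))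
          (indicator {x \<in> space \<mu>. x t \<in> A}) x)"

text \<open>Conditional independence, under \<open>M\<close>, of \<open>f\<close> (into \<open>A\<close>) and \<open>g\<close> (into \<open>B\<close>) given \<open>h\<close> (into \<open>C\<close>).\<close>

definition cond_indep_given ::
  "'w measure \<Rightarrow> 'a measure \<Rightarrow> ('w \<Rightarrow> 'a) \<Rightarrow> 'b measure \<Rightarrow> ('w \<Rightarrow> 'b) \<Rightarrow>
     'c measure \<Rightarrow> ('w \<Rightarrow> 'c) \<Rightarrow> bool" where
  "cond_indep_given M A f B g C h \<longleftrightarrow>
     (let F = vimage_algebra (space M) h C in
      \<forall>S\<in>sets A. \<forall>T\<in>sets B. AE w in M.
        real_cond_exp M F (indicator {w \<in> space M. f w \<in> S \<and> g w \<in> T}) w =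
        real_cond_exp M F (indicator {w \<in> space M. f w \<in> S}) w *
        real_cond_exp M F (indicator {w \<in> space M. g w \<in> T}) w)"


section \<open>Couplings and primal problems\<close>

datatype version = Regular | Causal | Anticausal | Bicausal

type_synonym ('a, 'b) paths = "(nat \<Rightarrow> 'a) \<times> (nat \<Rightarrow> 'b)"

definition couplings ::
  "(nat \<Rightarrow> 'a) measure \<Rightarrow> (nat \<Rightarrow> 'b) measure \<Rightarrow> ('a, 'b) paths measure set" where
  "couplings \<mu> \<nu> = {\<pi>. prob_space \<pi> \<and> sets \<pi> = sets (\<mu> \<Otimes>\<^sub>M \<nu>) \<and>
                       distr \<pi> \<mu> fst = \<mu> \<and> distr \<pi> \<nu> snd = \<nu>}"

definition causal ::
  "nat \<Rightarrow> (nat \<Rightarrow> 'a topology) \<Rightarrow> (nat \<Rightarrow> 'b topology) \<Rightarrow> ('a, 'b) paths measure \<Rightarrow> bool" where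
  "causal N X Y \<pi> \<longleftrightarrow>
     (\<forall>t\<in>{1..N-1}. cond_indep_given \<pi>
        (borel_of (X (t + 1))) (\<lambda>(x, y). x (t + 1))
        (path_space Y t) (\<lambda>(x, y). restrict y {1..t})
        (path_space X t) (\<lambda>(x, y). restrict x {1..t}))"

definition anticausal ::
  "nat \<Rightarrow> (nat \<Rightarrow> 'a topology) \<Rightarrow> (nat \<Rightarrow> 'b topology) \<Rightarrow> ('a, 'b) paths measure \<Rightarrow> bool" where
  "anticausal N X Y \<pi> \<longleftrightarrow>
     (\<forall>t\<in>{1..N-1}. cond_indep_given \<pi>
        (borel_of (Y (t + 1))) (\<lambda>(x, y). y (t + 1))
        (path_space X t) (\<lambda>(x, y). restrict x {1..t})
        (path_space Y t) (\<lambda>(x, y). restrict y {1..t}))"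

fun couplings_of ::
  "version \<Rightarrow> nat \<Rightarrow> (nat \<Rightarrow> 'a topology) \<Rightarrow> (nat \<Rightarrow> 'b topology) \<Rightarrow>
     (nat \<Rightarrow> 'a) measure \<Rightarrow> (nat \<Rightarrow> 'b) measure \<Rightarrow> ('a, 'b) paths measure set" where
  "couplings_of Regular N X Y \<mu> \<nu> = couplings \<mu> \<nu>"
| "couplings_of Causal N X Y \<mu> \<nu> = {\<pi> \<in> couplings \<mu> \<nu>. causal N X Y \<pi>}"
| "couplings_of Anticausal N X Y \<mu> \<nu> = {\<pi> \<in> couplings \<mu> \<nu>. anticausal N X Y \<pi>}"
| "couplings_of Bicausal N X Y \<mu> \<nu> = {\<pi> \<in> couplings \<mu> \<nu>. causal N X Y \<pi> \<and> anticausal N X Y \<pi>}"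

text \<open>
  The library constant \<open>KL_divergence\<close> is a Bochner integral, hence \<open>0\<close> when the log-density is not
  integrable and meaningless without absolute continuity; the extended-real version is needed here.
  The integral of the negative part is always finite, so no indeterminate difference arises.
\<close>

definition KL :: "'a measure \<Rightarrow> 'a measure \<Rightarrow> ereal" where
  "KL \<pi> P =
     (if absolutely_continuous P \<pi>
      then enn2ereal (\<integral>\<^sup>+ z. ennreal (ln (enn2real (RN_deriv P \<pi> z))) \<partial>\<pi>) -
           enn2ereal (\<integral>\<^sup>+ z. ennreal (- ln (enn2real (RN_deriv P \<pi> z))) \<partial>\<pi>)
      else \<infinity>)"

definition transport_value ::
  "version \<Rightarrow> nat \<Rightarrow> (nat \<Rightarrow> 'a topology) \<Rightarrow> (nat \<Rightarrow> 'b topology) \<Rightarrow>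
     (nat \<Rightarrow> 'a) measure \<Rightarrow> (nat \<Rightarrow> 'b) measure \<Rightarrow> (('a, 'b) paths \<Rightarrow> real) \<Rightarrow> ereal" where
  "transport_value v N X Y \<mu> \<nu> c =
     (INF \<pi>\<in>couplings_of v N X Y \<mu> \<nu>. ereal (\<integral>z. c z \<partial>\<pi>))"

definition entropic_value ::
  "version \<Rightarrow> nat \<Rightarrow> (nat \<Rightarrow> 'a topology) \<Rightarrow> (nat \<Rightarrow> 'b topology) \<Rightarrow> ('a, 'b) paths measure \<Rightarrow> real \<Rightarrow>
     (nat \<Rightarrow> 'a) measure \<Rightarrow> (nat \<Rightarrow> 'b) measure \<Rightarrow> (('a, 'b) paths \<Rightarrow> real) \<Rightarrow> ereal" where
  "entropic_value v N X Y P \<epsilon> \<mu> \<nu> c =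
     (INF \<pi>\<in>couplings_of v N X Y \<mu> \<nu>. ereal (\<integral>z. c z \<partial>\<pi>) + ereal \<epsilon> * KL \<pi> P)"


section \<open>Dual function spaces\<close>

definition bounded_measurable :: "'a measure \<Rightarrow> ('a \<Rightarrow> real) set" where
  "bounded_measurable M = {f \<in> borel_measurable M. bounded (f ` space M)}"

definition S_X :: "nat \<Rightarrow> (nat \<Rightarrow> 'a topology) \<Rightarrow> (('a, 'b) paths \<Rightarrow> real) set" where
  "S_X N X = {(\<lambda>(x, y). f x) | f. f \<in> bounded_measurable (path_space X N)}"

definition S_Y :: "nat \<Rightarrow> (nat \<Rightarrow> 'b topology) \<Rightarrow> (('a, 'b) paths \<Rightarrow> real) set" where
  "S_Y N Y = {(\<lambda>(x, y). g y) | g. g \<in> bounded_measurable (path_space Y N)}"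

definition A_X ::
  "(nat \<Rightarrow> 'a topology) \<Rightarrow> (nat \<Rightarrow> 'b topology) \<Rightarrow> (nat \<Rightarrow> (nat \<Rightarrow> 'a) \<Rightarrow> 'a measure) \<Rightarrow> nat \<Rightarrow>
     (('a, 'b) paths \<Rightarrow> real) set" where
  "A_X X Y \<kappa> t =
     (if t = 1 then {(\<lambda>(x, y). f (x 1)) | f. f \<in> bounded_measurable (borel_of (X 1))}
      else {(\<lambda>(x, y).
               a (restrict x {1..t}, restrict y {1..t-1}) -
               (\<integral>x'. a ((restrict x {1..t-1})(t := x'), restrict y {1..t-1})
                  \<partial>\<kappa> t (restrict x {1..t-1})))
            | a. a \<in> bounded_measurable (path_space X t \<Otimes>\<^sub>M path_space Y (t - 1))})"

definition A_Y ::
  "(nat \<Rightarrow> 'a topology) \<Rightarrow> (nat \<Rightarrow> 'b topology) \<Rightarrow> (nat \<Rightarrow> (nat \<Rightarrow> 'b) \<Rightarrow> 'b measure) \<Rightarrow> nat \<Rightarrow>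
     (('a, 'b) paths \<Rightarrow> real) set" where
  "A_Y X Y \<kappa> t =
     (if t = 1 then {(\<lambda>(x, y). g (y 1)) | g. g \<in> bounded_measurable (borel_of (Y 1))}
      else {(\<lambda>(x, y).
               a (restrict x {1..t-1}, restrict y {1..t}) -
               (\<integral>y'. a (restrict x {1..t-1}, (restrict y {1..t-1})(t := y'))
                  \<partial>\<kappa> t (restrict y {1..t-1})))
            | a. a \<in> bounded_measurable (path_space X (t - 1) \<Otimes>\<^sub>M path_space Y t)})"

definition S_X_adapted ::
  "nat \<Rightarrow> (nat \<Rightarrow> 'a topology) \<Rightarrow> (nat \<Rightarrow> 'b topology) \<Rightarrow> (nat \<Rightarrow> (nat \<Rightarrow> 'a) \<Rightarrow> 'a measure) \<Rightarrow>
     (('a, 'b) paths \<Rightarrow> real) set" where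
  "S_X_adapted N X Y \<kappa> = {(\<lambda>z. \<Sum>t=1..N. f t z) | f. \<forall>t\<in>{1..N}. f t \<in> A_X X Y \<kappa> t}"

definition S_Y_adapted ::
  "nat \<Rightarrow> (nat \<Rightarrow> 'a topology) \<Rightarrow> (nat \<Rightarrow> 'b topology) \<Rightarrow> (nat \<Rightarrow> (nat \<Rightarrow> 'b) \<Rightarrow> 'b measure) \<Rightarrow>
     (('a, 'b) paths \<Rightarrow> real) set" where
  "S_Y_adapted N X Y \<kappa> = {(\<lambda>z. \<Sum>t=1..N. g t z) | g. \<forall>t\<in>{1..N}. g t \<in> A_Y X Y \<kappa> t}"

definition fun_sum :: "('z \<Rightarrow> real) set \<Rightarrow> ('z \<Rightarrow> real) set \<Rightarrow> ('z \<Rightarrow> real) set" where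
  "fun_sum F G = {(\<lambda>z. f z + g z) | f g. f \<in> F \<and> g \<in> G}"

fun dual_space ::
  "version \<Rightarrow> nat \<Rightarrow> (nat \<Rightarrow> 'a topology) \<Rightarrow> (nat \<Rightarrow> 'b topology) \<Rightarrow>
     (nat \<Rightarrow> (nat \<Rightarrow> 'a) \<Rightarrow> 'a measure) \<Rightarrow> (nat \<Rightarrow> (nat \<Rightarrow> 'b) \<Rightarrow> 'b measure) \<Rightarrow>
     (('a, 'b) paths \<Rightarrow> real) set" where
  "dual_space Regular N X Y \<kappa> \<eta> = fun_sum (S_X N X) (S_Y N Y)"
| "dual_space Causal N X Y \<kappa> \<eta> = fun_sum (S_X_adapted N X Y \<kappa>) (S_Y N Y)"
| "dual_space Anticausal N X Y \<kappa> \<eta> = fun_sum (S_X N X) (S_Y_adapted N X Y \<eta>)"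
| "dual_space Bicausal N X Y \<kappa> \<eta> = fun_sum (S_X_adapted N X Y \<kappa>) (S_Y_adapted N X Y \<eta>)"

end

theory Submission
  imports Defs
begin

text \<open>
  Both identities come from one Fenchel duality on the space of bounded measurable functions. Put
  \<open>F h = sup (h - c)\<close> for transport and \<open>F h = \<epsilon> \<integral> exp ((h - c) / \<epsilon>) dP\<close> for the entropic problem. If
  \<open>D\<close> bounds the dual objective \<open>\<integral> s dP - F s\<close>, Hahn--Banach gives a positive linear functional \<open>L\<close> with
  \<open>L s = \<integral> s dP\<close> on the dual space and \<open>L h \<le> F h + D\<close> for all \<open>h\<close>.

  In the entropic case the growth bound makes \<open>L\<close> absolutely continuous with respect to \<open>P\<close>, hence
  a measure, and testing with \<open>h = c + \<epsilon> ln (d\<pi> / dP)\<close>, truncated, bounds the relative entropy. For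
  transport, \<open>L\<close> is only finitely additive, but its marginals are tight, so that it agrees on rectangles
  with a measure \<open>\<pi>\<close>; open sets are countable unions of rectangles, so \<open>\<integral> c d\<pi> \<le> L c\<close> for
  continuous \<open>c\<close>. No compactness of the set of couplings is needed, since causality only involves
  integrals of functions \<open>f(x) 1\<^sub>B(y)\<close> (or with \<open>x\<close> and \<open>y\<close> exchanged), on which \<open>L\<close> and \<open>\<pi>\<close> agree.
\<close>


section \<open>Hahn--Banach and Fenchel duality on spaces of functions\<close>

text \<open>Functions in the dual spaces are merely measurable, so the pairing of continuous
  functions with measures does not see the equations \<open>L s = \<integral> s dP\<close> directly.
  Hence \<open>L\<close> lives on all bounded measurable functions, where Hahn--Banach needs no
  topology but may return a functional without countable additivity. The two problems pay for this
  differently: the exponential in the entropic \<open>F\<close> controls \<open>L\<close> on sets of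
  small \<open>P\<close>-measure, whereas the supremum in the transport \<open>F\<close> does not,
  and there only the marginals are known. Both problems share the fact that all plans of a given
  version assign the same integral to each dual function. The product \<open>P\<close> is such a
  plan, because its two paths are independent, and weak duality becomes the integration of a
  pointwise inequality. Conversely, functions of one path enter an adapted dual space only as sums
  of innovations, so the marginal of \<open>L\<close> is recovered one coordinate at a time, by
  splitting a function into an innovation and a function of the shorter past.\<close>

definition fun_space :: "('z \<Rightarrow> real) set \<Rightarrow> bool" where
  "fun_space V \<longleftrightarrow> (\<lambda>z. 0) \<in> V \<and> (\<forall>f\<in>V. \<forall>g\<in>V. \<forall>a b. (\<lambda>z. a * f z + b * g z) \<in> V)"

lemma fun_spaceD:
  assumes "fun_space V"
  shows fun_space_zero: "(\<lambda>z. 0) \<in> V"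
    and fun_space_lincomb: "\<And>f g a b. f \<in> V \<Longrightarrow> g \<in> V \<Longrightarrow> (\<lambda>z. a * f z + b * g z) \<in> V"
    and fun_space_add: "\<And>f g. f \<in> V \<Longrightarrow> g \<in> V \<Longrightarrow> (\<lambda>z. f z + g z) \<in> V"
    and fun_space_diff: "\<And>f g. f \<in> V \<Longrightarrow> g \<in> V \<Longrightarrow> (\<lambda>z. f z - g z) \<in> V"
    and fun_space_cmult: "\<And>f a. f \<in> V \<Longrightarrow> (\<lambda>z. a * f z) \<in> V"
    and fun_space_uminus: "\<And>f. f \<in> V \<Longrightarrow> (\<lambda>z. - f z) \<in> V"
proof -
  have *: "(\<lambda>z. a * f z + b * g z) \<in> V" if "f \<in> V" "g \<in> V" for f g a b
    using assms that unfolding fun_space_def by blast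
  show "(\<lambda>z. 0) \<in> V" using assms unfolding fun_space_def by blast
  show "(\<lambda>z. a * f z + b * g z) \<in> V" if "f \<in> V" "g \<in> V" for f g a b using * that .
  show "(\<lambda>z. f z + g z) \<in> V" if "f \<in> V" "g \<in> V" for f g using *[OF that, of 1 1] by simp
  show "(\<lambda>z. f z - g z) \<in> V" if "f \<in> V" "g \<in> V" for f g using *[OF that, of 1 "-1"] by simp
  show "(\<lambda>z. a * f z) \<in> V" if "f \<in> V" for f a using *[OF that that, of a 0] by simp
  show "(\<lambda>z. - f z) \<in> V" if "f \<in> V" for f using *[OF that that, of "-1" 0] by simp
qed

definition sublinear_on :: "('z \<Rightarrow> real) set \<Rightarrow> (('z \<Rightarrow> real) \<Rightarrow> real) \<Rightarrow> bool" where
  "sublinear_on V q \<longleftrightarrow> (\<forall>f\<in>V. \<forall>g\<in>V. q (\<lambda>z. f z + g z) \<le> q f + q g) \<and>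
     (\<forall>f\<in>V. \<forall>a>0. q (\<lambda>z. a * f z) \<le> a * q f)"

definition linear_on :: "('z \<Rightarrow> real) set \<Rightarrow> (('z \<Rightarrow> real) \<Rightarrow> real) \<Rightarrow> bool" where
  "linear_on V L \<longleftrightarrow> (\<forall>f\<in>V. \<forall>g\<in>V. \<forall>a b. L (\<lambda>z. a * f z + b * g z) = a * L f + b * L g)"

lemma linear_onD:
  assumes "linear_on V L" "f \<in> V"
  shows linear_on_lincomb: "\<And>g a b. g \<in> V \<Longrightarrow> L (\<lambda>z. a * f z + b * g z) = a * L f + b * L g"
    and linear_on_add: "\<And>g. g \<in> V \<Longrightarrow> L (\<lambda>z. f z + g z) = L f + L g"
    and linear_on_diff: "\<And>g. g \<in> V \<Longrightarrow> L (\<lambda>z. f z - g z) = L f - L g"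
    and linear_on_cmult: "\<And>a. L (\<lambda>z. a * f z) = a * L f"
    and linear_on_uminus: "L (\<lambda>z. - f z) = - L f"
    and linear_on_zero: "L (\<lambda>z. 0) = 0"
proof -
  have *: "L (\<lambda>z. a * f z + b * g z) = a * L f + b * L g" if "g \<in> V" for g a b
    using assms that unfolding linear_on_def by blast
  show "L (\<lambda>z. a * f z + b * g z) = a * L f + b * L g" if "g \<in> V" for g a b using *[OF that] .
  show "L (\<lambda>z. f z + g z) = L f + L g" if "g \<in> V" for g using *[OF that, of 1 1] by simp
  show "L (\<lambda>z. f z - g z) = L f - L g" if "g \<in> V" for g using *[OF that, of 1 "-1"] by simp
  show "L (\<lambda>z. a * f z) = a * L f" for a using *[OF assms(2), of a 0] by simp
  show "L (\<lambda>z. - f z) = - L f" using *[OF assms(2), of "-1" 0] by simp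
  show "L (\<lambda>z. 0) = 0" using *[OF assms(2), of 0 0] by simp
qed

text \<open>Homogeneity is assumed only as an inequality; the same inequality with factor
  \<open>inverse a\<close>, applied to \<open>a * f\<close>, is its converse.\<close>

lemma sublinear_on_cmult:
  assumes V: "fun_space V" and q: "sublinear_on V q" and f: "f \<in> V" and a: "(a::real) > 0"
  shows "q (\<lambda>z. a * f z) = a * q f"
proof (rule antisym)
  show "q (\<lambda>z. a * f z) \<le> a * q f" using q f a by (auto simp: sublinear_on_def)
  have "q (\<lambda>z. inverse a * (a * f z)) \<le> inverse a * q (\<lambda>z. a * f z)"
    using q[unfolded sublinear_on_def, THEN conjunct2, rule_format, OF fun_space_cmult[OF V f, of a],
      of "inverse a"] a by simp
  moreover have "(\<lambda>z. inverse a * (a * f z)) = f" using a by (auto simp: field_simps)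
  ultimately show "a * q f \<le> q (\<lambda>z. a * f z)" using a by (simp add: field_simps)
qed

lemma sublinear_on_zero:
  assumes "fun_space V" "sublinear_on V q"
  shows "q (\<lambda>z. 0) = 0"
  using sublinear_on_cmult[OF assms fun_space_zero[OF assms(1)], of 2] by simp

lemma sublinear_on_add:
  assumes "sublinear_on V q" "f \<in> V" "g \<in> V"
  shows "q (\<lambda>z. f z + g z) \<le> q f + q g"
  using assms by (auto simp: sublinear_on_def)

lemma sublinear_on_uminus:
  assumes "fun_space V" "sublinear_on V q" "f \<in> V"
  shows "- q (\<lambda>z. - f z) \<le> q f"
  using sublinear_on_add[OF assms(2,3) fun_space_uminus[OF assms(1,3)]]
    sublinear_on_zero[OF assms(1,2)] by simp

text \<open>Oddness reverses subadditivity: writing \<open>f = (f + g) + (- g)\<close> gives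
  \<open>q f \<le> q (f + g) - q g\<close>. Negative scalars are likewise reduced to positive
  ones.\<close>

lemma sublinear_on_odd_imp_linear_on:
  assumes V: "fun_space V" and q: "sublinear_on V q"
    and odd: "\<And>f. f \<in> V \<Longrightarrow> q (\<lambda>z. - f z) \<le> - q f"
  shows "linear_on V q"
proof -
  have minus: "q (\<lambda>z. - f z) = - q f" if "f \<in> V" for f
    using odd[OF that] sublinear_on_uminus[OF V q that] by simp
  have add: "q (\<lambda>z. f z + g z) = q f + q g" if f: "f \<in> V" and g: "g \<in> V" for f g
  proof -
    have "q (\<lambda>z. (f z + g z) + - g z) \<le> q (\<lambda>z. f z + g z) + q (\<lambda>z. - g z)"
      by (intro sublinear_on_add[OF q] fun_space_add[OF V] fun_space_uminus[OF V] f g)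
    then show ?thesis using minus[OF g] sublinear_on_add[OF q f g] by simp
  qed
  have cmult: "q (\<lambda>z. a * f z) = a * q f" if f: "f \<in> V" for f a
  proof -
    consider "a > 0" | "a = 0" | "a < 0" by linarith
    then show ?thesis
    proof cases
      case 3
      have "q (\<lambda>z. - ((- a) * f z)) = - ((- a) * q f)"
        using minus[OF fun_space_cmult[OF V f, of "- a"]] sublinear_on_cmult[OF V q f, of "- a"] 3 by simp
      then show ?thesis by simp
    qed (use sublinear_on_cmult[OF V q f] sublinear_on_zero[OF V q] in auto)
  qed
  show ?thesis
    unfolding linear_on_def using add cmult fun_space_cmult[OF V] by auto
qed

text \<open>A minimal sublinear functional is linear: otherwise some direction \<open>y\<close> makes
  \<open>f \<mapsto> INF t\<ge>0. m (f + t y) - t m y\<close> strictly smaller.\<close>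

theorem sublinear_dominates_linear:
  fixes q :: "('z \<Rightarrow> real) \<Rightarrow> real"
  assumes V: "fun_space V" and q: "sublinear_on V q"
  obtains L where "linear_on V L" "\<And>f. f \<in> V \<Longrightarrow> L f \<le> q f"
proof -
  \<comment> \<open>Outside \<open>V\<close> the value is fixed to 0; free values there could always
    be lowered, and no element would be minimal in the pointwise order.\<close>
  define S where "S = {r. sublinear_on V r \<and> (\<forall>f\<in>V. r f \<le> q f) \<and> (\<forall>f. f \<notin> V \<longrightarrow> r f = 0)}"
  \<comment> \<open>The order is reversed: Zorn's lemma in this form yields maximal elements, and a
    minimal functional is wanted.\<close>
  define R where "R = (\<lambda>(r :: ('z \<Rightarrow> real) \<Rightarrow> real) r'. \<forall>f. r' f \<le> r f)"
  \<comment> \<open>A bound independent of \<open>r\<close>; it makes the infimum over a chain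
    finite.\<close>
  have lower: "- q (\<lambda>z. - f z) \<le> r f" if "r \<in> S" "f \<in> V" for r f
  proof -
    have "- q (\<lambda>z. - f z) \<le> - r (\<lambda>z. - f z)"
      using that fun_space_uminus[OF V that(2)] by (auto simp: S_def)
    also have "\<dots> \<le> r f" using that by (intro sublinear_on_uminus[OF V]) (auto simp: S_def)
    finally show ?thesis .
  qed
  have "\<exists>m\<in>S. \<forall>a\<in>S. R m a \<longrightarrow> a = m"
  proof (rule predicate_Zorn)
    show "partial_order_on S (relation_of R S)"
      unfolding partial_order_on_def preorder_on_def refl_on_def trans_def antisym_def relation_of_def R_def
      by (auto intro: order_trans intro!: ext antisym)
  next
    fix C assume C: "C \<in> Chains (relation_of R S)"
    have CS: "C \<subseteq> S" using C by (auto simp: Chains_def relation_of_def)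
    have chain: "(\<forall>f. r f \<le> r' f) \<or> (\<forall>f. r' f \<le> r f)" if "r \<in> C" "r' \<in> C" for r r'
      using C that by (auto simp: Chains_def relation_of_def R_def)
    show "\<exists>u\<in>S. \<forall>a\<in>C. R a u"
    proof (cases "C = {}")
      case True
      have "(\<lambda>f. if f \<in> V then q f else 0) \<in> S"
        using q fun_space_add[OF V] fun_space_cmult[OF V] by (auto simp: S_def sublinear_on_def)
      then show ?thesis using True by auto
    next
      case False
      define u where "u = (\<lambda>f. INF r\<in>C. r f)"
      have bdd: "bdd_below ((\<lambda>r. r f) ` C)" for f
      proof (cases "f \<in> V")
        case True then show ?thesis using lower CS by (intro bdd_belowI) auto
      next
        case False then show ?thesis using CS by (intro bdd_belowI[of _ 0]) (auto simp: S_def)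
      qed
      have le: "u f \<le> r f" if "r \<in> C" for r f
        unfolding u_def using that bdd by (rule cINF_lower[rotated])
      have "u (\<lambda>z. f z + g z) \<le> u f + u g" if fg: "f \<in> V" "g \<in> V" for f g
      proof -
        \<comment> \<open>Two members of a chain are comparable, so the smaller one bounds both
          values at once and its subadditivity applies.\<close>
        have *: "u (\<lambda>z. f z + g z) \<le> r1 f + r2 g" if r: "r1 \<in> C" "r2 \<in> C" for r1 r2
        proof -
          obtain r where "r \<in> C" "r f \<le> r1 f" "r g \<le> r2 g" using chain[OF r] r by blast
          moreover have "r (\<lambda>z. f z + g z) \<le> r f + r g"
            using \<open>r \<in> C\<close> CS fg by (intro sublinear_on_add[of V]) (auto simp: S_def)
          ultimately show ?thesis using le[OF \<open>r \<in> C\<close>, of "\<lambda>z. f z + g z"] by linarith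
        qed
        have "u (\<lambda>z. f z + g z) - r1 f \<le> u g" if "r1 \<in> C" for r1
          unfolding fun_cong[OF u_def, of g] using *[OF that] False
          by (intro cINF_greatest) (auto simp: algebra_simps)
        then have "u (\<lambda>z. f z + g z) - u g \<le> u f"
          unfolding fun_cong[OF u_def, of f] using False
          by (intro cINF_greatest) (auto simp: algebra_simps)
        then show ?thesis by simp
      qed
      moreover have "u (\<lambda>z. a * f z) \<le> a * u f" if f: "f \<in> V" and a: "a > 0" for f a
      proof -
        have "u (\<lambda>z. a * f z) / a \<le> r f" if "r \<in> C" for r
        proof -
          have "u (\<lambda>z. a * f z) \<le> r (\<lambda>z. a * f z)" using le[OF that] .
          also have "\<dots> \<le> a * r f" using that CS f a by (auto simp: S_def sublinear_on_def)
          finally show ?thesis using a by (simp add: field_simps)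
        qed
        then have "u (\<lambda>z. a * f z) / a \<le> u f"
          unfolding fun_cong[OF u_def, of f] using False by (intro cINF_greatest) auto
        then show ?thesis using a by (simp add: field_simps)
      qed
      ultimately have "sublinear_on V u" by (simp add: sublinear_on_def)
      moreover have "u f \<le> q f" if "f \<in> V" for f
      proof -
        obtain r where r: "r \<in> C" using False by auto
        then have "r f \<le> q f" using CS that by (auto simp: S_def)
        then show ?thesis using le[OF r, of f] by linarith
      qed
      moreover have "u f = 0" if "f \<notin> V" for f
      proof -
        have "(\<lambda>r. r f) ` C = (\<lambda>r. 0) ` C"
          using CS that by (intro image_cong) (auto simp: S_def)
        then show ?thesis using False by (simp add: u_def)
      qed
      ultimately have "u \<in> S" by (simp add: S_def)
      then show ?thesis using le by (auto simp: R_def)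
    qed
  qed
  then obtain m where mS: "m \<in> S" and min: "\<And>a. a \<in> S \<Longrightarrow> (\<And>f. a f \<le> m f) \<Longrightarrow> a = m"
    by (auto simp: R_def)
  have m: "sublinear_on V m" using mS by (simp add: S_def)
  have odd: "m (\<lambda>z. - y z) \<le> - m y" if y: "y \<in> V" for y
  proof -
    define A where "A = (\<lambda>f. (\<lambda>t. m (\<lambda>z. f z + t * y z) - t * m y) ` {0..})"
    define my where "my = (\<lambda>f. if f \<in> V then Inf (A f) else 0)"
    have mty: "m (\<lambda>z. t * y z) = t * m y" if "t \<ge> 0" for t
      using sublinear_on_cmult[OF V m y, of t] sublinear_on_zero[OF V m] that by (cases "t = 0") auto
    have bdd: "bdd_below (A f)" if f: "f \<in> V" for f
    proof (rule bdd_belowI[of _ "- m (\<lambda>z. - f z)"])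
      fix x assume "x \<in> A f"
      then obtain t where t: "t \<ge> 0" "x = m (\<lambda>z. f z + t * y z) - t * m y" by (auto simp: A_def)
      have "m (\<lambda>z. (f z + t * y z) + - f z) \<le> m (\<lambda>z. f z + t * y z) + m (\<lambda>z. - f z)"
        by (intro sublinear_on_add[OF m] fun_space_add[OF V] fun_space_uminus[OF V] fun_space_cmult[OF V] f y)
      then show "- m (\<lambda>z. - f z) \<le> x" using t mty[OF t(1)] by simp
    qed
    have le: "my f \<le> m (\<lambda>z. f z + t * y z) - t * m y" if "f \<in> V" "t \<ge> 0" for f t
    proof -
      have "Inf (A f) \<le> m (\<lambda>z. f z + t * y z) - t * m y"
        by (rule cInf_lower[OF _ bdd[OF that(1)]]) (use that in \<open>auto simp: A_def\<close>)
      then show ?thesis using that by (simp add: my_def)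
    qed
    have greatest: "x \<le> my f"
      if "f \<in> V" "\<And>t. t \<ge> 0 \<Longrightarrow> x \<le> m (\<lambda>z. f z + t * y z) - t * m y" for f x
    proof -
      have "x \<le> Inf (A f)" by (rule cInf_greatest) (use that in \<open>auto simp: A_def\<close>)
      then show ?thesis using that by (simp add: my_def)
    qed
    have "my (\<lambda>z. f z + g z) \<le> my f + my g" if fg: "f \<in> V" "g \<in> V" for f g
    proof -
      \<comment> \<open>The parameters add up: the competitor \<open>t + t'\<close> for
        \<open>f + g\<close> splits into the competitor \<open>t\<close> for \<open>f\<close> and
        \<open>t'\<close> for \<open>g\<close>.\<close>
      have *: "my (\<lambda>z. f z + g z) \<le>
          (m (\<lambda>z. f z + t * y z) - t * m y) + (m (\<lambda>z. g z + t' * y z) - t' * m y)"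
        if t: "t \<ge> 0" "t' \<ge> 0" for t t'
      proof -
        have "my (\<lambda>z. f z + g z) \<le> m (\<lambda>z. (f z + g z) + (t + t') * y z) - (t + t') * m y"
          using t fg by (intro le fun_space_add[OF V]) auto
        also have "(\<lambda>z. (f z + g z) + (t + t') * y z) = (\<lambda>z. (f z + t * y z) + (g z + t' * y z))"
          by (auto simp: algebra_simps)
        also have "m \<dots> \<le> m (\<lambda>z. f z + t * y z) + m (\<lambda>z. g z + t' * y z)"
          using fg y by (intro sublinear_on_add[OF m] fun_space_add[OF V] fun_space_cmult[OF V])
        finally show ?thesis by (simp add: algebra_simps)
      qed
      have "my (\<lambda>z. f z + g z) - my g \<le> my f"
      proof (rule greatest[OF fg(1)])
        fix t :: real assume t: "t \<ge> 0"
        have "my (\<lambda>z. f z + g z) - (m (\<lambda>z. f z + t * y z) - t * m y) \<le> my g"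
          by (rule greatest[OF fg(2)]) (use *[OF t] in \<open>simp add: algebra_simps\<close>)
        then show "my (\<lambda>z. f z + g z) - my g \<le> m (\<lambda>z. f z + t * y z) - t * m y" by simp
      qed
      then show ?thesis by simp
    qed
    moreover have "my (\<lambda>z. a * f z) \<le> a * my f" if f: "f \<in> V" and a: "a > 0" for f a
    proof -
      have "my (\<lambda>z. a * f z) / a \<le> my f"
      proof (rule greatest[OF f])
        fix t :: real assume t: "t \<ge> 0"
        have "my (\<lambda>z. a * f z) \<le> m (\<lambda>z. a * f z + (a * t) * y z) - (a * t) * m y"
          using t a by (intro le fun_space_cmult[OF V f]) auto
        also have "(\<lambda>z. a * f z + (a * t) * y z) = (\<lambda>z. a * (f z + t * y z))"
          by (auto simp: algebra_simps)
        also have "m \<dots> = a * m (\<lambda>z. f z + t * y z)"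
          by (intro sublinear_on_cmult[OF V m] fun_space_add[OF V] fun_space_cmult[OF V] f y a)
        finally show "my (\<lambda>z. a * f z) / a \<le> m (\<lambda>z. f z + t * y z) - t * m y"
          using a by (simp add: field_simps)
      qed
      then show ?thesis using a by (simp add: field_simps)
    qed
    ultimately have "sublinear_on V my" by (simp add: sublinear_on_def)
    moreover have my_le: "my f \<le> m f" for f
      using le[of f 0] mS by (cases "f \<in> V") (auto simp: my_def S_def)
    moreover have "my f \<le> q f" if "f \<in> V" for f
      using my_le[of f] mS that by (auto simp: S_def intro: order_trans)
    ultimately have "my \<in> S" by (simp add: S_def my_def)
    then have "my = m" using my_le by (rule min)
    \<comment> \<open>Minimality has identified \<open>my\<close> with \<open>m\<close>. The choice
      \<open>t = 1\<close> cancels \<open>- y\<close>, so the first term on the right is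
      \<open>m 0 = 0\<close>.\<close>
    then have "m (\<lambda>z. - y z) \<le> m (\<lambda>z. - y z + 1 * y z) - 1 * m y"
      using le[OF fun_space_uminus[OF V y], of 1] by simp
    then show ?thesis using sublinear_on_zero[OF V m] by simp
  qed
  show thesis
  proof (rule that)
    show "linear_on V m" using V m odd by (rule sublinear_on_odd_imp_linear_on)
    show "m f \<le> q f" if "f \<in> V" for f using mS that by (auto simp: S_def)
  qed
qed

text \<open>Lets \<open>t\<close> tend to 0 in the homogenised bounds of the Fenchel argument;
  dividing by \<open>\<bar>C\<bar> + 1\<close> covers \<open>C = 0\<close> and either sign.\<close>

lemma le_if_le_add_small_multiple:
  fixes x y C :: real
  assumes "\<And>t. t > 0 \<Longrightarrow> x \<le> t * C + y"
  shows "x \<le> y"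
proof (rule field_le_epsilon)
  fix e :: real assume e: "e > 0"
  have "x \<le> e / (\<bar>C\<bar> + 1) * C + y" using e by (intro assms) auto
  also have "e / (\<bar>C\<bar> + 1) * C \<le> e"
    using e by (simp add: divide_le_eq) (smt (verit) mult_left_mono)
  finally show "x \<le> y + e" by simp
qed

text \<open>Functions are total on the type, but measures see only their values on
  \<open>\<Omega>\<close>. Positivity applied to \<open>g - f\<close> makes a linear functional
  blind to everything outside.\<close>

lemma linear_on_cong_positive:
  assumes V: "fun_space V" and L: "linear_on V L"
    and pos: "\<And>f. f \<in> V \<Longrightarrow> (\<And>z. z \<in> \<Omega> \<Longrightarrow> 0 \<le> f z) \<Longrightarrow> 0 \<le> L f"
    and fg: "f \<in> V" "g \<in> V"
  shows linear_on_mono_positive: "(\<And>z. z \<in> \<Omega> \<Longrightarrow> f z \<le> g z) \<Longrightarrow> L f \<le> L g"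
    and linear_on_eq_positive: "(\<And>z. z \<in> \<Omega> \<Longrightarrow> f z = g z) \<Longrightarrow> L f = L g"
proof -
  have *: "L f \<le> L g" if fg: "f \<in> V" "g \<in> V" and "\<And>z. z \<in> \<Omega> \<Longrightarrow> f z \<le> g z" for f g
    using pos[OF fun_space_diff[OF V fg(2,1)]] linear_on_diff[OF L fg(2,1)] that(3) by simp
  show "L f \<le> L g" if "\<And>z. z \<in> \<Omega> \<Longrightarrow> f z \<le> g z" using * fg that .
  show "L f = L g" if "\<And>z. z \<in> \<Omega> \<Longrightarrow> f z = g z" using *[of f g] *[of g f] fg that by fastforce
qed

text \<open>Fenchel duality for \<open>h \<mapsto> inf {F (h + s) - l s | s \<in> H}\<close>: the functional \<open>L\<close> lies below the
  directional derivative at \<open>0\<close> of this convex function, relaxed by replacing its value at \<open>0\<close>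
  with the smaller number \<open>- D\<close>.\<close>

theorem fenchel_duality:
  fixes V H :: "('z \<Rightarrow> real) set" and \<Omega> :: "'z set" and F l :: "('z \<Rightarrow> real) \<Rightarrow> real"
  assumes V: "fun_space V" and Vconst: "\<And>k. (\<lambda>z. k) \<in> V"
    and Vbdd: "\<And>f. f \<in> V \<Longrightarrow> \<exists>K. \<forall>z\<in>\<Omega>. \<bar>f z\<bar> \<le> K"
    and HV: "H \<subseteq> V" and Hconst: "\<And>k. \<exists>w\<in>H. \<forall>z\<in>\<Omega>. w z = k"
    and Hlin: "\<And>s u a b. s \<in> H \<Longrightarrow> u \<in> H \<Longrightarrow> \<exists>w\<in>H. \<forall>z\<in>\<Omega>. w z = a * s z + b * u z"
    and l: "linear_on V l" and lpos: "\<And>f. f \<in> V \<Longrightarrow> (\<And>z. z \<in> \<Omega> \<Longrightarrow> 0 \<le> f z) \<Longrightarrow> 0 \<le> l f"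
    and lone: "l (\<lambda>z. 1) = 1"
    and Fmono: "\<And>f g. f \<in> V \<Longrightarrow> g \<in> V \<Longrightarrow> (\<And>z. z \<in> \<Omega> \<Longrightarrow> f z \<le> g z) \<Longrightarrow> F f \<le> F g"
    and Fconv: "\<And>f g a b. f \<in> V \<Longrightarrow> g \<in> V \<Longrightarrow> a > 0 \<Longrightarrow> b > 0 \<Longrightarrow> a + b = 1 \<Longrightarrow>
                  F (\<lambda>z. a * f z + b * g z) \<le> a * F f + b * F g"
    and D: "\<And>s. s \<in> H \<Longrightarrow> l s - F s \<le> D"
  obtains L where "linear_on V L" "\<And>f. f \<in> V \<Longrightarrow> (\<And>z. z \<in> \<Omega> \<Longrightarrow> 0 \<le> f z) \<Longrightarrow> 0 \<le> L f"
    "\<And>s. s \<in> H \<Longrightarrow> L s = l s" "\<And>f. f \<in> V \<Longrightarrow> L f \<le> F f + D"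
proof -
  \<comment> \<open>With \<open>r = inverse t\<close> this is
    \<open>(F (r h + s) - l s + D) / r\<close>, a difference quotient at 0 with \<open>- D\<close>
    in place of the value there. As a perspective of \<open>F\<close> it is jointly convex in
    \<open>h\<close>, \<open>t\<close> and \<open>t s\<close>, so its infimum \<open>q\<close> is
    sublinear.\<close>
  define val where "val = (\<lambda>h t s. t * (F (\<lambda>z. inverse t * h z + s z) - l s + D))"
  define q where "q = (\<lambda>h. INF p\<in>{0<..}\<times>H. val h (fst p) (snd p))"
  obtain s0 where s0: "s0 \<in> H" using Hconst by blast
  have Hne: "{0::real<..}\<times>H \<noteq> {}" using s0 by (auto intro: exI[of _ 1])
  have shift: "(\<lambda>z. a * h z + s z) \<in> V" if "h \<in> V" "s \<in> H" for h s a
    using fun_space_lincomb[OF V that(1), of s a 1] HV that by auto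
  have lcong: "l f = l g" if "f \<in> V" "g \<in> V" "\<And>z. z \<in> \<Omega> \<Longrightarrow> f z = g z" for f g
    using linear_on_eq_positive[OF V l lpos that] .
  have lconst: "l (\<lambda>z. k) = k" for k using linear_on_cmult[OF l Vconst[of 1], of k] lone by simp
  \<comment> \<open>Finiteness of \<open>q\<close> is what the dual bound \<open>D\<close> provides:
    it is applied to an element of \<open>H\<close> equal to \<open>s - K / t\<close>, which lies
    below \<open>h / t + s\<close>.\<close>
  have val_lower: "- K \<le> val h t s"
    if h: "h \<in> V" and K: "\<And>z. z \<in> \<Omega> \<Longrightarrow> \<bar>h z\<bar> \<le> K" and t: "t > 0" and s: "s \<in> H" for h K t s
  proof -
    obtain k where k: "k \<in> H" "\<forall>z\<in>\<Omega>. k z = 1" using Hconst by blast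
    obtain w where w: "w \<in> H" "\<forall>z\<in>\<Omega>. w z = 1 * s z + (- K / t) * k z" using Hlin[OF s k(1)] by blast
    have "l w = l (\<lambda>z. 1 * s z + (- K / t) * 1)"
      using w k HV s Vconst by (intro lcong fun_space_lincomb[OF V]) auto
    also have "\<dots> = l s - K / t" using linear_on_lincomb[OF l _ Vconst, of s 1 "- K / t" 1] s HV lone by auto
    finally have "l s - K / t - F w \<le> D" using D[OF w(1)] by simp
    moreover have "F w \<le> F (\<lambda>z. inverse t * h z + s z)"
    proof (rule Fmono)
      fix z assume z: "z \<in> \<Omega>"
      have "- K \<le> h z" using K[OF z] by simp
      then have "inverse t * (- K) \<le> inverse t * h z" using t by (intro mult_left_mono) auto
      moreover have "w z = s z + inverse t * (- K)" using w k z by (simp add: divide_inverse)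
      ultimately show "w z \<le> inverse t * h z + s z" by simp
    qed (use w HV shift h s in auto)
    ultimately have "- (K / t) \<le> F (\<lambda>z. inverse t * h z + s z) - l s + D" by simp
    then have "t * (- (K / t)) \<le> val h t s" unfolding val_def using t by (intro mult_left_mono) auto
    then show ?thesis using t by simp
  qed
  have bdd: "bdd_below ((\<lambda>p. val h (fst p) (snd p)) ` ({0<..}\<times>H))" if "h \<in> V" for h
  proof -
    obtain K where "\<forall>z\<in>\<Omega>. \<bar>h z\<bar> \<le> K" using Vbdd[OF \<open>h \<in> V\<close>] by blast
    then show ?thesis using val_lower[OF that, of K] by (intro bdd_belowI[of _ "- K"]) auto
  qed
  have q_le: "q h \<le> val h t s" if "h \<in> V" "t > 0" "s \<in> H" for h t s
    using cINF_lower[OF bdd[OF that(1)], of "(t, s)"] that by (simp add: q_def)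
  have q_ge: "x \<le> q h" if "\<And>t s. t > 0 \<Longrightarrow> s \<in> H \<Longrightarrow> x \<le> val h t s" for x h
    unfolding q_def using that Hne by (intro cINF_greatest) auto
  have "q (\<lambda>z. f z + g z) \<le> q f + q g" if fg: "f \<in> V" "g \<in> V" for f g
  proof -
    have *: "q (\<lambda>z. f z + g z) \<le> val f t s + val g t' s'"
      if t: "t > 0" "t' > 0" and s: "s \<in> H" "s' \<in> H" for t t' s s'
    proof -
      \<comment> \<open>Convex weights proportional to \<open>t\<close> and \<open>t'\<close>. With
        them both \<open>a / t\<close> and \<open>b / t'\<close> equal \<open>1 / T\<close>, so the
        two arguments of \<open>F\<close> combine to \<open>(f + g) / T + w\<close>.\<close>
      define T a b where "T = t + t'" and "a = t / T" and "b = t' / T"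
      have "a + b = T / T" by (simp add: T_def a_def b_def flip: add_divide_distrib)
      then have T: "T > 0" and ab: "a > 0" "b > 0" "a + b = 1" "T * a = t" "T * b = t'"
        "a * inverse t = inverse T" "b * inverse t' = inverse T"
        using t by (auto simp: T_def a_def b_def field_simps)
      obtain w where w: "w \<in> H" "\<forall>z\<in>\<Omega>. w z = a * s z + b * s' z" using Hlin[OF s] by blast
      have lw: "l w = a * l s + b * l s'"
      proof -
        have "l w = l (\<lambda>z. a * s z + b * s' z)"
          using w s HV by (intro lcong fun_space_lincomb[OF V]) auto
        then show ?thesis using linear_on_lincomb[OF l, of s s'] s HV by auto
      qed
      have "F (\<lambda>z. inverse T * (f z + g z) + w z) \<le>
            F (\<lambda>z. a * (inverse t * f z + s z) + b * (inverse t' * g z + s' z))"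
      proof (rule Fmono)
        fix z assume z: "z \<in> \<Omega>"
        have "a * (inverse t * f z + s z) + b * (inverse t' * g z + s' z) =
              (a * inverse t) * f z + (b * inverse t') * g z + (a * s z + b * s' z)"
          by (simp add: algebra_simps)
        also have "\<dots> = inverse T * (f z + g z) + w z" using w z ab by (simp add: algebra_simps)
        finally show "inverse T * (f z + g z) + w z \<le>
          a * (inverse t * f z + s z) + b * (inverse t' * g z + s' z)" by simp
      qed (use w fg s shift fun_space_add[OF V] fun_space_lincomb[OF V] in auto)
      also have "\<dots> \<le> a * F (\<lambda>z. inverse t * f z + s z) + b * F (\<lambda>z. inverse t' * g z + s' z)"
        using fg s ab by (intro Fconv shift) auto
      finally have "T * (F (\<lambda>z. inverse T * (f z + g z) + w z) - l w + D) \<le>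
          T * (a * F (\<lambda>z. inverse t * f z + s z) + b * F (\<lambda>z. inverse t' * g z + s' z) - l w + (a + b) * D)"
        using T ab by (intro mult_left_mono) auto
      also have "\<dots> = (T * a) * (F (\<lambda>z. inverse t * f z + s z) - l s + D) +
          (T * b) * (F (\<lambda>z. inverse t' * g z + s' z) - l s' + D)"
        unfolding lw by (simp add: algebra_simps)
      also have "\<dots> = val f t s + val g t' s'" using ab by (simp add: val_def)
      finally show ?thesis
        using q_le[OF fun_space_add[OF V fg] T w(1)] by (simp add: val_def)
    qed
    have "q (\<lambda>z. f z + g z) - q g \<le> q f"
    proof (rule q_ge)
      fix t s assume ts: "(t::real) > 0" "s \<in> H"
      have "q (\<lambda>z. f z + g z) - val f t s \<le> q g" using *[OF ts(1) _ ts(2)] by (intro q_ge) (simp add: algebra_simps)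
      then show "q (\<lambda>z. f z + g z) - q g \<le> val f t s" by simp
    qed
    then show ?thesis by simp
  qed
  moreover have "q (\<lambda>z. a * f z) \<le> a * q f" if f: "f \<in> V" and a: "a > 0" for f a
  proof -
    have "q (\<lambda>z. a * f z) / a \<le> q f"
    proof (rule q_ge)
      fix t s assume ts: "(t::real) > 0" "s \<in> H"
      have "q (\<lambda>z. a * f z) \<le> val (\<lambda>z. a * f z) (a * t) s"
        using ts a by (intro q_le fun_space_cmult[OF V f]) auto
      also have "\<dots> = a * val f t s"
      proof -
        have "(\<lambda>z. inverse (a * t) * (a * f z) + s z) = (\<lambda>z. inverse t * f z + s z)"
          using a by (auto simp: field_simps)
        then show ?thesis by (simp add: val_def)
      qed
      finally show "q (\<lambda>z. a * f z) / a \<le> val f t s" using a by (simp add: field_simps)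
    qed
    then show ?thesis using a by (simp add: field_simps)
  qed
  ultimately have "sublinear_on V q" by (simp add: sublinear_on_def)
  then obtain L where L: "linear_on V L" and Lq: "\<And>f. f \<in> V \<Longrightarrow> L f \<le> q f"
    using sublinear_dominates_linear[OF V] by blast
  \<comment> \<open>The value of \<open>val\<close> at \<open>h = 0\<close>, \<open>t = 1\<close>,
    \<open>s = s0\<close>. The error terms below are \<open>t * C\<close> and vanish as
    \<open>t\<close> tends to 0.\<close>
  define C where "C = F s0 - l s0 + D"
  have s0V: "s0 \<in> V" using s0 HV by auto
  have Lpos: "0 \<le> L f" if f: "f \<in> V" "\<And>z. z \<in> \<Omega> \<Longrightarrow> 0 \<le> f z" for f
  proof -
    have "L (\<lambda>z. - f z) \<le> 0"
    proof (rule le_if_le_add_small_multiple[where C = C])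
      fix t :: real assume t: "t > 0"
      have mf: "(\<lambda>z. - f z) \<in> V" using fun_space_uminus[OF V f(1)] .
      have "L (\<lambda>z. - f z) \<le> val (\<lambda>z. - f z) t s0" using Lq[OF mf] q_le[OF mf t s0] by simp
      also have "\<dots> \<le> t * C"
        unfolding val_def C_def
        using t mf s0 s0V shift[OF mf s0, of "inverse t"] f(2)
        by (intro mult_left_mono add_right_mono diff_right_mono Fmono) auto
      finally show "L (\<lambda>z. - f z) \<le> t * C + 0" by simp
    qed
    then show ?thesis using linear_on_uminus[OF L f(1)] by simp
  qed
  have Lle: "L s \<le> l s" if s: "s \<in> H" for s
  proof (rule le_if_le_add_small_multiple[where C = C])
    fix t :: real assume t: "t > 0"
    have sV: "s \<in> V" using s HV by auto
    \<comment> \<open>Subtracting \<open>s / t\<close> from \<open>s0\<close> cancels the summand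
      \<open>s / t\<close> in the argument of \<open>F\<close>, leaving \<open>F s0\<close>, while
      \<open>- t * l w\<close> contributes exactly the wanted \<open>l s\<close>.\<close>
    obtain w where w: "w \<in> H" "\<forall>z\<in>\<Omega>. w z = 1 * s0 z + (- inverse t) * s z" using Hlin[OF s0 s] by blast
    have "l w = l (\<lambda>z. 1 * s0 z + (- inverse t) * s z)"
      using w sV s0V HV by (intro lcong fun_space_lincomb[OF V]) auto
    also have "\<dots> = l s0 - inverse t * l s" using linear_on_lincomb[OF l s0V sV, of 1 "- inverse t"] by simp
    finally have lw: "l w = l s0 - inverse t * l s" .
    have "L s \<le> val s t w" using Lq[OF sV] q_le[OF sV t w(1)] by simp
    also have "\<dots> \<le> t * (F s0 - l w + D)"
      unfolding val_def
      using t shift[OF sV w(1), of "inverse t"] s0V w(2)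
      by (intro mult_left_mono add_right_mono diff_right_mono Fmono) auto
    also have "\<dots> = t * C + l s" using t unfolding lw C_def by (simp add: field_simps)
    finally show "L s \<le> t * C + l s" .
  qed
  show thesis
  proof (rule that[OF L])
    show "0 \<le> L f" if "f \<in> V" "\<And>z. z \<in> \<Omega> \<Longrightarrow> 0 \<le> f z" for f using Lpos that .
    show "L s = l s" if s: "s \<in> H" for s
    proof (rule antisym[OF Lle[OF s]])
      have sV: "s \<in> V" using s HV by auto
      \<comment> \<open>The reverse inequality is the same bound for \<open>- s\<close>, which
        \<open>H\<close> contains up to its values on \<open>\<Omega>\<close>.\<close>
      obtain w where w: "w \<in> H" "\<forall>z\<in>\<Omega>. w z = (-1) * s z + 0 * s z" using Hlin[OF s s] by blast
      have "L w = L (\<lambda>z. - s z)"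
        using w sV HV by (intro linear_on_eq_positive[OF V L Lpos] fun_space_uminus[OF V]) auto
      moreover have "l w = l (\<lambda>z. - s z)"
        using w sV HV by (intro lcong fun_space_uminus[OF V]) auto
      ultimately show "l s \<le> L s"
        using Lle[OF w(1)] linear_on_uminus[OF L sV] linear_on_uminus[OF l sV] by simp
    qed
    show "L f \<le> F f + D" if f: "f \<in> V" for f
    proof -
      obtain w where w: "w \<in> H" "\<forall>z\<in>\<Omega>. w z = 0" using Hconst by blast
      have "l w = 0" using lcong[of w "\<lambda>z. 0"] w HV Vconst lconst by auto
      \<comment> \<open>Taking \<open>t = 1\<close> and the zero function of \<open>H\<close> turns
        the bound by \<open>q\<close> into the bound by \<open>F f + D\<close>.\<close>
      have "L f \<le> val f 1 w" using Lq[OF f] q_le[OF f _ w(1), of 1] by simp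
      also have "\<dots> = F (\<lambda>z. inverse 1 * f z + w z) + D" using \<open>l w = 0\<close> by (simp add: val_def)
      also have "\<dots> \<le> F f + D"
        using f w(2) shift[OF f w(1), of "inverse 1"] by (intro add_right_mono Fmono) auto
      finally show ?thesis .
    qed
  qed
qed


section \<open>Tightness on Polish spaces\<close>

lemma closedin_sets_borel_of:
  assumes "closedin T C" shows "C \<in> sets (borel_of T)"
proof -
  have "C = space (borel_of T) - (space (borel_of T) - C)" using closedin_subset[OF assms] by auto
  moreover have "space (borel_of T) - C \<in> sets (borel_of T)"
    using assms by (simp add: closedin_def openin_sets_borel_of)
  ultimately show ?thesis by (metis sets.compl_sets)
qed

text \<open>The sets with such approximations form a sigma-algebra: complements exchange the closed
  and the open approximant. Open sets qualify because in a metrizable space they are increasing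
  unions of closed sets.\<close>

lemma (in finite_measure) borel_of_closed_open_regular:
  assumes T: "metrizable_space T" and sets: "sets M = sets (borel_of T)"
    and A: "A \<in> sets M" and e: "e > 0"
  shows "\<exists>C U. closedin T C \<and> openin T U \<and> C \<subseteq> A \<and> A \<subseteq> U \<and> measure M (U - C) < e"
proof -
  have sp: "space M = topspace T" using sets_eq_imp_space_eq[OF sets] by simp
  have om: "U \<in> sets M" if "openin T U" for U using that by (simp add: sets openin_sets_borel_of)
  have cm: "C \<in> sets M" if "closedin T C" for C
    unfolding sets by (rule closedin_sets_borel_of[OF that])
  have "A \<in> sigma_sets (topspace T) {U. openin T U}" using A sets by (simp add: sets_borel_of)
  then have "\<forall>e>0. \<exists>C U. closedin T C \<and> openin T U \<and> C \<subseteq> A \<and> A \<subseteq> U \<and> measure M (U - C) < e"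
  proof induction
    case (Basic U)
    then have U: "openin T U" by simp
    then obtain C where C: "\<And>n. closedin T (C n)" "\<And>n. C n \<subseteq> C (Suc n)" "\<Union> (range C) = U"
      using open_imp_fsigma_in[OF T] unfolding fsigma_in_ascending by metis
    have "(\<lambda>n. measure M (U - C n)) \<longlonglongrightarrow> measure M (\<Inter>n. U - C n)"
      using C om[OF U] cm by (intro finite_Lim_measure_decseq decseq_SucI) auto
    moreover have "(\<Inter>n. U - C n) = {}" using C by auto
    ultimately have lim: "(\<lambda>n. measure M (U - C n)) \<longlonglongrightarrow> 0" by (simp only: measure_empty)
    show ?case
    proof (intro allI impI)
      fix e :: real assume "e > 0"
      then obtain n where "measure M (U - C n) < e"
        using order_tendstoD(2)[OF lim, of e] by (auto simp: eventually_sequentially)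
      then show "\<exists>C V. closedin T C \<and> openin T V \<and> C \<subseteq> U \<and> U \<subseteq> V \<and> measure M (V - C) < e"
        using C U by (intro exI[of _ "C n"] exI[of _ U]) auto
    qed
  next
    case Empty
    show ?case
    proof (intro allI impI)
      fix e :: real assume "e > 0"
      then show "\<exists>C U. closedin T C \<and> openin T U \<and> C \<subseteq> {} \<and> {} \<subseteq> U \<and> measure M (U - C) < e"
        by - (rule exI[of _ "{}"], rule exI[of _ "{}"], simp)
    qed
  next
    case (Compl A)
    show ?case
    proof (intro allI impI)
      fix e :: real assume "e > 0"
      then obtain C U where CU: "closedin T C" "openin T U" "C \<subseteq> A" "A \<subseteq> U" "measure M (U - C) < e"
        using Compl.IH by metis
      have "(topspace T - C) - (topspace T - U) = U - C" using openin_subset[OF CU(2)] by auto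
      then show "\<exists>D V. closedin T D \<and> openin T V \<and> D \<subseteq> topspace T - A \<and> topspace T - A \<subseteq> V \<and>
          measure M (V - D) < e"
        using CU by (intro exI[of _ "topspace T - U"] exI[of _ "topspace T - C"]) auto
    qed
  next
    case (Union A)
    show ?case
    proof (intro allI impI)
      fix e :: real assume e: "e > 0"
      \<comment> \<open>These errors sum to \<open>e / 2\<close>. The other half pays for truncating
        the union of the \<open>C i\<close>, since closedness is preserved by finite unions
        only.\<close>
      have "\<forall>i. \<exists>C U. closedin T C \<and> openin T U \<and> C \<subseteq> A i \<and> A i \<subseteq> U \<and>
          measure M (U - C) < e / 2 * (1/2) ^ Suc i"
        using Union.IH e by (metis half_gt_zero mult_pos_pos zero_less_power zero_less_divide_1_iff zero_less_numeral)
      then obtain C U where CU: "\<And>i. closedin T (C i)" "\<And>i. openin T (U i)" "\<And>i. C i \<subseteq> A i"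
          "\<And>i. A i \<subseteq> U i" "\<And>i. measure M (U i - C i) < e / 2 * (1/2) ^ Suc i" by metis
      have sums: "(\<lambda>i. e / 2 * (1/2) ^ Suc i) sums (e / 2)"
        using sums_mult[OF power_half_series, of "e/2"] by simp
      have summ: "summable (\<lambda>i. measure M (U i - C i))"
        by (rule summable_comparison_test'[OF sums_summable[OF sums], of 0])
           (subst real_norm_def, subst abs_of_nonneg, rule measure_nonneg, rule less_imp_le[OF CU(5)])
      have "measure M (\<Union>i. U i - C i) \<le> (\<Sum>i. measure M (U i - C i))"
        using CU om cm by (intro finite_measure_subadditive_countably summ) auto
      also have "\<dots> \<le> (\<Sum>i. e / 2 * (1/2) ^ Suc i)"
        by (intro suminf_le less_imp_le CU(5) summ sums_summable[OF sums])
      also have "\<dots> = e / 2"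
        using sums_unique[OF sums] by (rule sym)
      finally have 1: "measure M (\<Union>i. U i - C i) \<le> e / 2" .
      define Z where "Z = (\<lambda>n. (\<Union>i. C i) - (\<Union>i<n. C i))"
      have "(\<lambda>n. measure M (Z n)) \<longlonglongrightarrow> measure M (\<Inter>n. Z n)"
        using CU cm unfolding Z_def by (intro finite_Lim_measure_decseq decseq_SucI) auto
      moreover have "(\<Inter>n. Z n) = {}" unfolding Z_def by (auto intro: lessI)
      ultimately have lim: "(\<lambda>n. measure M (Z n)) \<longlonglongrightarrow> 0" by (simp only: measure_empty)
      obtain n where n: "measure M (Z n) < e / 2"
        using order_tendstoD(2)[OF lim, of "e / 2"] e by (auto simp: eventually_sequentially)
      have "measure M ((\<Union>i. U i) - (\<Union>i<n. C i)) \<le> measure M ((\<Union>i. U i - C i) \<union> Z n)"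
        using CU om cm unfolding Z_def by (intro finite_measure_mono) auto
      also have "\<dots> \<le> measure M (\<Union>i. U i - C i) + measure M (Z n)"
        using CU om cm unfolding Z_def by (intro measure_Un_le) auto
      also have "\<dots> < e" using 1 n by simp
      finally have 2: "measure M ((\<Union>i. U i) - (\<Union>i<n. C i)) < e" .
      show "\<exists>C U. closedin T C \<and> openin T U \<and> C \<subseteq> (\<Union>i. A i) \<and> (\<Union>i. A i) \<subseteq> U \<and> measure M (U - C) < e"
      proof (intro exI conjI)
        show "closedin T (\<Union>i<n. C i)" using CU by (intro closedin_Union) auto
        show "openin T (\<Union>i. U i)" using CU by (intro openin_Union) auto
        show "(\<Union>i<n. C i) \<subseteq> (\<Union>i. A i)" using CU(3) by blast
        show "(\<Union>i. A i) \<subseteq> (\<Union>i. U i)" using CU(4) by blast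
      qed (rule 2)
    qed
  qed
  then show ?thesis using e by blast
qed

text \<open>\<open>mtotally_bounded\<close> requires centres inside \<open>S\<close>. A ball meeting
  \<open>S\<close> is replaced by one around a point of \<open>S\<close>, and
  \<open>r / 3 + r / 3 < r\<close> leaves room for the move.\<close>

lemma (in Metric_space) totally_bounded_if_covered_by_balls:
  assumes SM: "S \<subseteq> M" and cov: "\<And>r. r > 0 \<Longrightarrow> \<exists>F. finite F \<and> S \<subseteq> (\<Union>x\<in>F. mcball x r)"
  shows "mtotally_bounded S"
  unfolding mtotally_bounded_def
proof (intro allI impI)
  fix r :: real assume r: "r > 0"
  obtain F where F: "finite F" "S \<subseteq> (\<Union>x\<in>F. mcball x (r / 3))" using cov[of "r / 3"] r by auto
  define G where "G = {x \<in> F. S \<inter> mcball x (r / 3) \<noteq> {}}"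
  have "\<forall>x\<in>G. \<exists>y. y \<in> S \<inter> mcball x (r / 3)" by (auto simp: G_def)
  then obtain p where p: "\<And>x. x \<in> G \<Longrightarrow> p x \<in> S \<inter> mcball x (r / 3)" by metis
  have "S \<subseteq> (\<Union>y\<in>p ` G. mball y r)"
  proof
    fix z assume z: "z \<in> S"
    then obtain x where x: "x \<in> F" "z \<in> mcball x (r / 3)" using F by auto
    then have xG: "x \<in> G" using z by (auto simp: G_def)
    have M: "x \<in> M" "z \<in> M" "p x \<in> M" using x(2) p[OF xG] SM z by auto
    have "d (p x) z \<le> d (p x) x + d x z" using M by (intro triangle)
    also have "\<dots> \<le> r / 3 + r / 3" using x(2) p[OF xG] commute[of "p x" x] by (intro add_mono) auto
    finally have "d (p x) z < r" using r by simp
    then show "z \<in> (\<Union>y\<in>p ` G. mball y r)" using xG M by auto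
  qed
  then show "\<exists>K. finite K \<and> K \<subseteq> S \<and> S \<subseteq> (\<Union>x\<in>K. mball x r)"
    using F(1) p by (intro exI[of _ "p ` G"]) (auto simp: G_def)
qed

text \<open>Ulam's theorem. Finitely many balls of radius \<open>1 / (k + 1)\<close> around a dense
  sequence carry all mass but \<open>e / 2 ^ (k + 2)\<close>. The intersection over \<open>k\<close>
  of these finite unions is closed and totally bounded, hence compact by completeness.\<close>

lemma (in finite_measure) polish_tight:
  assumes T: "polish_topology T" and sets: "sets M = sets (borel_of T)" and e: "e > 0"
  shows "\<exists>K. compactin T K \<and> measure M (space M - K) < e"
proof -
  have sp: "space M = topspace T" using sets_eq_imp_space_eq[OF sets] by simp
  obtain X d where Md: "Metric_space X d" "Metric_space.mcomplete X d" "T = Metric_space.mtopology X d"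
    using T by (auto simp: polish_topology_def completely_metrizable_space_def)
  interpret m: Metric_space X d by (rule Md)
  have TX: "topspace T = X" using Md by simp
  show ?thesis
  proof (cases "X = {}")
    case True
    then show ?thesis using e sp TX by (intro exI[of _ "{}"]) auto
  next
    case False
    obtain C where C: "countable C" "C \<subseteq> X" "T closure_of C = X"
      using second_countable_imp_separable_space[of T] T TX
      by (auto simp: polish_topology_def separable_space_def)
    have "C \<noteq> {}" using C False by auto
    define u where "u = from_nat_into C"
    have u: "range u = C" using C(1) \<open>C \<noteq> {}\<close> by (simp add: u_def range_from_nat_into)
    have cm: "F \<in> sets M" if "closedin T F" for F
      unfolding sets by (rule closedin_sets_borel_of[OF that])
    define A where "A = (\<lambda>k n. \<Union>i<n. m.mcball (u i) (1 / real (Suc k)))"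
    have Acl: "closedin T (A k n)" for k n
      unfolding A_def Md(3) by (intro closedin_Union) auto
    have "\<forall>k. \<exists>n. measure M (X - A k n) < e / 2 * (1/2) ^ Suc k"
    proof
      fix k
      have "X \<subseteq> (\<Union>n. A k n)"
      proof
        fix x assume "x \<in> X"
        then have "x \<in> m.mtopology closure_of C" using C Md by simp
        then have "\<exists>y\<in>C. y \<in> m.mcball x (1 / real (Suc k))"
          unfolding m.metric_closure_of_alt by (simp del: m.in_mcball)
        then obtain y where "y \<in> C" "y \<in> m.mcball x (1 / real (Suc k))" by blast
        moreover obtain i where "y = u i" using u \<open>y \<in> C\<close> by auto
        ultimately have "x \<in> m.mcball (u i) (1 / real (Suc k))" by (auto simp: m.commute)
        then have "x \<in> A k (Suc i)" unfolding A_def by blast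
        then show "x \<in> (\<Union>n. A k n)" by blast
      qed
      then have "(\<Inter>n. X - A k n) = {}" by auto
      moreover have "(\<lambda>n. measure M (X - A k n)) \<longlonglongrightarrow> measure M (\<Inter>n. X - A k n)"
        using cm[OF Acl] sp TX sets.top[of M] unfolding image_subset_iff
        by (intro finite_Lim_measure_decseq decseq_SucI) (auto simp: A_def)
      ultimately have lim: "(\<lambda>n. measure M (X - A k n)) \<longlonglongrightarrow> 0" by (simp only: measure_empty)
      have "e / 2 * (1/2) ^ Suc k > 0" using e by simp
      then show "\<exists>n. measure M (X - A k n) < e / 2 * (1/2) ^ Suc k"
        using order_tendstoD(2)[OF lim, of "e / 2 * (1/2) ^ Suc k"] by (auto simp: eventually_sequentially)
    qed
    then obtain n where n: "\<And>k. measure M (X - A k (n k)) < e / 2 * (1/2) ^ Suc k" by metis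
    define K where "K = (\<Inter>k. A k (n k))"
    have Kcl: "closedin T K" unfolding K_def using Acl by (intro closedin_Inter) auto
    have KX: "K \<subseteq> X" using closedin_subset[OF Kcl] TX by simp
    have "m.mtotally_bounded K"
    proof (rule m.totally_bounded_if_covered_by_balls[OF KX])
      fix r :: real assume "r > 0"
      then obtain k where k: "1 / real (Suc k) < r" using nat_approx_posE by blast
      have "K \<subseteq> A k (n k)" by (auto simp: K_def)
      also have "\<dots> \<subseteq> (\<Union>x\<in>u ` {..<n k}. m.mcball x r)"
      proof
        fix x assume "x \<in> A k (n k)"
        then obtain i where "i < n k" "x \<in> m.mcball (u i) (1 / real (Suc k))" unfolding A_def by blast
        then have "x \<in> m.mcball (u i) r" using k by (simp add: m.mcball_def)
        then show "x \<in> (\<Union>x\<in>u ` {..<n k}. m.mcball x r)" using \<open>i < n k\<close> by blast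
      qed
      finally show "\<exists>F. finite F \<and> K \<subseteq> (\<Union>x\<in>F. m.mcball x r)" by blast
    qed
    then have "compactin T (T closure_of K)"
      using m.mtotally_bounded_eq_compact_closure_of[OF Md(2)] Md(3) by simp
    then have comp: "compactin T K" using closure_of_closedin[OF Kcl] by simp
    have sums: "(\<lambda>i. e / 2 * (1/2) ^ Suc i) sums (e / 2)"
      using sums_mult[OF power_half_series, of "e/2"] by simp
    have summ: "summable (\<lambda>k. measure M (X - A k (n k)))"
      by (rule summable_comparison_test'[OF sums_summable[OF sums], of 0])
         (subst real_norm_def, subst abs_of_nonneg, rule measure_nonneg, rule less_imp_le[OF n])
    have "space M - K = (\<Union>k. X - A k (n k))" using sp TX by (auto simp: K_def)
    also have "measure M \<dots> \<le> (\<Sum>k. measure M (X - A k (n k)))"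
      using cm[OF Acl] sp TX sets.top[of M] by (intro finite_measure_subadditive_countably summ) auto
    also have "\<dots> \<le> (\<Sum>i. e / 2 * (1/2) ^ Suc i)"
      by (intro suminf_le less_imp_le n summ sums_summable[OF sums])
    also have "\<dots> = e / 2"
      using sums_unique[OF sums] by (rule sym)
    also have "\<dots> < e" using e by simp
    finally show ?thesis using comp by blast
  qed
qed

lemma polish_topology_metrizable: "polish_topology T \<Longrightarrow> metrizable_space T"
  by (simp add: polish_topology_def completely_metrizable_imp_metrizable_space)

text \<open>A closed inner approximation of \<open>A\<close>, intersected with a compact set
  carrying almost all mass, is compact and still close to \<open>A\<close>.\<close>

lemma (in finite_measure) polish_inner_regular:
  assumes T: "polish_topology T" and sets: "sets M = sets (borel_of T)"
    and A: "A \<in> sets M" and e: "e > 0"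
  shows "\<exists>K. compactin T K \<and> K \<subseteq> A \<and> measure M (A - K) < e"
proof -
  obtain C U where CU: "closedin T C" "openin T U" "C \<subseteq> A" "A \<subseteq> U" "measure M (U - C) < e / 2"
    using borel_of_closed_open_regular[OF polish_topology_metrizable[OF T] sets A, of "e / 2"] e by auto
  obtain K where K: "compactin T K" "measure M (space M - K) < e / 2"
    using polish_tight[OF T sets, of "e / 2"] e by auto
  have sp: "space M = topspace T" using sets_eq_imp_space_eq[OF sets] by simp
  have cm: "F \<in> sets M" if "closedin T F" for F
    unfolding sets by (rule closedin_sets_borel_of[OF that])
  have "closedin T K"
    using K(1) polish_topology_metrizable[OF T] metrizable_imp_Hausdorff_space compactin_imp_closedin by blast
  then have m: "K \<in> sets M" "C \<in> sets M" "U \<in> sets M" "C \<inter> K \<in> sets M"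
    using cm CU by (auto simp: sets openin_sets_borel_of)
  have "measure M (A - (C \<inter> K)) \<le> measure M ((U - C) \<union> (space M - K))"
    using m CU sets.sets_into_space[OF A] by (intro finite_measure_mono) auto
  also have "\<dots> \<le> measure M (U - C) + measure M (space M - K)"
    using m by (intro measure_Un_le) auto
  also have "\<dots> < e" using CU K by simp
  finally have "measure M (A - (C \<inter> K)) < e" .
  moreover have "compactin T (C \<inter> K)" using CU K by (intro closed_Int_compactin)
  ultimately show ?thesis using CU by (intro exI[of _ "C \<inter> K"]) auto
qed


section \<open>Positive functionals and measures\<close>

lemma bounded_measurable_iff:
  "f \<in> bounded_measurable M \<longleftrightarrow> f \<in> borel_measurable M \<and> (\<exists>K. \<forall>z\<in>space M. \<bar>f z\<bar> \<le> K)"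
  by (auto simp: bounded_measurable_def bounded_real)

lemma bounded_measurableI:
  "f \<in> borel_measurable M \<Longrightarrow> (\<And>z. z \<in> space M \<Longrightarrow> \<bar>f z\<bar> \<le> K) \<Longrightarrow> f \<in> bounded_measurable M"
  by (auto simp: bounded_measurable_iff)

lemma bounded_measurable_measurable: "f \<in> bounded_measurable M \<Longrightarrow> f \<in> borel_measurable M"
  by (simp add: bounded_measurable_def)

lemma bounded_measurable_bound:
  assumes "f \<in> bounded_measurable M"
  obtains K where "K \<ge> 0" "\<And>z. z \<in> space M \<Longrightarrow> \<bar>f z\<bar> \<le> K"
proof -
  obtain K where "\<forall>z\<in>space M. \<bar>f z\<bar> \<le> K" using assms by (auto simp: bounded_measurable_iff)
  then show thesis by (intro that[of "\<bar>K\<bar>"]) (auto intro: order_trans)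
qed

lemma bounded_measurable_const: "(\<lambda>z. k) \<in> bounded_measurable M"
  by (rule bounded_measurableI[of _ _ "\<bar>k\<bar>"]) auto

lemma bounded_measurable_indicator: "A \<in> sets M \<Longrightarrow> indicator A \<in> bounded_measurable M"
  by (rule bounded_measurableI[of _ _ 1]) (auto simp: indicator_def)

lemma bounded_measurable_mult:
  assumes "f \<in> bounded_measurable M" "g \<in> bounded_measurable M"
  shows "(\<lambda>z. f z * g z) \<in> bounded_measurable M"
proof -
  obtain K where K: "K \<ge> 0" "\<And>z. z \<in> space M \<Longrightarrow> \<bar>f z\<bar> \<le> K" using bounded_measurable_bound[OF assms(1)] by blast
  obtain K' where K': "K' \<ge> 0" "\<And>z. z \<in> space M \<Longrightarrow> \<bar>g z\<bar> \<le> K'" using bounded_measurable_bound[OF assms(2)] by blast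
  show ?thesis
  proof (rule bounded_measurableI[of _ _ "K * K'"])
    show "(\<lambda>z. f z * g z) \<in> borel_measurable M" using assms by (auto simp: bounded_measurable_def)
    show "\<bar>f z * g z\<bar> \<le> K * K'" if "z \<in> space M" for z
      unfolding abs_mult using K(1) K(2)[OF that] K'(2)[OF that] by (intro mult_mono) auto
  qed
qed

lemma fun_space_bounded_measurable: "fun_space (bounded_measurable M)"
  unfolding fun_space_def
proof (intro conjI ballI allI)
  show "(\<lambda>z. 0) \<in> bounded_measurable M" by (rule bounded_measurable_const)
  fix f g a b assume f: "f \<in> bounded_measurable M" and g: "g \<in> bounded_measurable M"
  obtain K where K: "K \<ge> 0" "\<And>z. z \<in> space M \<Longrightarrow> \<bar>f z\<bar> \<le> K" using bounded_measurable_bound[OF f] by blast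
  obtain K' where K': "K' \<ge> 0" "\<And>z. z \<in> space M \<Longrightarrow> \<bar>g z\<bar> \<le> K'" using bounded_measurable_bound[OF g] by blast
  show "(\<lambda>z. a * f z + b * g z) \<in> bounded_measurable M"
  proof (rule bounded_measurableI[of _ _ "\<bar>a\<bar> * K + \<bar>b\<bar> * K'"])
    show "(\<lambda>z. a * f z + b * g z) \<in> borel_measurable M"
      using f g by (auto simp: bounded_measurable_def)
    fix z assume z: "z \<in> space M"
    have "\<bar>a * f z + b * g z\<bar> \<le> \<bar>a\<bar> * \<bar>f z\<bar> + \<bar>b\<bar> * \<bar>g z\<bar>"
      using abs_triangle_ineq[of "a * f z" "b * g z"] by (simp add: abs_mult)
    also have "\<dots> \<le> \<bar>a\<bar> * K + \<bar>b\<bar> * K'"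
      using K(2)[OF z] K'(2)[OF z] by (intro add_mono mult_left_mono) auto
    finally show "\<bar>a * f z + b * g z\<bar> \<le> \<bar>a\<bar> * K + \<bar>b\<bar> * K'" .
  qed
qed

lemmas bounded_measurable_add = fun_space_add[OF fun_space_bounded_measurable]
  and bounded_measurable_diff = fun_space_diff[OF fun_space_bounded_measurable]
  and bounded_measurable_cmult = fun_space_cmult[OF fun_space_bounded_measurable]

lemma bounded_measurable_compose:
  assumes "f \<in> bounded_measurable N" "T \<in> measurable M N"
  shows "(\<lambda>z. f (T z)) \<in> bounded_measurable M"
proof -
  obtain K where "K \<ge> 0" "\<And>z. z \<in> space N \<Longrightarrow> \<bar>f z\<bar> \<le> K" using bounded_measurable_bound[OF assms(1)] by blast
  then show ?thesis
    using assms measurable_space[OF assms(2)] measurable_compose[OF assms(2) bounded_measurable_measurable[OF assms(1)]]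
    by (intro bounded_measurableI[of _ _ K]) auto
qed

lemma bounded_measurable_sets_cong: "sets M = sets N \<Longrightarrow> bounded_measurable M = bounded_measurable N"
  using sets_eq_imp_space_eq[of M N] measurable_cong_sets[of M N borel borel] by (auto simp: bounded_measurable_def)

lemma (in finite_measure) integrable_bounded_measurable:
  assumes "f \<in> bounded_measurable M" shows "integrable M f"
proof -
  obtain K where "K \<ge> 0" "\<And>z. z \<in> space M \<Longrightarrow> \<bar>f z\<bar> \<le> K" using bounded_measurable_bound[OF assms] by blast
  then show ?thesis using bounded_measurable_measurable[OF assms]
    by (intro integrable_const_bound[of _ K]) auto
qed

lemma (in finite_measure) linear_on_integral: "linear_on (bounded_measurable M) (\<lambda>f. \<integral>z. f z \<partial>M)"
  by (auto simp: linear_on_def integrable_bounded_measurable)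

lemma linear_on_sum:
  assumes V: "fun_space V" and L: "linear_on V L" and I: "finite I" and f: "\<And>i. i \<in> I \<Longrightarrow> f i \<in> V"
  shows "(\<lambda>z. \<Sum>i\<in>I. f i z) \<in> V \<and> L (\<lambda>z. \<Sum>i\<in>I. f i z) = (\<Sum>i\<in>I. L (f i))"
  using I f
proof (induction I)
  case empty
  then show ?case using fun_space_zero[OF V] linear_on_zero[OF L fun_space_zero[OF V]] by simp
next
  case (insert i I)
  then show ?case using fun_space_add[OF V] linear_on_add[OF L] by simp
qed

text \<open>The sum counts the positive integers below \<open>u\<close>, that is
  \<open>\<lceil>u\<rceil> - 1\<close>; the truncated subtraction gives 0 for
  \<open>u = 0\<close>.\<close>

lemma sum_indicator_levels:
  fixes u :: real
  assumes "0 \<le> u" "u \<le> real m"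
  shows "u - 1 \<le> (\<Sum>k=1..m. if real k < u then 1 else 0)"
    and "(\<Sum>k=1..m. if real k < u then 1 else 0) \<le> u"
proof -
  have "{1..m} \<inter> {k. real k < u} = {1..<nat \<lceil>u\<rceil>}"
    using assms by (auto simp: zless_nat_eq_int_zless less_ceiling_iff)
  then have eq: "(\<Sum>k=1..m. if real k < u then 1 else 0) = real (nat \<lceil>u\<rceil> - 1)"
    by (simp add: sum.If_cases)
  have "u \<le> real (nat \<lceil>u\<rceil>)" by linarith
  then show "u - 1 \<le> (\<Sum>k=1..m. if real k < u then 1 else 0)" unfolding eq by linarith
  have "real (nat \<lceil>u\<rceil>) < u + 1" using assms by linarith
  then show "(\<Sum>k=1..m. if real k < u then 1 else 0) \<le> u" unfolding eq using assms by linarith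
qed

text \<open>Layer cake: \<open>f\<close> is within \<open>1 / n\<close> of \<open>- K\<close> plus \<open>1 / n\<close> times the number of levels
  \<open>k / n - K\<close>, \<open>k \<ge> 1\<close>, that it exceeds.\<close>

lemma positive_functional_mono_level_sets:
  fixes f :: "'z \<Rightarrow> real"
  assumes L1: "linear_on (bounded_measurable M) L1"
    and pos1: "\<And>g. g \<in> bounded_measurable M \<Longrightarrow> (\<And>z. z \<in> space M \<Longrightarrow> 0 \<le> g z) \<Longrightarrow> 0 \<le> L1 g"
    and L2: "linear_on (bounded_measurable M) L2"
    and pos2: "\<And>g. g \<in> bounded_measurable M \<Longrightarrow> (\<And>z. z \<in> space M \<Longrightarrow> 0 \<le> g z) \<Longrightarrow> 0 \<le> L2 g"
    and one: "L1 (\<lambda>z. 1) = L2 (\<lambda>z. 1)"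
    and f: "f \<in> bounded_measurable M"
    and level: "\<And>a. L1 (indicator {z \<in> space M. a < f z}) \<le> L2 (indicator {z \<in> space M. a < f z})"
  shows "L1 f \<le> L2 f"
proof -
  let ?V = "bounded_measurable M"
  note V = fun_space_bounded_measurable[of M]
  obtain K where K: "K \<ge> 0" "\<And>z. z \<in> space M \<Longrightarrow> \<bar>f z\<bar> \<le> K" using bounded_measurable_bound[OF f] by blast
  have fm: "f \<in> borel_measurable M" using f by (rule bounded_measurable_measurable)
  have main: "L1 f \<le> L2 f + L1 (\<lambda>z. 1) / real n" if n: "n > 0" for n :: nat
  proof -
    \<comment> \<open>Since \<open>f + K \<le> 2 * K\<close>, no level beyond the
      \<open>m\<close>-th is exceeded, and a finite sum of indicators suffices.\<close>
    define m where "m = nat \<lceil>2 * K * real n\<rceil>"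
    define A where "A = (\<lambda>k::nat. {z \<in> space M. real k / real n - K < f z})"
    have A: "A k \<in> sets M" for k unfolding A_def using fm by measurable
    define S where "S = (\<lambda>z. \<Sum>k=1..m. indicator (A k) z :: real)"
    define g where "g = (\<lambda>z. (1 / real n) * S z + (- K) * 1)"
    have S: "S \<in> ?V" and SL: "\<And>L. linear_on ?V L \<Longrightarrow> L S = (\<Sum>k=1..m. L (indicator (A k)))"
      using linear_on_sum[OF V _ finite_atLeastAtMost, of _ 1 m "\<lambda>k. indicator (A k)"]
        bounded_measurable_indicator[OF A] L1 unfolding S_def by blast+
    have gV: "g \<in> ?V" unfolding g_def by (intro fun_space_lincomb[OF V S bounded_measurable_const])
    have gL: "L g = (1 / real n) * (\<Sum>k=1..m. L (indicator (A k))) + (- K) * L (\<lambda>z. 1)"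
      if "linear_on ?V L" for L
      unfolding g_def using linear_on_lincomb[OF that S bounded_measurable_const, of "1 / real n" "- K" 1] SL[OF that] by simp
    have bounds: "g z \<le> f z \<and> f z \<le> g z + 1 / real n" if z: "z \<in> space M" for z
    proof -
      define u where "u = real n * (f z + K)"
      have "0 \<le> f z + K" "f z + K \<le> 2 * K" using K(2)[OF z] by auto
      then have u0: "0 \<le> u" and "u \<le> real n * (2 * K)"
        unfolding u_def by (auto intro: mult_nonneg_nonneg mult_left_mono)
      then have um: "u \<le> real m" unfolding m_def by (simp add: mult.commute) linarith
      have "indicator (A k) z = (if real k < u then 1 else 0 :: real)" for k
        using z n by (auto simp: A_def u_def indicator_def field_simps)
      then have "S z = (\<Sum>k=1..m. if real k < u then 1 else 0)" by (simp add: S_def)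
      then have "u - 1 \<le> S z" "S z \<le> u" using sum_indicator_levels[OF u0 um] by auto
      then have "(u - 1) / real n \<le> S z / real n" "S z / real n \<le> u / real n"
        by (auto intro: divide_right_mono)
      moreover have "u / real n = f z + K" using n by (simp add: u_def)
      ultimately show ?thesis by (simp add: g_def diff_divide_distrib)
    qed
    have "L1 f \<le> L1 (\<lambda>z. 1 * g z + (1 / real n) * 1)"
      using bounds
      by (intro linear_on_mono_positive[OF V L1 pos1] f fun_space_lincomb[OF V gV bounded_measurable_const]) auto
    also have "\<dots> = L1 g + L1 (\<lambda>z. 1) / real n"
      using linear_on_lincomb[OF L1 gV bounded_measurable_const, of 1 "1 / real n" 1] by simp
    also have "L1 g \<le> L2 g"
      unfolding gL[OF L1] gL[OF L2] one A_def by (intro add_right_mono mult_left_mono sum_mono level) auto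
    also have "L2 g \<le> L2 f"
      using bounds by (intro linear_on_mono_positive[OF V L2 pos2] gV f) auto
    finally show ?thesis by simp
  qed
  have "(\<lambda>n. L2 f + L1 (\<lambda>z. 1) / real n) \<longlonglongrightarrow> L2 f + 0"
    by (intro tendsto_add tendsto_const lim_const_over_n)
  moreover have "\<forall>\<^sub>F n in sequentially. L1 f \<le> L2 f + L1 (\<lambda>z. 1) / real n"
    using main by (auto simp: eventually_sequentially intro!: exI[of _ 1])
  ultimately show ?thesis by (simp add: tendsto_lowerbound)
qed

text \<open>Either functional may lack countable additivity, so monotone limits are out of reach;
  uniform approximation by level sets, used in both directions, takes their place.\<close>

lemma positive_functional_eq_indicators:
  fixes f :: "'z \<Rightarrow> real"
  assumes L1: "linear_on (bounded_measurable M) L1"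
    and pos1: "\<And>g. g \<in> bounded_measurable M \<Longrightarrow> (\<And>z. z \<in> space M \<Longrightarrow> 0 \<le> g z) \<Longrightarrow> 0 \<le> L1 g"
    and L2: "linear_on (bounded_measurable M) L2"
    and pos2: "\<And>g. g \<in> bounded_measurable M \<Longrightarrow> (\<And>z. z \<in> space M \<Longrightarrow> 0 \<le> g z) \<Longrightarrow> 0 \<le> L2 g"
    and ind: "\<And>A. A \<in> sets M \<Longrightarrow> L1 (indicator A) = L2 (indicator A)"
    and f: "f \<in> bounded_measurable M"
  shows "L1 f = L2 f"
proof -
  note V = fun_space_bounded_measurable[of M]
  have "L1 (\<lambda>z. 1) = L1 (indicator (space M))"
    by (intro linear_on_eq_positive[OF V L1 pos1] bounded_measurable_const bounded_measurable_indicator) auto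
  moreover have "L2 (\<lambda>z. 1) = L2 (indicator (space M))"
    by (intro linear_on_eq_positive[OF V L2 pos2] bounded_measurable_const bounded_measurable_indicator) auto
  ultimately have one: "L1 (\<lambda>z. 1) = L2 (\<lambda>z. 1)" using ind by simp
  have level: "L1 (indicator {z \<in> space M. a < f z}) = L2 (indicator {z \<in> space M. a < f z})" for a
    using bounded_measurable_measurable[OF f] by (intro ind) measurable
  show ?thesis
    by (rule antisym[OF
        positive_functional_mono_level_sets[OF L1 pos1 L2 pos2 one f eq_refl[OF level]]
        positive_functional_mono_level_sets[OF L2 pos2 L1 pos1 one[symmetric] f eq_refl[OF level[symmetric]]]])
qed

text \<open>Caratheodory extension from an algebra on which \<open>L\<close> is continuous at the
  empty set. Agreement is claimed only on \<open>\<A>\<close>: elsewhere \<open>L\<close> and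
  \<open>\<pi>\<close> may differ. In the entropic problem \<open>\<A>\<close> is the whole
  sigma-algebra, in the transport problem a generating algebra.\<close>

lemma measure_of_positive_functional:
  fixes P :: "'z measure" and L :: "('z \<Rightarrow> real) \<Rightarrow> real"
  assumes L: "linear_on (bounded_measurable P) L"
    and pos: "\<And>f. f \<in> bounded_measurable P \<Longrightarrow> (\<And>z. z \<in> space P \<Longrightarrow> 0 \<le> f z) \<Longrightarrow> 0 \<le> L f"
    and one: "L (\<lambda>z. 1) = 1"
    and \<A>: "algebra (space P) \<A>" "\<A> \<subseteq> sets P" "sets P \<subseteq> sigma_sets (space P) \<A>"
    and cont: "\<And>E. range E \<subseteq> \<A> \<Longrightarrow> decseq E \<Longrightarrow> (\<Inter>i. E i) = {} \<Longrightarrow> (\<lambda>i. L (indicator (E i))) \<longlonglongrightarrow> 0"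
  obtains \<pi> where "prob_space \<pi>" "sets \<pi> = sets P" "\<And>E. E \<in> \<A> \<Longrightarrow> measure \<pi> E = L (indicator E)"
proof -
  interpret algebra "space P" \<A> by (rule \<A>)
  note V = fun_space_bounded_measurable[of P]
  have ind: "indicator E \<in> bounded_measurable P" if "E \<in> \<A>" for E
    using that \<A>(2) by (intro bounded_measurable_indicator) auto
  have nn: "0 \<le> L (indicator E)" if "E \<in> \<A>" for E using pos[OF ind[OF that]] by simp
  define m where "m = (\<lambda>E. ennreal (L (indicator E)))"
  have emp: "L (indicator {}) = 0"
    using linear_on_zero[OF L bounded_measurable_const[of 0]] by (simp add: indicator_def[abs_def])
  have "\<exists>\<mu>. (\<forall>s\<in>\<A>. \<mu> s = m s) \<and> measure_space (space P) (sigma_sets (space P) \<A>) \<mu>"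
  proof (rule caratheodory_empty_continuous)
    show "positive \<A> m" using emp by (simp add: positive_def m_def)
    show "additive \<A> m"
      unfolding additive_def
    proof (intro ballI impI)
      fix x y assume xy: "x \<in> \<A>" "y \<in> \<A>" "x \<inter> y = {}"
      have "(indicator (x \<union> y) :: _ \<Rightarrow> real) = (\<lambda>z. indicator x z + indicator y z)"
        using xy(3) by (intro ext) (auto simp: indicator_def)
      then show "m (x \<union> y) = m x + m y"
        using linear_on_add[OF L ind ind] xy nn by (simp add: m_def ennreal_plus)
    qed
    show "m A \<noteq> \<infinity>" for A by (simp add: m_def)
    show "(\<lambda>i. m (A i)) \<longlonglongrightarrow> 0" if "range A \<subseteq> \<A>" "decseq A" "(\<Inter>i. A i) = {}" for A
      using tendsto_ennrealI[OF cont[OF that]] by (simp add: m_def)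
  qed
  then obtain \<mu> where \<mu>: "\<And>s. s \<in> \<A> \<Longrightarrow> \<mu> s = m s" "measure_space (space P) (sigma_sets (space P) \<A>) \<mu>" by blast
  have sub: "sigma_sets (space P) \<A> = sets P" using \<A>(2,3) sets.sigma_sets_subset[of \<A> P] by blast
  define \<pi> where "\<pi> = measure_of (space P) (sets P) \<mu>"
  have sets: "sets \<pi> = sets P" by (simp add: \<pi>_def)
  have sp: "space \<pi> = space P" by (rule sets_eq_imp_space_eq[OF sets])
  have em: "emeasure \<pi> E = \<mu> E" if "E \<in> sets P" for E
  proof (rule emeasure_measure_of[OF \<pi>_def])
    show "sets P \<subseteq> Pow (space P)" by (rule sets.space_closed)
    show "positive (sets \<pi>) \<mu>" "countably_additive (sets \<pi>) \<mu>"
      using \<mu>(2) sub sets by (auto simp: measure_space_def)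
    show "E \<in> sets \<pi>" using that sets by simp
  qed
  have em': "emeasure \<pi> E = ennreal (L (indicator E))" if "E \<in> \<A>" for E
    using em[of E] \<mu>(1)[OF that] that \<A>(2) by (auto simp: m_def)
  have "L (indicator (space P)) = L (\<lambda>z. 1)"
    by (intro linear_on_eq_positive[OF V L pos] bounded_measurable_const bounded_measurable_indicator) auto
  then have "prob_space \<pi>" using em'[OF top] sp one by (intro prob_spaceI) simp
  then show thesis using sets em' nn by (intro that[of \<pi>]) (auto simp: measure_def)
qed

text \<open>Marczewski and Ryll-Nardzewski: a finitely additive coupling of tight probability measures is
  countably additive on the algebra of those sets which, together with their complements, are
  approximable from inside by compact sets.\<close>

theorem countably_additive_coupling:
  fixes S :: "'a topology" and T :: "'b topology"
  assumes S: "polish_topology S" and T: "polish_topology T"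
    and \<mu>: "prob_space \<mu>" "sets \<mu> = sets (borel_of S)" and \<nu>: "prob_space \<nu>" "sets \<nu> = sets (borel_of T)"
    and L: "linear_on (bounded_measurable (\<mu> \<Otimes>\<^sub>M \<nu>)) L"
    and pos: "\<And>f. f \<in> bounded_measurable (\<mu> \<Otimes>\<^sub>M \<nu>) \<Longrightarrow> (\<And>z. z \<in> space (\<mu> \<Otimes>\<^sub>M \<nu>) \<Longrightarrow> 0 \<le> f z) \<Longrightarrow> 0 \<le> L f"
    and one: "L (\<lambda>z. 1) = 1"
    and fst: "\<And>A. A \<in> sets \<mu> \<Longrightarrow> L (indicator (A \<times> space \<nu>)) = measure \<mu> A"
    and snd: "\<And>B. B \<in> sets \<nu> \<Longrightarrow> L (indicator (space \<mu> \<times> B)) = measure \<nu> B"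
  obtains \<pi> where "prob_space \<pi>" "sets \<pi> = sets (\<mu> \<Otimes>\<^sub>M \<nu>)"
    "\<And>A B. A \<in> sets \<mu> \<Longrightarrow> B \<in> sets \<nu> \<Longrightarrow> measure \<pi> (A \<times> B) = L (indicator (A \<times> B))"
    "\<And>U. openin (prod_topology S T) U \<Longrightarrow> measure \<pi> U \<le> L (indicator U)"
proof -
  define P where "P = \<mu> \<Otimes>\<^sub>M \<nu>"
  define W where "W = prod_topology S T"
  note L' = L[folded P_def] and pos' = pos[folded P_def]
  note V = fun_space_bounded_measurable[of P]
  interpret \<mu>: prob_space \<mu> by (rule \<mu>)
  interpret \<nu>: prob_space \<nu> by (rule \<nu>)
  have sc: "second_countable S" "second_countable T" using S T by (auto simp: polish_topology_def)
  have setsP: "sets P = sets (borel_of W)"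
    unfolding P_def W_def sets_borel_of_prod_topology[OF sc, symmetric] by (intro sets_pair_measure_cong \<mu> \<nu>)
  have spP: "space P = topspace W" using sets_eq_imp_space_eq[OF setsP] by simp
  have sp: "space P = space \<mu> \<times> space \<nu>" by (simp add: P_def space_pair_measure)
  have rect: "A \<times> B \<in> sets P" if "A \<in> sets \<mu>" "B \<in> sets \<nu>" for A B
    unfolding P_def using that by (rule pair_measureI)
  have HW: "Hausdorff_space W"
    unfolding W_def using S T
    by (simp add: Hausdorff_space_prod_topology metrizable_imp_Hausdorff_space polish_topology_metrizable)
  have cl: "closedin W K" if "compactin W K" for K using compactin_imp_closedin[OF HW that] .
  have cm: "K \<in> sets P" if "compactin W K" for K
    unfolding setsP by (rule closedin_sets_borel_of[OF cl[OF that]])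
  define m where "m = (\<lambda>E. L (indicator E))"
  have ind: "indicator E \<in> bounded_measurable P" if "E \<in> sets P" for E
    using that by (rule bounded_measurable_indicator)
  have mono: "m E \<le> m F" if "E \<in> sets P" "F \<in> sets P" "E \<subseteq> F" for E F
    unfolding m_def using that
    by (intro linear_on_mono_positive[OF V L' pos'] ind) (auto simp: indicator_def)
  have m0: "0 \<le> m E" if "E \<in> sets P" for E
    unfolding m_def by (rule pos'[OF ind[OF that]]) simp
  have memp: "m {} = 0"
    using linear_on_zero[OF L' bounded_measurable_const[of 0]] by (simp add: m_def indicator_def[abs_def])
  have subadd: "m (E \<union> F) \<le> m E + m F" if EF: "E \<in> sets P" "F \<in> sets P" for E F
  proof -
    have "m (E \<union> F) \<le> L (\<lambda>z. indicator E z + indicator F z)"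
      unfolding m_def using EF
      by (intro linear_on_mono_positive[OF V L' pos'] ind bounded_measurable_add) (auto simp: indicator_def)
    then show ?thesis using linear_on_add[OF L' ind ind] EF by (simp add: m_def)
  qed
  have subadd_fin: "m (\<Union>i<n. E i) \<le> (\<Sum>i<n. m (E i))" if "\<And>i. E i \<in> sets P" for E and n :: nat
  proof (induction n)
    case 0 then show ?case by (simp add: memp)
  next
    case (Suc n)
    have "m (\<Union>i<Suc n. E i) = m ((\<Union>i<n. E i) \<union> E n)" by (simp add: lessThan_Suc Un_commute)
    also have "\<dots> \<le> m (\<Union>i<n. E i) + m (E n)" using that by (intro subadd) auto
    finally show ?case using Suc by simp
  qed
  define appr where "appr = (\<lambda>E. \<forall>e>0. \<exists>K. compactin W K \<and> K \<subseteq> E \<and> m (E - K) < e)"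
  define \<A> where "\<A> = {E \<in> sets P. appr E \<and> appr (space P - E)}"
  \<comment> \<open>The common part of the union and intersection cases: an error of
    \<open>e / 2\<close> is allotted to each of the two sets.\<close>
  have appr_combine: "appr G"
    if E: "appr E" "E \<in> sets P" and F: "appr F" "F \<in> sets P" and G: "G \<in> sets P"
      and comb: "\<And>K K'. compactin W K \<Longrightarrow> K \<subseteq> E \<Longrightarrow> compactin W K' \<Longrightarrow> K' \<subseteq> F \<Longrightarrow>
        \<exists>H. compactin W H \<and> H \<subseteq> G \<and> G - H \<subseteq> (E - K) \<union> (F - K')" for E F G
    unfolding appr_def
  proof (intro allI impI)
    fix e :: real assume "e > 0"
    then have e2: "e / 2 > 0" by simp
    obtain K where K: "compactin W K" "K \<subseteq> E" "m (E - K) < e / 2" using E(1) e2 unfolding appr_def by metis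
    obtain K' where K': "compactin W K'" "K' \<subseteq> F" "m (F - K') < e / 2" using F(1) e2 unfolding appr_def by metis
    obtain H where H: "compactin W H" "H \<subseteq> G" "G - H \<subseteq> (E - K) \<union> (F - K')"
      using comb[OF K(1,2) K'(1,2)] by metis
    have "m (G - H) \<le> m ((E - K) \<union> (F - K'))"
      using H E F G cm[OF K(1)] cm[OF K'(1)] cm[OF H(1)] by (intro mono) auto
    also have "\<dots> \<le> m (E - K) + m (F - K')"
      using E F cm[OF K(1)] cm[OF K'(1)] by (intro subadd) auto
    also have "\<dots> < e" using K K' by simp
    finally show "\<exists>K. compactin W K \<and> K \<subseteq> G \<and> m (G - K) < e" using H by blast
  qed
  have appr_Un: "appr (E \<union> F)" if "appr E" "E \<in> sets P" "appr F" "F \<in> sets P" for E F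
  proof (rule appr_combine[OF that])
    show "E \<union> F \<in> sets P" using that by auto
    show "\<exists>H. compactin W H \<and> H \<subseteq> E \<union> F \<and> E \<union> F - H \<subseteq> E - K \<union> (F - K')"
      if "compactin W K" "K \<subseteq> E" "compactin W K'" "K' \<subseteq> F" for K K'
      using that by (intro exI[of _ "K \<union> K'"]) (auto intro: compactin_Un)
  qed
  have appr_Int: "appr (E \<inter> F)" if "appr E" "E \<in> sets P" "appr F" "F \<in> sets P" for E F
  proof (rule appr_combine[OF that])
    show "E \<inter> F \<in> sets P" using that by auto
    show "\<exists>H. compactin W H \<and> H \<subseteq> E \<inter> F \<and> E \<inter> F - H \<subseteq> E - K \<union> (F - K')"
      if "compactin W K" "K \<subseteq> E" "compactin W K'" "K' \<subseteq> F" for K K'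
      using that cl by (intro exI[of _ "K \<inter> K'"]) (auto intro: closed_Int_compactin)
  qed
  have appr_rect: "appr (A \<times> B)" if A: "A \<in> sets \<mu>" and B: "B \<in> sets \<nu>" for A B
    unfolding appr_def
  proof (intro allI impI)
    fix e :: real assume "e > 0"
    then have e2: "e / 2 > 0" by simp
    obtain K where K: "compactin S K" "K \<subseteq> A" "measure \<mu> (A - K) < e / 2"
      using \<mu>.polish_inner_regular[OF S \<mu>(2) A e2] by blast
    obtain K' where K': "compactin T K'" "K' \<subseteq> B" "measure \<nu> (B - K') < e / 2"
      using \<nu>.polish_inner_regular[OF T \<nu>(2) B e2] by blast
    have "K \<in> sets \<mu>" "K' \<in> sets \<nu>"
    proof -
      have "closedin S K" "closedin T K'"
        using K(1) K'(1) S T by (auto intro: compactin_imp_closedin metrizable_imp_Hausdorff_space polish_topology_metrizable)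
      then show "K \<in> sets \<mu>" "K' \<in> sets \<nu>" unfolding \<mu> \<nu> by (auto intro: closedin_sets_borel_of)
    qed
    then have AK: "A - K \<in> sets \<mu>" "B - K' \<in> sets \<nu>" "K \<times> K' \<in> sets P" using A B rect by auto
    \<comment> \<open>A point of \<open>A \<times> B\<close> outside \<open>K \<times> K'\<close>
      misses one of the two factors, so the error is controlled by the marginals alone.\<close>
    have "m (A \<times> B - K \<times> K') \<le> m (((A - K) \<times> space \<nu>) \<union> (space \<mu> \<times> (B - K')))"
      using A B AK rect sets.sets_into_space[OF A] sets.sets_into_space[OF B]
      by (intro mono sets.Un sets.Diff) auto
    also have "\<dots> \<le> m ((A - K) \<times> space \<nu>) + m (space \<mu> \<times> (B - K'))"
      using AK rect by (intro subadd) auto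
    also have "\<dots> = measure \<mu> (A - K) + measure \<nu> (B - K')"
      unfolding m_def using fst[OF AK(1)] snd[OF AK(2)] by simp
    also have "\<dots> < e" using K K' by simp
    finally have "m (A \<times> B - K \<times> K') < e" .
    moreover have "compactin W (K \<times> K')" using K K' by (simp add: W_def compactin_Times)
    moreover have "K \<times> K' \<subseteq> A \<times> B" using K K' by auto
    ultimately show "\<exists>H. compactin W H \<and> H \<subseteq> A \<times> B \<and> m (A \<times> B - H) < e" by blast
  qed
  have rectA: "A \<times> B \<in> \<A>" if A: "A \<in> sets \<mu>" and B: "B \<in> sets \<nu>" for A B
  proof -
    have "space P - A \<times> B = ((space \<mu> - A) \<times> space \<nu>) \<union> (space \<mu> \<times> (space \<nu> - B))"
      unfolding sp using sets.sets_into_space[OF A] sets.sets_into_space[OF B] by auto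
    moreover have "appr \<dots>" using A B by (intro appr_Un appr_rect rect) auto
    ultimately show ?thesis using A B appr_rect rect by (simp add: \<A>_def)
  qed
  have alg: "algebra (space P) \<A>"
    unfolding algebra_iff_Un
  proof (intro conjI ballI)
    show "\<A> \<subseteq> Pow (space P)" using sets.space_closed[of P] by (auto simp: \<A>_def)
    show "{} \<in> \<A>" using rectA[of "{}" "{}"] by simp
    show "space P - E \<in> \<A>" if "E \<in> \<A>" for E
    proof -
      have "space P - (space P - E) = E" using that sets.sets_into_space by (fastforce simp: \<A>_def)
      then show ?thesis using that by (simp add: \<A>_def sets.compl_sets)
    qed
    show "E \<union> F \<in> \<A>" if "E \<in> \<A>" "F \<in> \<A>" for E F
    proof -
      have "appr ((space P - E) \<inter> (space P - F))"
        using that by (intro appr_Int) (auto simp: \<A>_def)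
      moreover have "(space P - E) \<inter> (space P - F) = space P - (E \<union> F)" by auto
      moreover have "appr (E \<union> F)" using that by (intro appr_Un) (auto simp: \<A>_def)
      ultimately show ?thesis using that by (auto simp: \<A>_def)
    qed
  qed
  have gen: "sets P \<subseteq> sigma_sets (space P) \<A>"
  proof -
    have "sets P = sigma_sets (space P) {A \<times> B |A B. A \<in> sets \<mu> \<and> B \<in> sets \<nu>}"
      by (simp add: P_def sets_pair_measure space_pair_measure)
    also have "\<dots> \<subseteq> sigma_sets (space P) \<A>" using rectA by (intro sigma_sets_mono') auto
    finally show ?thesis .
  qed
  have cont: "(\<lambda>i. L (indicator (E i))) \<longlonglongrightarrow> 0"
    if E: "range E \<subseteq> \<A>" "decseq E" "(\<Inter>i. E i) = {}" for E
  proof (rule LIMSEQ_I)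
    fix e :: real assume e: "e > 0"
    have EP: "E i \<in> sets P" for i using E(1) by (auto simp: \<A>_def)
    have "\<exists>K. compactin W K \<and> K \<subseteq> E i \<and> m (E i - K) < e / 2 * (1/2) ^ Suc i" for i
    proof -
      have "appr (E i)" "e / 2 * (1/2) ^ Suc i > 0" using E(1) e by (auto simp: \<A>_def)
      then show ?thesis unfolding appr_def by metis
    qed
    then obtain K where K: "\<And>i. compactin W (K i)" "\<And>i. K i \<subseteq> E i" "\<And>i. m (E i - K i) < e / 2 * (1/2) ^ Suc i"
      by metis
    \<comment> \<open>Otherwise compactness of \<open>K 0\<close> gives a point in all
      \<open>K i\<close>, hence in all \<open>E i\<close>. The extra \<open>K 0\<close> matters at
      \<open>n = 0\<close>, where the intersection over \<open>i < n\<close> is the whole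
      type.\<close>
    have "\<exists>n. (\<Inter>i<n. K i) \<inter> K 0 = {}"
    proof (rule ccontr)
      assume ne: "\<nexists>n. (\<Inter>i<n. K i) \<inter> K 0 = {}"
      have fip: "K 0 \<inter> \<Inter>\<F> \<noteq> {}" if F: "finite \<F>" "\<F> \<subseteq> range K" for \<F>
      proof -
        obtain I where I: "finite I" "\<F> = K ` I" using finite_subset_image[OF F] by blast
        obtain n where n: "\<forall>i\<in>I. i < n" using finite_nat_set_iff_bounded I(1) by blast
        then have "(\<Inter>i<n. K i) \<inter> K 0 \<subseteq> K 0 \<inter> \<Inter>\<F>" using I by auto
        then show ?thesis using ne by blast
      qed
      have "K 0 \<inter> \<Inter>(range K) \<noteq> {}"
        using K(1)[of 0, unfolded compactin_fip, THEN conjunct2, rule_format, of "range K"] cl[OF K(1)] fip by auto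
      then obtain z where "\<And>i. z \<in> K i" by auto
      then have "z \<in> (\<Inter>i. E i)" using subsetD[OF K(2)] by auto
      then show False unfolding E(3) by simp
    qed
    then obtain n where n: "(\<Inter>i<n. K i) \<inter> K 0 = {}" by metis
    have n': "(\<Inter>i<Suc n. K i) = {}"
    proof -
      have "(\<Inter>i<Suc n. K i) \<subseteq> (\<Inter>i<n. K i) \<inter> K 0" by auto
      then show ?thesis using n by simp
    qed
    have "m (E k) < e" if k: "k \<ge> n" for k
    proof -
      \<comment> \<open>A point of \<open>E k\<close> misses some \<open>K i\<close> with
        \<open>i \<le> n\<close>, and it lies in \<open>E i\<close> because the sequence
        decreases.\<close>
      have sub: "E k \<subseteq> (\<Union>i<Suc n. E i - K i)"
      proof
        fix z assume z: "z \<in> E k"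
        obtain i where i: "i < Suc n" "z \<notin> K i" using n' by blast
        have "E k \<subseteq> E i" using E(2) i k by (auto simp: decseq_def)
        then show "z \<in> (\<Union>i<Suc n. E i - K i)" using z i by blast
      qed
      have "m (E k) \<le> m (\<Union>i<Suc n. E i - K i)" using sub EP cm[OF K(1)] by (intro mono) auto
      also have "\<dots> \<le> (\<Sum>i<Suc n. m (E i - K i))" using EP cm[OF K(1)] by (intro subadd_fin) auto
      also have "\<dots> \<le> (\<Sum>i<Suc n. e / 2 * (1/2) ^ Suc i)" by (intro sum_mono less_imp_le K(3))
      also have "\<dots> \<le> (\<Sum>i. e / 2 * (1/2) ^ Suc i)"
        using e sums_summable[OF sums_mult[OF power_half_series, of "e/2"]] by (intro sum_le_suminf) auto
      also have "\<dots> = e / 2" using sums_unique[OF sums_mult[OF power_half_series, of "e/2"]] by simp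
      also have "\<dots> < e" using e by simp
      finally show ?thesis .
    qed
    then show "\<exists>n0. \<forall>k\<ge>n0. norm (L (indicator (E k)) - 0) < e"
      using m0[OF EP] by (intro exI[of _ n]) (auto simp: m_def)
  qed
  have \<A>_sets: "\<A> \<subseteq> sets P" by (auto simp: \<A>_def)
  obtain \<pi> where \<pi>: "prob_space \<pi>" "sets \<pi> = sets P" "\<And>E. E \<in> \<A> \<Longrightarrow> measure \<pi> E = L (indicator E)"
    by (rule measure_of_positive_functional[OF L' pos' one alg \<A>_sets gen cont]; (assumption | (rule that; blast)))
  show thesis
  proof (rule that[OF \<pi>(1) \<pi>(2)[unfolded P_def]])
    show "measure \<pi> (A \<times> B) = L (indicator (A \<times> B))" if "A \<in> sets \<mu>" "B \<in> sets \<nu>" for A B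
      using \<pi>(3) rectA[OF that] .
    show "measure \<pi> U \<le> L (indicator U)" if U: "openin (prod_topology S T) U" for U
    proof -
      interpret \<pi>: prob_space \<pi> by (rule \<pi>)
      interpret A: algebra "space P" \<A> by (rule alg)
      obtain BS BT where B: "countable_base S BS" "countable_base T BT"
        using sc by (auto simp: second_countable_iff_base)
      define R where "R = {p \<in> BS \<times> BT. fst p \<times> snd p \<subseteq> U}"
      have cR: "countable R" using B unfolding R_def countable_base_def by (intro countable_Collect) auto
      have RA: "fst p \<times> snd p \<in> \<A>" if "p \<in> R" for p
        using that B \<mu> \<nu> by (intro rectA) (auto simp: R_def countable_base_def openin_sets_borel_of)
      have RU: "U = (\<Union>p\<in>R. fst p \<times> snd p)"
      proof
        show "U \<subseteq> (\<Union>p\<in>R. fst p \<times> snd p)"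
        proof
          fix z assume z: "z \<in> U"
          obtain V where "V \<in> (\<lambda>(U, V). U \<times> V) ` (BS \<times> BT)" "z \<in> V" "V \<subseteq> U"
            using countable_base_prod_topology[OF B] U z unfolding countable_base_def by meson
          then show "z \<in> (\<Union>p\<in>R. fst p \<times> snd p)" by (force simp: R_def)
        qed
      qed (auto simp: R_def)
      show ?thesis
      proof (cases "R = {}")
        case True
        then show ?thesis using RU memp by (simp add: m_def)
      next
        case False
        define r where "r = from_nat_into R"
        have r: "range r = R" unfolding r_def using cR False by (simp add: range_from_nat_into)
        \<comment> \<open>Finite unions of basic rectangles belong to \<open>\<A>\<close>, where
          \<open>\<pi>\<close> and \<open>L\<close> agree.\<close>
        define Z where "Z = (\<lambda>n. \<Union>i<n. fst (r i) \<times> snd (r i))"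
        have ZA: "Z n \<in> \<A>" for n unfolding Z_def using RA r by (intro A.finite_UN) auto
        have ZU: "(\<Union>n. Z n) = U"
        proof -
          have "(\<Union>n. Z n) = (\<Union>i. fst (r i) \<times> snd (r i))" unfolding Z_def by blast
          also have "\<dots> = U" unfolding RU r[symmetric] by blast
          finally show ?thesis .
        qed
        have Um: "U \<in> sets P" using U by (simp add: setsP W_def openin_sets_borel_of)
        have "(\<lambda>n. measure \<pi> (Z n)) \<longlonglongrightarrow> measure \<pi> (\<Union>n. Z n)"
        proof (rule \<pi>.finite_Lim_measure_incseq)
          show "range Z \<subseteq> sets \<pi>" using ZA \<pi>(2) by (auto simp: \<A>_def)
          show "incseq Z" unfolding Z_def by (intro incseq_SucI UN_mono) auto
        qed
        \<comment> \<open>Monotonicity of \<open>L\<close> gives the bound. Equality could be lost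
          in the limit, since \<open>L\<close> need not be continuous along \<open>Z n\<close>
          increasing to \<open>U\<close>.\<close>
        moreover have "measure \<pi> (Z n) \<le> L (indicator U)" for n
          unfolding \<pi>(3)[OF ZA] using mono[of "Z n" U] ZA[of n] ZU Um by (auto simp: m_def \<A>_def)
        ultimately show ?thesis unfolding ZU by (intro LIMSEQ_le_const2) auto
      qed
    qed
  qed
qed


section \<open>Kernels and conditional independence\<close>

lemma pair_measure_eqI_rectangles:
  assumes fin: "finite_measure M1" and sets: "sets M1 = sets (A \<Otimes>\<^sub>M B)" "sets M2 = sets (A \<Otimes>\<^sub>M B)"
    and eq: "\<And>a b. a \<in> sets A \<Longrightarrow> b \<in> sets B \<Longrightarrow> emeasure M1 (a \<times> b) = emeasure M2 (a \<times> b)"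
  shows "M1 = M2"
proof (rule measure_eqI_generator_eq[OF Int_stable_pair_measure_generator[of A B]])
  show "{a \<times> b |a b. a \<in> sets A \<and> b \<in> sets B} \<subseteq> Pow (space A \<times> space B)"
    by (rule pair_measure_closed)
  show "emeasure M1 E = emeasure M2 E" if "E \<in> {a \<times> b |a b. a \<in> sets A \<and> b \<in> sets B}" for E
    using that eq by auto
  show "range (\<lambda>_::nat. space A \<times> space B) \<subseteq> {a \<times> b |a b. a \<in> sets A \<and> b \<in> sets B}" by blast
  show "emeasure M1 (space A \<times> space B) \<noteq> \<infinity>" using finite_measure.emeasure_finite[OF fin] by simp
qed (auto simp: sets sets_pair_measure)

text \<open>With \<open>f\<close> and \<open>g\<close> as densities, the images of \<open>M\<close>
  under \<open>(Z1, Z2)\<close> are finite measures that agree on rectangles. Causality is expressed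
  on rectangles of past and side information, while disintegration needs all their joint
  events.\<close>

lemma (in prob_space) integral_rectangles_imp_pair:
  assumes Z: "Z1 \<in> measurable M A" "Z2 \<in> measurable M B"
    and f: "f \<in> bounded_measurable M" "\<And>w. w \<in> space M \<Longrightarrow> 0 \<le> f w"
    and g: "g \<in> bounded_measurable M" "\<And>w. w \<in> space M \<Longrightarrow> 0 \<le> g w"
    and rect: "\<And>a b. a \<in> sets A \<Longrightarrow> b \<in> sets B \<Longrightarrow>
      (\<integral>w. indicator a (Z1 w) * indicator b (Z2 w) * f w \<partial>M) = (\<integral>w. indicator a (Z1 w) * indicator b (Z2 w) * g w \<partial>M)"
    and E: "E \<in> sets (A \<Otimes>\<^sub>M B)"
  shows "(\<integral>w. indicator E (Z1 w, Z2 w) * f w \<partial>M) = (\<integral>w. indicator E (Z1 w, Z2 w) * g w \<partial>M)"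
proof -
  let ?Z = "\<lambda>w. (Z1 w, Z2 w)"
  let ?D = "\<lambda>f. distr (density M (\<lambda>w. ennreal (f w))) (A \<Otimes>\<^sub>M B) ?Z"
  have Zm: "?Z \<in> measurable M (A \<Otimes>\<^sub>M B)" using Z by measurable
  have em: "emeasure (?D h) E = ennreal (\<integral>w. indicator E (?Z w) * h w \<partial>M)"
    if h: "h \<in> bounded_measurable M" "\<And>w. w \<in> space M \<Longrightarrow> 0 \<le> h w" and E: "E \<in> sets (A \<Otimes>\<^sub>M B)" for h E
  proof -
    have hm: "h \<in> borel_measurable M" using h(1) by (rule bounded_measurable_measurable)
    have ZE: "?Z -` E \<inter> space M \<in> sets M" using measurable_sets[OF Zm E] .
    have "emeasure (?D h) E = (\<integral>\<^sup>+w. ennreal (h w) * indicator (?Z -` E \<inter> space M) w \<partial>M)"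
      using Zm E hm ZE by (simp add: emeasure_distr emeasure_density)
    also have "\<dots> = (\<integral>\<^sup>+w. ennreal (indicator E (?Z w) * h w) \<partial>M)"
      by (intro nn_integral_cong) (auto simp: indicator_def)
    also have "\<dots> = ennreal (\<integral>w. indicator E (?Z w) * h w \<partial>M)"
      using h(2) bounded_measurable_mult[OF bounded_measurable_compose[OF bounded_measurable_indicator[OF E] Zm] h(1)]
      by (intro nn_integral_eq_integral integrable_bounded_measurable) (auto simp: indicator_def)
    finally show ?thesis .
  qed
  have "?D f = ?D g"
  proof (rule pair_measure_eqI_rectangles)
    show "finite_measure (?D f)"
      by (rule finite_measureI) (use em[OF f sets.top] in \<open>simp add: space_pair_measure\<close>)
    show "emeasure (?D f) (a \<times> b) = emeasure (?D g) (a \<times> b)" if "a \<in> sets A" "b \<in> sets B" for a b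
      using that rect[OF that] by (simp add: em[OF f] em[OF g] indicator_times)
  qed simp_all
  moreover have "0 \<le> (\<integral>w. indicator E (?Z w) * f w \<partial>M)" "0 \<le> (\<integral>w. indicator E (?Z w) * g w \<partial>M)"
    using f(2) g(2) by (auto intro!: Bochner_Integration.integral_nonneg)
  ultimately show ?thesis using em[OF f E] em[OF g E] by simp
qed

lemma bounded_measurable_kernel_integral:
  assumes k: "k \<in> measurable A (prob_algebra C)" and g: "g \<in> bounded_measurable (A \<Otimes>\<^sub>M C)"
  shows "(\<lambda>z. \<integral>u. g (z, u) \<partial>k z) \<in> bounded_measurable A"
    and "z \<in> space A \<Longrightarrow> (\<lambda>u. g (z, u)) \<in> bounded_measurable (k z)"
proof -
  have kz: "sets (k z) = sets C" "prob_space (k z)" "space (k z) = space C" if "z \<in> space A" for z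
    using measurable_space[OF k that] by (auto simp: space_prob_algebra dest: sets_eq_imp_space_eq)
  have bm: "(\<lambda>u. g (z, u)) \<in> bounded_measurable (k z)" if "z \<in> space A" for z
    unfolding bounded_measurable_sets_cong[OF kz(1)[OF that]]
    using that by (intro bounded_measurable_compose[OF g]) auto
  show "(\<lambda>u. g (z, u)) \<in> bounded_measurable (k z)" if "z \<in> space A" using bm that .
  obtain K where K: "K \<ge> 0" "\<And>z. z \<in> space (A \<Otimes>\<^sub>M C) \<Longrightarrow> \<bar>g z\<bar> \<le> K" using bounded_measurable_bound[OF g] by blast
  have gm: "g \<in> borel_measurable (A \<Otimes>\<^sub>M C)" using g by (rule bounded_measurable_measurable)
  show "(\<lambda>z. \<integral>u. g (z, u) \<partial>k z) \<in> bounded_measurable A"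
  proof (rule bounded_measurableI[of _ _ K])
    show "(\<lambda>z. \<integral>u. g (z, u) \<partial>k z) \<in> borel_measurable A"
    proof (subst measurable_cong)
      \<comment> \<open>This is the integral of \<open>g\<close> against the law of
        \<open>(z, u)\<close>, a kernel into the product, and integration against a kernel is
        measurable in its parameter.\<close>
      show "(\<integral>u. g (z, u) \<partial>k z) = integral\<^sup>L (distr (k z) (A \<Otimes>\<^sub>M C) (\<lambda>u. (z, u))) g" if "z \<in> space A" for z
        using gm that measurable_cong_sets[OF kz(1)[OF that] refl, of "A \<Otimes>\<^sub>M C"]
        by (subst integral_distr) auto
      show "(\<lambda>z. integral\<^sup>L (distr (k z) (A \<Otimes>\<^sub>M C) (\<lambda>u. (z, u))) g) \<in> borel_measurable A"
        by (rule measurable_compose[OF measurable_distr2[OF _ measurable_prob_algebraD[OF k]]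
              integral_measurable_subprob_algebra[OF gm]]) simp
    qed
    fix z assume z: "z \<in> space A"
    interpret kz: prob_space "k z" using kz(2)[OF z] .
    have "\<bar>\<integral>u. g (z, u) \<partial>k z\<bar> \<le> (\<integral>u. \<bar>g (z, u)\<bar> \<partial>k z)" by (rule integral_abs_bound)
    also have "\<dots> \<le> (\<integral>u. K \<partial>k z)"
      using kz.integrable_bounded_measurable[OF bm[OF z]] K z kz(3)[OF z]
      by (intro integral_mono) (auto simp: space_pair_measure)
    also have "\<dots> = K" by (simp add: kz.prob_space)
    finally show "\<bar>\<integral>u. g (z, u) \<partial>k z\<bar> \<le> K" .
  qed
qed

text \<open>The joint law of \<open>(Z, U)\<close> and the composition of the law of
  \<open>Z\<close> with the kernel agree on rectangles, hence coincide; bounded \<open>g\<close>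
  then follow from indicators.\<close>

lemma (in prob_space) integral_disintegration:
  assumes Z: "Z \<in> measurable M A" and U: "U \<in> measurable M C" and k: "k \<in> measurable A (prob_algebra C)"
    and rect: "\<And>E c. E \<in> sets A \<Longrightarrow> c \<in> sets C \<Longrightarrow>
      (\<integral>w. indicator E (Z w) * indicator c (U w) \<partial>M) = (\<integral>w. indicator E (Z w) * measure (k (Z w)) c \<partial>M)"
    and g: "g \<in> bounded_measurable (A \<Otimes>\<^sub>M C)"
  shows "(\<integral>w. g (Z w, U w) \<partial>M) = (\<integral>w. (\<integral>u. g (Z w, u) \<partial>k (Z w)) \<partial>M)"
proof (rule positive_functional_eq_indicators[OF _ _ _ _ _ g,
    where ?L1.0 = "\<lambda>g. \<integral>w. g (Z w, U w) \<partial>M" and ?L2.0 = "\<lambda>g. \<integral>w. (\<integral>u. g (Z w, u) \<partial>k (Z w)) \<partial>M"])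
  have ZU: "(\<lambda>w. (Z w, U w)) \<in> measurable M (A \<Otimes>\<^sub>M C)" using Z U by measurable
  have sp: "Z w \<in> space A" if "w \<in> space M" for w using measurable_space[OF Z that] .
  have spk: "prob_space (k z)" "sets (k z) = sets C" "space (k z) = space C" if "z \<in> space A" for z
    using measurable_space[OF k that] by (auto simp: space_prob_algebra dest: sets_eq_imp_space_eq)
  have i1: "integrable M (\<lambda>w. h (Z w, U w))" if "h \<in> bounded_measurable (A \<Otimes>\<^sub>M C)" for h
    by (intro integrable_bounded_measurable bounded_measurable_compose[OF that ZU])
  have i2: "integrable M (\<lambda>w. \<integral>u. h (Z w, u) \<partial>k (Z w))" if "h \<in> bounded_measurable (A \<Otimes>\<^sub>M C)" for h
    by (intro integrable_bounded_measurable bounded_measurable_compose[OF bounded_measurable_kernel_integral(1)[OF k that] Z])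
  have i3: "integrable (k (Z w)) (\<lambda>u. h (Z w, u))"
    if "h \<in> bounded_measurable (A \<Otimes>\<^sub>M C)" "w \<in> space M" for h w
    using finite_measure.integrable_bounded_measurable[OF prob_space.finite_measure[OF spk(1)[OF sp[OF that(2)]]]]
      bounded_measurable_kernel_integral(2)[OF k that(1) sp[OF that(2)]] .
  show "linear_on (bounded_measurable (A \<Otimes>\<^sub>M C)) (\<lambda>g. \<integral>w. g (Z w, U w) \<partial>M)"
    using i1 by (auto simp: linear_on_def)
  show "linear_on (bounded_measurable (A \<Otimes>\<^sub>M C)) (\<lambda>g. \<integral>w. (\<integral>u. g (Z w, u) \<partial>k (Z w)) \<partial>M)"
    unfolding linear_on_def
  proof (intro ballI allI)
    fix f g a b assume fg: "f \<in> bounded_measurable (A \<Otimes>\<^sub>M C)" "g \<in> bounded_measurable (A \<Otimes>\<^sub>M C)"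
    have "(\<integral>w. (\<integral>u. a * f (Z w, u) + b * g (Z w, u) \<partial>k (Z w)) \<partial>M) =
        (\<integral>w. a * (\<integral>u. f (Z w, u) \<partial>k (Z w)) + b * (\<integral>u. g (Z w, u) \<partial>k (Z w)) \<partial>M)"
      using i3 fg by (intro Bochner_Integration.integral_cong) auto
    then show "(\<integral>w. (\<integral>u. a * f (Z w, u) + b * g (Z w, u) \<partial>k (Z w)) \<partial>M) =
        a * (\<integral>w. (\<integral>u. f (Z w, u) \<partial>k (Z w)) \<partial>M) + b * (\<integral>w. (\<integral>u. g (Z w, u) \<partial>k (Z w)) \<partial>M)"
      using i2 fg by simp
  qed
  show "0 \<le> (\<integral>w. h (Z w, U w) \<partial>M)" if "\<And>z. z \<in> space (A \<Otimes>\<^sub>M C) \<Longrightarrow> 0 \<le> h z" for h :: "_ \<Rightarrow> real"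
    using that measurable_space[OF ZU] by (intro Bochner_Integration.integral_nonneg) auto
  show "0 \<le> (\<integral>w. (\<integral>u. h (Z w, u) \<partial>k (Z w)) \<partial>M)" if "\<And>z. z \<in> space (A \<Otimes>\<^sub>M C) \<Longrightarrow> 0 \<le> h z" for h :: "_ \<Rightarrow> real"
    using that sp spk(3) by (intro Bochner_Integration.integral_nonneg) (auto simp: space_pair_measure)
  \<comment> \<open>The product of the point mass at \<open>Z w\<close> with
    \<open>k (Z w)\<close>.\<close>
  define k' where "k' = (\<lambda>w. distr (k (Z w)) (A \<Otimes>\<^sub>M C) (\<lambda>u. (Z w, u)))"
  have k'm: "k' \<in> measurable M (subprob_algebra (A \<Otimes>\<^sub>M C))"
    unfolding k'_def
  proof (rule measurable_distr2[where M = C])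
    show "(\<lambda>w. k (Z w)) \<in> measurable M (subprob_algebra C)"
      using measurable_compose[OF Z measurable_prob_algebraD[OF k]] .
    show "(\<lambda>(w, u). (Z w, u)) \<in> measurable (M \<Otimes>\<^sub>M C) (A \<Otimes>\<^sub>M C)" using Z by measurable
  qed
  have k'_em: "emeasure (k' w) E = ennreal (\<integral>u. indicator E (Z w, u) \<partial>k (Z w))"
    if w: "w \<in> space M" and E: "E \<in> sets (A \<Otimes>\<^sub>M C)" for w E
  proof -
    interpret kw: prob_space "k (Z w)" using spk(1)[OF sp[OF w]] .
    have m: "(\<lambda>u. (Z w, u)) \<in> measurable (k (Z w)) (A \<Otimes>\<^sub>M C)"
      unfolding measurable_cong_sets[OF spk(2)[OF sp[OF w]] refl] using sp[OF w] by simp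
    have "(\<integral>u. (indicator E (Z w, u) :: real) \<partial>k (Z w)) = (\<integral>u. indicator ((\<lambda>u. (Z w, u)) -` E \<inter> space (k (Z w))) u \<partial>k (Z w))"
      by (intro Bochner_Integration.integral_cong) (auto simp: indicator_def)
    also have "\<dots> = measure (k (Z w)) ((\<lambda>u. (Z w, u)) -` E \<inter> space (k (Z w)))"
      using measurable_sets[OF m E] by simp
    finally show ?thesis
      unfolding k'_def by (simp add: emeasure_distr[OF m E] kw.emeasure_eq_measure)
  qed
  have nn3: "0 \<le> (\<integral>u. (indicator E (Z w, u) :: real) \<partial>k (Z w))" for E w
    by (intro Bochner_Integration.integral_nonneg) simp
  have ne: "space M \<noteq> {}" by (rule not_empty)
  have em2: "emeasure (M \<bind> k') E = ennreal (\<integral>w. (\<integral>u. indicator E (Z w, u) \<partial>k (Z w)) \<partial>M)"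
    if E: "E \<in> sets (A \<Otimes>\<^sub>M C)" for E
  proof -
    have "emeasure (M \<bind> k') E = (\<integral>\<^sup>+w. emeasure (k' w) E \<partial>M)" by (rule emeasure_bind[OF ne k'm E])
    also have "\<dots> = (\<integral>\<^sup>+w. ennreal (\<integral>u. indicator E (Z w, u) \<partial>k (Z w)) \<partial>M)"
      using k'_em E by (intro nn_integral_cong) auto
    also have "\<dots> = ennreal (\<integral>w. (\<integral>u. indicator E (Z w, u) \<partial>k (Z w)) \<partial>M)"
      using i2[OF bounded_measurable_indicator[OF E]] nn3 by (intro nn_integral_eq_integral) auto
    finally show ?thesis .
  qed
  have em1: "emeasure (distr M (A \<Otimes>\<^sub>M C) (\<lambda>w. (Z w, U w))) E = ennreal (\<integral>w. indicator E (Z w, U w) \<partial>M)"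
    if E: "E \<in> sets (A \<Otimes>\<^sub>M C)" for E
  proof -
    have "(\<integral>w. (indicator E (Z w, U w) :: real) \<partial>M) = (\<integral>w. indicator ((\<lambda>w. (Z w, U w)) -` E \<inter> space M) w \<partial>M)"
      by (intro Bochner_Integration.integral_cong) (auto simp: indicator_def)
    also have "\<dots> = prob ((\<lambda>w. (Z w, U w)) -` E \<inter> space M)" using measurable_sets[OF ZU E] by simp
    finally show ?thesis by (simp add: emeasure_distr[OF ZU E] emeasure_eq_measure)
  qed
  have eq: "distr M (A \<Otimes>\<^sub>M C) (\<lambda>w. (Z w, U w)) = M \<bind> k'"
  proof (rule pair_measure_eqI_rectangles)
    show "finite_measure (distr M (A \<Otimes>\<^sub>M C) (\<lambda>w. (Z w, U w)))"
      using ZU by (intro prob_space.finite_measure prob_space_distr)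
    show "sets (M \<bind> k') = sets (A \<Otimes>\<^sub>M C)" using subprob_measurableD(2)[OF k'm] ne by (rule sets_bind)
    fix E c assume Ec: "E \<in> sets A" "c \<in> sets C"
    have "(\<integral>w. (\<integral>u. indicator (E \<times> c) (Z w, u) \<partial>k (Z w)) \<partial>M) = (\<integral>w. indicator E (Z w) * measure (k (Z w)) c \<partial>M)"
    proof (intro Bochner_Integration.integral_cong refl)
      fix w assume w: "w \<in> space M"
      have "c \<in> sets (k (Z w))" using spk(2)[OF sp[OF w]] Ec by simp
      then show "(\<integral>u. indicator (E \<times> c) (Z w, u) \<partial>k (Z w)) = indicator E (Z w) * measure (k (Z w)) c"
        using sets.sets_into_space by (simp add: indicator_times Int_absorb1 Int_absorb2)
    qed
    then show "emeasure (distr M (A \<Otimes>\<^sub>M C) (\<lambda>w. (Z w, U w))) (E \<times> c) = emeasure (M \<bind> k') (E \<times> c)"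
      using rect[OF Ec] Ec by (simp add: em1 em2 indicator_times)
  qed simp
  show "(\<integral>w. (indicator E (Z w, U w) :: real) \<partial>M) = (\<integral>w. (\<integral>u. indicator E (Z w, u) \<partial>k (Z w)) \<partial>M)"
    if E: "E \<in> sets (A \<Otimes>\<^sub>M C)" for E
  proof -
    have "ennreal (\<integral>w. indicator E (Z w, U w) \<partial>M) = ennreal (\<integral>w. (\<integral>u. indicator E (Z w, u) \<partial>k (Z w)) \<partial>M)"
      using em1[OF E] em2[OF E] eq by simp
    then show ?thesis
      using nn3 by (subst (asm) ennreal_inj) (auto intro!: Bochner_Integration.integral_nonneg)
  qed
qed

section \<open>Paths, their initial segments, and causality of a path process\<close>

lemma measurable_path_restrict: "m \<le> n \<Longrightarrow> (\<lambda>x. restrict x {1..m}) \<in> measurable (path_space X n) (path_space X m)"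
  unfolding path_space_def by (rule measurable_restrict_subset) auto

lemma measurable_path_coordinate: "t \<in> {1..n} \<Longrightarrow> (\<lambda>x. x t) \<in> measurable (path_space X n) (borel_of (X t))"
  unfolding path_space_def by (rule measurable_component_singleton)

lemma measurable_path_extend:
  "(\<lambda>(x, u). x(Suc t := u)) \<in> measurable (path_space X t \<Otimes>\<^sub>M borel_of (X (Suc t))) (path_space X (Suc t))"
proof -
  have "insert (Suc t) {1..t} = {1..Suc t}" by auto
  then show ?thesis unfolding path_space_def using measurable_add_dim[of "Suc t" "{1..t}" "\<lambda>t. borel_of (X t)"] by simp
qed

text \<open>Regroups \<open>((past, side), present)\<close> as \<open>(longer past, side)\<close>,
  so that disintegration applies with \<open>Z = (past, side)\<close> and
  \<open>U = present\<close>.\<close>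

lemma bounded_measurable_path_extend:
  assumes "b \<in> bounded_measurable (path_space X (Suc t) \<Otimes>\<^sub>M B)"
  shows "(\<lambda>p. b ((fst (fst p))(Suc t := snd p), snd (fst p))) \<in>
    bounded_measurable ((path_space X t \<Otimes>\<^sub>M B) \<Otimes>\<^sub>M borel_of (X (Suc t)))" (is "_ \<in> bounded_measurable ?M")
proof (rule bounded_measurable_compose[OF assms])
  have "(\<lambda>p. (fst (fst p), snd p)) \<in> measurable ?M (path_space X t \<Otimes>\<^sub>M borel_of (X (Suc t)))" by measurable
  from measurable_compose[OF this measurable_path_extend]
  have "(\<lambda>p. (fst (fst p))(Suc t := snd p)) \<in> measurable ?M (path_space X (Suc t))" by simp
  then show "(\<lambda>p. ((fst (fst p))(Suc t := snd p), snd (fst p))) \<in> measurable ?M (path_space X (Suc t) \<Otimes>\<^sub>M B)"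
    by measurable
qed

lemma path_extend_restrict: "(restrict x {1..t})(Suc t := x (Suc t)) = restrict x {1..Suc t}"
  by (auto simp: restrict_def fun_eq_iff)

text \<open>Only \<open>\<xi>\<close> has a prescribed law; \<open>\<zeta>\<close> is side
  information. The same results thus hold under \<open>P\<close> and under any other coupling, and
  again with the two projections exchanged.\<close>

locale path_process = M: prob_space M + \<mu>: prob_space \<mu>
  for M :: "'w measure" and \<mu> :: "(nat \<Rightarrow> 'a) measure" +
  fixes X :: "nat \<Rightarrow> 'a topology" and Y :: "nat \<Rightarrow> 'b topology" and N :: nat
    and \<kappa> :: "nat \<Rightarrow> (nat \<Rightarrow> 'a) \<Rightarrow> 'a measure" and \<xi> :: "'w \<Rightarrow> nat \<Rightarrow> 'a" and \<zeta> :: "'w \<Rightarrow> nat \<Rightarrow> 'b"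
  assumes sets_\<mu>: "sets \<mu> = sets (path_space X N)"
    and \<kappa>: "\<And>t. t \<in> {2..N} \<Longrightarrow> regular_cond_law X \<mu> t (\<kappa> t)"
    and \<xi>: "\<xi> \<in> measurable M (path_space X N)" and law_\<xi>: "distr M \<mu> \<xi> = \<mu>"
    and \<zeta>: "\<zeta> \<in> measurable M (path_space Y N)"
begin

lemma space_\<mu>: "space \<mu> = space (path_space X N)"
  by (rule sets_eq_imp_space_eq[OF sets_\<mu>])

lemma measurable_\<mu>: "measurable \<mu> K = measurable (path_space X N) K"
  by (rule measurable_cong_sets[OF sets_\<mu> refl])

lemma integral_\<xi>: "f \<in> borel_measurable (path_space X N) \<Longrightarrow> (\<integral>w. (f (\<xi> w) :: real) \<partial>M) = (\<integral>x. f x \<partial>\<mu>)"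
  using integral_distr[of \<xi> M \<mu> f] \<xi> law_\<xi> by (simp add: measurable_\<mu> measurable_cong_sets[OF refl sets_\<mu>])

context
  fixes t assumes t: "1 \<le> t" "Suc t \<le> N"
begin

abbreviation "past w \<equiv> restrict (\<xi> w) {1..t}"
abbreviation "other w \<equiv> restrict (\<zeta> w) {1..t}"
abbreviation "present w \<equiv> \<xi> w (Suc t)"

lemma measurable_past: "(\<lambda>w. past w) \<in> measurable M (path_space X t)"
  using measurable_compose[OF \<xi> measurable_path_restrict[of t N X]] t by simp

lemma measurable_other: "(\<lambda>w. other w) \<in> measurable M (path_space Y t)"
  using measurable_compose[OF \<zeta> measurable_path_restrict[of t N Y]] t by simp

lemma measurable_present: "(\<lambda>w. present w) \<in> measurable M (borel_of (X (Suc t)))"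
  using measurable_compose[OF \<xi> measurable_path_coordinate[of "Suc t" N X]] t by simp

lemma measurable_kernel: "\<kappa> (Suc t) \<in> measurable (path_space X t) (prob_algebra (borel_of (X (Suc t))))"
  using \<kappa>[of "Suc t"] t by (simp add: regular_cond_law_def)

lemma bounded_measurable_kernel_measure:
  assumes "C \<in> sets (borel_of (X (Suc t)))"
  shows "(\<lambda>x. measure (\<kappa> (Suc t) x) C) \<in> bounded_measurable (path_space X t)"
proof (rule bounded_measurableI[of _ _ 1])
  show "(\<lambda>x. measure (\<kappa> (Suc t) x) C) \<in> borel_measurable (path_space X t)"
    using measurable_compose[OF measurable_kernel measurable_measure_prob_algebra[OF assms]] by simp
  fix x assume "x \<in> space (path_space X t)"
  then have "prob_space (\<kappa> (Suc t) x)"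
    using measurable_space[OF measurable_kernel] by (auto simp: space_prob_algebra)
  then show "\<bar>measure (\<kappa> (Suc t) x) C\<bar> \<le> 1" by (simp add: prob_space.prob_le_1)
qed

text \<open>The kernel is specified by a conditional expectation under \<open>\<mu>\<close>;
  integrating over past events and changing variables by \<open>\<xi>\<close> carries this over to
  \<open>M\<close>.\<close>

lemma integral_past_present:
  assumes A: "A \<in> sets (path_space X t)" and C: "C \<in> sets (borel_of (X (Suc t)))"
  shows "(\<integral>w. indicator A (past w) * indicator C (present w) \<partial>M) =
         (\<integral>w. indicator A (past w) * measure (\<kappa> (Suc t) (past w)) C \<partial>M)"
proof -
  let ?r = "\<lambda>x::nat \<Rightarrow> 'a. restrict x {1..t}"
  let ?f = "indicator {x \<in> space \<mu>. x (Suc t) \<in> C} :: _ \<Rightarrow> real"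
  define F where "F = vimage_algebra (space \<mu>) ?r (path_space X t)"
  have r: "?r \<in> measurable \<mu> (path_space X t)" unfolding measurable_\<mu> using t by (intro measurable_path_restrict) simp
  have rm: "?r \<in> measurable (path_space X N) (path_space X t)" using r by (simp add: measurable_\<mu>)
  have cm: "(\<lambda>x. x (Suc t)) \<in> measurable (path_space X N) (borel_of (X (Suc t)))"
    using t by (intro measurable_path_coordinate) simp
  have setsF: "sets F = {?r -` A \<inter> space \<mu> | A. A \<in> sets (path_space X t)}"
    unfolding F_def by (rule sets_vimage_algebra2[OF funcsetI[OF measurable_space[OF r]]])
  have sub: "subalgebra \<mu> F"
    unfolding subalgebra_def setsF using measurable_sets[OF r] by (auto simp: F_def)
  interpret finite_measure_subalgebra \<mu> F by unfold_locales (rule sub)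
  have rF: "?r \<in> measurable F (path_space X t)"
    unfolding F_def by (rule measurable_vimage_algebra1) (use measurable_space[OF r] in auto)
  have C': "{x \<in> space \<mu>. x (Suc t) \<in> C} \<in> sets \<mu>"
  proof -
    have "(\<lambda>x. x (Suc t)) -` C \<inter> space \<mu> \<in> sets \<mu>"
      using measurable_sets[OF cm C] sets_\<mu> space_\<mu> by simp
    moreover have "(\<lambda>x. x (Suc t)) -` C \<inter> space \<mu> = {x \<in> space \<mu>. x (Suc t) \<in> C}" by auto
    ultimately show ?thesis by simp
  qed
  have Am: "(\<lambda>x. indicator A (?r x) :: real) \<in> bounded_measurable \<mu>"
    by (rule bounded_measurable_compose[OF bounded_measurable_indicator[OF A] r])
  have ce: "AE x in \<mu>. measure (\<kappa> (Suc t) (?r x)) C = real_cond_exp \<mu> F ?f x"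
    using \<kappa>[of "Suc t"] t C by (simp add: regular_cond_law_def F_def)
  have "(\<integral>w. (indicator A (past w) * indicator C (present w) :: real) \<partial>M) = (\<integral>x. indicator A (?r x) * indicator C (x (Suc t)) \<partial>\<mu>)"
    using measurable_compose[OF rm borel_measurable_indicator[OF A]] measurable_compose[OF cm borel_measurable_indicator[OF C]]
    by (intro integral_\<xi>[where f = "\<lambda>x. indicator A (?r x) * indicator C (x (Suc t))"] borel_measurable_times) simp_all
  also have "\<dots> = (\<integral>x. indicator A (?r x) * ?f x \<partial>\<mu>)"
    by (intro Bochner_Integration.integral_cong) (auto simp: indicator_def)
  also have "\<dots> = (\<integral>x. indicator A (?r x) * real_cond_exp \<mu> F ?f x \<partial>\<mu>)"
    using measurable_compose[OF rF borel_measurable_indicator[OF A]] C'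
    by (intro real_cond_exp_intg(2)[symmetric] \<mu>.integrable_bounded_measurable bounded_measurable_mult Am
          bounded_measurable_indicator) simp_all
  also have "\<dots> = (\<integral>x. indicator A (?r x) * measure (\<kappa> (Suc t) (?r x)) C \<partial>\<mu>)"
    using ce bounded_measurable_measurable[OF Am]
      bounded_measurable_measurable[OF bounded_measurable_compose[OF bounded_measurable_kernel_measure[OF C] r]]
    by (intro integral_cong_AE) (auto intro!: borel_measurable_times)
  also have "\<dots> = (\<integral>w. indicator A (past w) * measure (\<kappa> (Suc t) (past w)) C \<partial>M)"
    using measurable_compose[OF rm borel_measurable_indicator[OF A]]
      measurable_compose[OF rm bounded_measurable_measurable[OF bounded_measurable_kernel_measure[OF C]]]
    by (intro integral_\<xi>[where f = "\<lambda>x. indicator A (?r x) * measure (\<kappa> (Suc t) (?r x)) C", symmetric] borel_measurable_times) simp_all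
  finally show ?thesis .
qed

text \<open>Conditional independence without conditional expectations: the kernel still predicts the
  present after the side information \<open>B\<close> has been added. Being a family of integral
  identities, it can be tested by a linear functional.\<close>

definition causal_on_rectangles :: bool where
  "causal_on_rectangles \<longleftrightarrow> (\<forall>A\<in>sets (path_space X t). \<forall>B\<in>sets (path_space Y t). \<forall>C\<in>sets (borel_of (X (Suc t))).
     (\<integral>w. indicator A (past w) * indicator B (other w) * indicator C (present w) \<partial>M) =
     (\<integral>w. indicator A (past w) * indicator B (other w) * measure (\<kappa> (Suc t) (past w)) C \<partial>M))"

text \<open>Given the past, the conditional probability of \<open>C\<close> is the kernel value
  \<open>kC C\<close>. Conditional independence therefore says that
  \<open>kC C * E[1_B | past]\<close> is the conditional expectation of \<open>1_C * 1_B\<close>,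
  and integrated over past events this is the rectangle identity.\<close>

lemma cond_indep_given_iff_rectangles:
  "cond_indep_given M (borel_of (X (Suc t))) (\<lambda>w. present w) (path_space Y t) (\<lambda>w. other w)
     (path_space X t) (\<lambda>w. past w) \<longleftrightarrow> causal_on_rectangles"
proof -
  define F where "F = vimage_algebra (space M) (\<lambda>w. past w) (path_space X t)"
  note r = measurable_past
  have setsF: "sets F = {(\<lambda>w. past w) -` A \<inter> space M | A. A \<in> sets (path_space X t)}"
    unfolding F_def by (rule sets_vimage_algebra2[OF funcsetI[OF measurable_space[OF r]]])
  have sub: "subalgebra M F"
    unfolding subalgebra_def setsF using measurable_sets[OF r] by (auto simp: F_def)
  interpret finite_measure_subalgebra M F by unfold_locales (rule sub)
  have rF: "(\<lambda>w. past w) \<in> measurable F (path_space X t)"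
    unfolding F_def by (rule measurable_vimage_algebra1) (use measurable_space[OF r] in auto)
  have Fsets: "\<exists>A\<in>sets (path_space X t). \<forall>f. (\<integral>w\<in>A'. f w \<partial>M) = (\<integral>w. indicator A (past w) * (f w :: real) \<partial>M)"
    if A': "A' \<in> sets F" for A'
  proof -
    obtain A where A: "A \<in> sets (path_space X t)" "A' = (\<lambda>w. past w) -` A \<inter> space M" using A' setsF by auto
    have "(\<integral>w\<in>A'. f w \<partial>M) = (\<integral>w. indicator A (past w) * (f w :: real) \<partial>M)" for f
      unfolding set_lebesgue_integral_def A(2) by (intro Bochner_Integration.integral_cong) (auto simp: indicator_def)
    then show ?thesis using A(1) by blast
  qed
  have event: "{w \<in> space M. g w \<in> E} \<in> sets M" if "g \<in> measurable M K" "E \<in> sets K" for g K E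
  proof -
    have "g -` E \<inter> space M = {w \<in> space M. g w \<in> E}" by auto
    then show ?thesis using measurable_sets[OF that] by simp
  qed
  define kC where "kC = (\<lambda>C w. measure (\<kappa> (Suc t) (past w)) C)"
  have kC: "kC C \<in> bounded_measurable M" and kCF: "kC C \<in> borel_measurable F"
    if "C \<in> sets (borel_of (X (Suc t)))" for C
    unfolding kC_def
    using bounded_measurable_compose[OF bounded_measurable_kernel_measure[OF that] r]
      measurable_compose[OF rF bounded_measurable_measurable[OF bounded_measurable_kernel_measure[OF that]]] by auto
  define iC where "iC = (\<lambda>C. indicator {w \<in> space M. present w \<in> C} :: _ \<Rightarrow> real)"
  define iB where "iB = (\<lambda>B. indicator {w \<in> space M. other w \<in> B} :: _ \<Rightarrow> real)"
  define iCB where "iCB = (\<lambda>C B. indicator {w \<in> space M. present w \<in> C \<and> other w \<in> B} :: _ \<Rightarrow> real)"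
  have iC: "iC C \<in> bounded_measurable M" if "C \<in> sets (borel_of (X (Suc t)))" for C
    unfolding iC_def by (rule bounded_measurable_indicator[OF event[OF measurable_present that]])
  have iB: "iB B \<in> bounded_measurable M" if "B \<in> sets (path_space Y t)" for B
    unfolding iB_def by (rule bounded_measurable_indicator[OF event[OF measurable_other that]])
  have iCB_eq: "iCB C B = (\<lambda>w. iC C w * iB B w)" for C B
    by (auto simp: iCB_def iC_def iB_def indicator_def fun_eq_iff)
  have iCB: "iCB C B \<in> bounded_measurable M" if "C \<in> sets (borel_of (X (Suc t)))" "B \<in> sets (path_space Y t)" for C B
    unfolding iCB_eq by (intro bounded_measurable_mult iC iB that)
  have iA: "(\<lambda>w. indicator A (past w) :: real) \<in> bounded_measurable M" and iAF: "(\<lambda>w. indicator A (past w) :: real) \<in> borel_measurable F"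
    if "A \<in> sets (path_space X t)" for A
    using bounded_measurable_compose[OF bounded_measurable_indicator[OF that] r]
      measurable_compose[OF rF borel_measurable_indicator[OF that]] by auto
  note int = M.integrable_bounded_measurable and bm = bounded_measurable_measurable
  have ceC: "AE w in M. real_cond_exp M F (iC C) w = kC C w" if C: "C \<in> sets (borel_of (X (Suc t)))" for C
  proof (rule real_cond_exp_charact[OF _ int[OF iC[OF C]] int[OF kC[OF C]] kCF[OF C]])
    fix A' assume "A' \<in> sets F"
    then obtain A where A: "A \<in> sets (path_space X t)"
      "\<And>f. (\<integral>w\<in>A'. f w \<partial>M) = (\<integral>w. indicator A (past w) * (f w :: real) \<partial>M)" using Fsets by metis
    have "(\<integral>w. indicator A (past w) * iC C w \<partial>M) = (\<integral>w. indicator A (past w) * indicator C (present w) \<partial>M)"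
      by (intro Bochner_Integration.integral_cong) (auto simp: iC_def indicator_def)
    then show "(\<integral>w\<in>A'. iC C w \<partial>M) = (\<integral>w\<in>A'. kC C w \<partial>M)"
      unfolding A(2) using integral_past_present[OF A(1) C] by (simp add: kC_def)
  qed
  have lhs: "(\<integral>w. indicator A (past w) * indicator B (other w) * indicator C (present w) \<partial>M) =
      (\<integral>w. indicator A (past w) * iCB C B w \<partial>M)" for A B C
    by (intro Bochner_Integration.integral_cong) (auto simp: iCB_def indicator_def)
  have rhs: "(\<integral>w. indicator A (past w) * indicator B (other w) * measure (\<kappa> (Suc t) (past w)) C \<partial>M) =
      (\<integral>w. indicator A (past w) * (kC C w * real_cond_exp M F (iB B) w) \<partial>M)"
    if A: "A \<in> sets (path_space X t)" and B: "B \<in> sets (path_space Y t)" and C: "C \<in> sets (borel_of (X (Suc t)))" for A B C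
  proof -
    have "(\<integral>w. indicator A (past w) * indicator B (other w) * measure (\<kappa> (Suc t) (past w)) C \<partial>M) =
        (\<integral>w. (indicator A (past w) * kC C w) * iB B w \<partial>M)"
      by (intro Bochner_Integration.integral_cong) (auto simp: iB_def kC_def indicator_def)
    \<comment> \<open>The factor \<open>1_A * kC C\<close> is measurable for the past, so
      \<open>iB B\<close> may be replaced by its conditional expectation.\<close>
    also have "\<dots> = (\<integral>w. (indicator A (past w) * kC C w) * real_cond_exp M F (iB B) w \<partial>M)"
      by (intro real_cond_exp_intg(2)[symmetric] int bounded_measurable_mult borel_measurable_times
            iAF[OF A] kCF[OF C] iA[OF A] kC[OF C] iB[OF B] bm[OF iB[OF B]])
    finally show ?thesis by (simp add: mult.assoc)
  qed
  have main: "(AE w in M. real_cond_exp M F (iCB C B) w = real_cond_exp M F (iC C) w * real_cond_exp M F (iB B) w) \<longleftrightarrow>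
    (\<forall>A\<in>sets (path_space X t).
     (\<integral>w. indicator A (past w) * indicator B (other w) * indicator C (present w) \<partial>M) =
     (\<integral>w. indicator A (past w) * indicator B (other w) * measure (\<kappa> (Suc t) (past w)) C \<partial>M))"
    if B: "B \<in> sets (path_space Y t)" and C: "C \<in> sets (borel_of (X (Suc t)))" for B C
  proof
    assume ae: "AE w in M. real_cond_exp M F (iCB C B) w = real_cond_exp M F (iC C) w * real_cond_exp M F (iB B) w"
    show "\<forall>A\<in>sets (path_space X t).
     (\<integral>w. indicator A (past w) * indicator B (other w) * indicator C (present w) \<partial>M) =
     (\<integral>w. indicator A (past w) * indicator B (other w) * measure (\<kappa> (Suc t) (past w)) C \<partial>M)"
    proof
      fix A assume A: "A \<in> sets (path_space X t)"
      have "(\<integral>w. indicator A (past w) * iCB C B w \<partial>M) = (\<integral>w. indicator A (past w) * real_cond_exp M F (iCB C B) w \<partial>M)"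
        by (intro real_cond_exp_intg(2)[symmetric] int bounded_measurable_mult iAF[OF A] iA[OF A] iCB[OF C B]
              bm[OF iCB[OF C B]])
      also have "\<dots> = (\<integral>w. indicator A (past w) * (kC C w * real_cond_exp M F (iB B) w) \<partial>M)"
        using ae ceC[OF C] bm[OF iA[OF A]] bm[OF kC[OF C]]
        by (intro integral_cong_AE borel_measurable_times) auto
      finally show "(\<integral>w. indicator A (past w) * indicator B (other w) * indicator C (present w) \<partial>M) =
          (\<integral>w. indicator A (past w) * indicator B (other w) * measure (\<kappa> (Suc t) (past w)) C \<partial>M)"
        unfolding lhs rhs[OF A B C] .
    qed
  next
    assume rect: "\<forall>A\<in>sets (path_space X t).
     (\<integral>w. indicator A (past w) * indicator B (other w) * indicator C (present w) \<partial>M) =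
     (\<integral>w. indicator A (past w) * indicator B (other w) * measure (\<kappa> (Suc t) (past w)) C \<partial>M)"
    have "AE w in M. real_cond_exp M F (iCB C B) w = kC C w * real_cond_exp M F (iB B) w"
    proof (rule real_cond_exp_charact[OF _ int[OF iCB[OF C B]]])
      show "integrable M (\<lambda>w. kC C w * real_cond_exp M F (iB B) w)"
        by (intro real_cond_exp_intg(1) int bounded_measurable_mult kCF[OF C] kC[OF C] iB[OF B] bm[OF iB[OF B]])
      show "(\<lambda>w. kC C w * real_cond_exp M F (iB B) w) \<in> borel_measurable F"
        using kCF[OF C] by (intro borel_measurable_times) auto
      fix A' assume "A' \<in> sets F"
      then obtain A where A: "A \<in> sets (path_space X t)"
        "\<And>f. (\<integral>w\<in>A'. f w \<partial>M) = (\<integral>w. indicator A (past w) * (f w :: real) \<partial>M)" using Fsets by metis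
      show "(\<integral>w\<in>A'. iCB C B w \<partial>M) = (\<integral>w\<in>A'. kC C w * real_cond_exp M F (iB B) w \<partial>M)"
        unfolding A(2) using rect A(1) unfolding lhs rhs[OF A(1) B C, symmetric] by simp
    qed
    then show "AE w in M. real_cond_exp M F (iCB C B) w = real_cond_exp M F (iC C) w * real_cond_exp M F (iB B) w"
      using ceC[OF C] by eventually_elim simp
  qed
  have swap: "(\<forall>C\<in>SC. \<forall>B\<in>SB. Q C B) \<longleftrightarrow> (\<forall>A\<in>SA. \<forall>B\<in>SB. \<forall>C\<in>SC. R A B C)"
    if "\<And>B C. B \<in> SB \<Longrightarrow> C \<in> SC \<Longrightarrow> Q C B \<longleftrightarrow> (\<forall>A\<in>SA. R A B C)"
    for SA :: "'x set" and SB :: "'y set" and SC :: "'z set" and Q R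
    using that by auto
  show ?thesis
    unfolding cond_indep_given_def Let_def causal_on_rectangles_def
    unfolding F_def[symmetric]
    by (rule swap[OF main[unfolded iCB_def iC_def iB_def]])
qed

text \<open>Under causality the conditional law of the present given past and side information
  depends on the past only, and is the kernel.\<close>

lemma integral_past_disintegration:
  assumes "causal_on_rectangles"
    and b: "b \<in> bounded_measurable (path_space X (Suc t) \<Otimes>\<^sub>M path_space Y t)"
  shows "(\<integral>w. b (restrict (\<xi> w) {1..Suc t}, other w) \<partial>M) =
         (\<integral>w. (\<integral>u. b ((past w)(Suc t := u), other w) \<partial>\<kappa> (Suc t) (past w)) \<partial>M)"
proof -
  let ?A = "path_space X t \<Otimes>\<^sub>M path_space Y t" and ?C = "borel_of (X (Suc t))"
  let ?g = "\<lambda>p. b ((fst (fst p))(Suc t := snd p), snd (fst p))"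
  have Z: "(\<lambda>w. (past w, other w)) \<in> measurable M ?A"
    using measurable_past measurable_other by measurable
  have k: "(\<lambda>z. \<kappa> (Suc t) (fst z)) \<in> measurable ?A (prob_algebra ?C)"
    by (rule measurable_compose[OF measurable_fst measurable_kernel])
  have g: "?g \<in> bounded_measurable (?A \<Otimes>\<^sub>M ?C)" by (rule bounded_measurable_path_extend[OF b])
  have "(\<integral>w. ?g ((past w, other w), present w) \<partial>M) =
      (\<integral>w. (\<integral>u. ?g ((past w, other w), u) \<partial>\<kappa> (Suc t) (fst (past w, other w))) \<partial>M)"
  proof (rule M.integral_disintegration[OF Z measurable_present k _ g])
    fix E C assume E: "E \<in> sets ?A" and C: "C \<in> sets ?C"
    show "(\<integral>w. indicator E (past w, other w) * indicator C (present w) \<partial>M) =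
        (\<integral>w. indicator E (past w, other w) * measure (\<kappa> (Suc t) (fst (past w, other w))) C \<partial>M)"
      unfolding fst_conv
    proof (rule M.integral_rectangles_imp_pair[OF measurable_past measurable_other _ _ _ _ _ E])
      show "(\<lambda>w. indicator C (present w) :: real) \<in> bounded_measurable M"
        by (rule bounded_measurable_compose[OF bounded_measurable_indicator[OF C] measurable_present])
      show "(\<lambda>w. measure (\<kappa> (Suc t) (past w)) C) \<in> bounded_measurable M"
        by (rule bounded_measurable_compose[OF bounded_measurable_kernel_measure[OF C] measurable_past])
    qed (use assms(1) C in \<open>auto simp: causal_on_rectangles_def\<close>)
  qed
  then show ?thesis unfolding fst_conv snd_conv path_extend_restrict .
qed

end

end


section \<open>Dual function spaces\<close>

text \<open>Generic versions of the function spaces, with the observed path \<open>\<xi>\<close> and the side information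
  \<open>\<zeta>\<close> as parameters: the causal spaces arise for \<open>(fst, snd)\<close>, the anticausal ones for \<open>(snd, fst)\<close>.\<close>

definition path_functions :: "nat \<Rightarrow> (nat \<Rightarrow> 'a topology) \<Rightarrow> ('w \<Rightarrow> nat \<Rightarrow> 'a) \<Rightarrow> ('w \<Rightarrow> real) set" where
  "path_functions N X \<xi> = {(\<lambda>w. f (\<xi> w)) | f. f \<in> bounded_measurable (path_space X N)}"

definition innovations ::
  "(nat \<Rightarrow> 'a topology) \<Rightarrow> (nat \<Rightarrow> 'b topology) \<Rightarrow> ('w \<Rightarrow> nat \<Rightarrow> 'a) \<Rightarrow> ('w \<Rightarrow> nat \<Rightarrow> 'b) \<Rightarrow>
     (nat \<Rightarrow> (nat \<Rightarrow> 'a) \<Rightarrow> 'a measure) \<Rightarrow> nat \<Rightarrow> ('w \<Rightarrow> real) set" where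
  "innovations X Y \<xi> \<zeta> \<kappa> t =
     (if t = 1 then {(\<lambda>w. f (\<xi> w 1)) | f. f \<in> bounded_measurable (borel_of (X 1))}
      else {(\<lambda>w. a (restrict (\<xi> w) {1..t}, restrict (\<zeta> w) {1..t-1}) -
               (\<integral>u. a ((restrict (\<xi> w) {1..t-1})(t := u), restrict (\<zeta> w) {1..t-1}) \<partial>\<kappa> t (restrict (\<xi> w) {1..t-1})))
            | a. a \<in> bounded_measurable (path_space X t \<Otimes>\<^sub>M path_space Y (t - 1))})"

definition adapted_functions ::
  "nat \<Rightarrow> (nat \<Rightarrow> 'a topology) \<Rightarrow> (nat \<Rightarrow> 'b topology) \<Rightarrow> ('w \<Rightarrow> nat \<Rightarrow> 'a) \<Rightarrow> ('w \<Rightarrow> nat \<Rightarrow> 'b) \<Rightarrow>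
     (nat \<Rightarrow> (nat \<Rightarrow> 'a) \<Rightarrow> 'a measure) \<Rightarrow> ('w \<Rightarrow> real) set" where
  "adapted_functions N X Y \<xi> \<zeta> \<kappa> = {(\<lambda>w. \<Sum>t=1..N. f t w) | f. \<forall>t\<in>{1..N}. f t \<in> innovations X Y \<xi> \<zeta> \<kappa> t}"

lemma innovations_1: "innovations X Y \<xi> \<zeta> \<kappa> (Suc 0) = {(\<lambda>w. f (\<xi> w 1)) | f. f \<in> bounded_measurable (borel_of (X 1))}"
  by (simp add: innovations_def)

lemma innovations_Suc:
  assumes "1 \<le> t"
  shows "innovations X Y \<xi> \<zeta> \<kappa> (Suc t) =
    {(\<lambda>w. a (restrict (\<xi> w) {1..Suc t}, restrict (\<zeta> w) {1..t}) -
       (\<integral>u. a ((restrict (\<xi> w) {1..t})(Suc t := u), restrict (\<zeta> w) {1..t}) \<partial>\<kappa> (Suc t) (restrict (\<xi> w) {1..t})))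
      | a. a \<in> bounded_measurable (path_space X (Suc t) \<Otimes>\<^sub>M path_space Y t)}"
  using assms by (simp add: innovations_def)

lemma zero_innovations: "(\<lambda>w. 0) \<in> innovations X Y \<xi> \<zeta> \<kappa> t"
proof (cases "t = 1")
  case True
  then show ?thesis
    by (auto simp: innovations_def intro!: exI[of _ "\<lambda>_. 0"] bounded_measurable_const)
next
  case False
  have "(\<lambda>w. 0 - (\<integral>u. 0 \<partial>\<kappa> t (restrict (\<xi> w) {1..t-1}))) \<in> innovations X Y \<xi> \<zeta> \<kappa> t"
    unfolding innovations_def if_not_P[OF False]
    by (intro CollectI exI[of _ "\<lambda>_. 0"] conjI) (simp_all add: bounded_measurable_const)
  then show ?thesis by simp
qed

lemma innovations_subset_adapted:
  assumes "t \<in> {1..N}"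
  shows "innovations X Y \<xi> \<zeta> \<kappa> t \<subseteq> adapted_functions N X Y \<xi> \<zeta> \<kappa>"
proof
  fix f assume f: "f \<in> innovations X Y \<xi> \<zeta> \<kappa> t"
  define g where "g = (\<lambda>s. if s = t then f else (\<lambda>w. 0))"
  have "f = (\<lambda>w. \<Sum>s=1..N. g s w)"
  proof
    fix w
    have "(\<Sum>s=1..N. g s w) = (\<Sum>s=1..N. if s = t then f w else 0)"
      by (intro sum.cong) (auto simp: g_def)
    then show "f w = (\<Sum>s=1..N. g s w)" using assms by simp
  qed
  moreover have "\<forall>s\<in>{1..N}. g s \<in> innovations X Y \<xi> \<zeta> \<kappa> s"
    using f zero_innovations by (auto simp: g_def)
  ultimately show "f \<in> adapted_functions N X Y \<xi> \<zeta> \<kappa>" unfolding adapted_functions_def by blast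
qed

section \<open>Boundedness, linearity and integrals of adapted functions\<close>

context path_process
begin

definition causal_process :: bool where
  "causal_process \<longleftrightarrow> (\<forall>t. 1 \<le> t \<longrightarrow> Suc t \<le> N \<longrightarrow> causal_on_rectangles t)"

lemma causal_process_iff_cond_indep:
  "causal_process \<longleftrightarrow> (\<forall>t\<in>{1..N-1}. cond_indep_given M
      (borel_of (X (t + 1))) (\<lambda>w. \<xi> w (t + 1)) (path_space Y t) (\<lambda>w. restrict (\<zeta> w) {1..t})
      (path_space X t) (\<lambda>w. restrict (\<xi> w) {1..t}))"
proof -
  have "t \<in> {1..N-1} \<longleftrightarrow> 1 \<le> t \<and> Suc t \<le> N" for t by auto
  then show ?thesis
    using cond_indep_given_iff_rectangles by (auto simp: causal_process_def)
qed

lemma bounded_measurable_path: "f \<in> bounded_measurable (path_space X N) \<Longrightarrow> (\<lambda>w. f (\<xi> w)) \<in> bounded_measurable M"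
  by (rule bounded_measurable_compose[OF _ \<xi>])

lemma bounded_measurable_kernel_path:
  assumes t: "1 \<le> t" "Suc t \<le> N" and a: "a \<in> bounded_measurable (path_space X (Suc t) \<Otimes>\<^sub>M path_space Y t)"
  shows "(\<lambda>p. \<integral>u. a ((fst p)(Suc t := u), snd p) \<partial>\<kappa> (Suc t) (fst p)) \<in>
           bounded_measurable (path_space X t \<Otimes>\<^sub>M path_space Y t)" (is ?P)
    and "p \<in> space (path_space X t \<Otimes>\<^sub>M path_space Y t) \<Longrightarrow>
           (\<lambda>u. a ((fst p)(Suc t := u), snd p)) \<in> bounded_measurable (\<kappa> (Suc t) (fst p))"
proof -
  let ?A = "path_space X t \<Otimes>\<^sub>M path_space Y t" and ?C = "borel_of (X (Suc t))"
  have k: "(\<lambda>z. \<kappa> (Suc t) (fst z)) \<in> measurable ?A (prob_algebra ?C)"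
    by (rule measurable_compose[OF measurable_fst measurable_kernel[OF t]])
  note g = bounded_measurable_path_extend[OF a]
  show ?P using bounded_measurable_kernel_integral(1)[OF k g] by simp
  show "(\<lambda>u. a ((fst p)(Suc t := u), snd p)) \<in> bounded_measurable (\<kappa> (Suc t) (fst p))" if "p \<in> space ?A"
    using bounded_measurable_kernel_integral(2)[OF k g that] by simp
qed

lemma bounded_measurable_present:
  assumes t: "1 \<le> t" "Suc t \<le> N" and a: "a \<in> bounded_measurable (path_space X (Suc t) \<Otimes>\<^sub>M path_space Y t)"
  shows "(\<lambda>w. a (past (Suc t) w, other t w)) \<in> bounded_measurable M"
    and "(\<lambda>w. \<integral>u. a ((past t w)(Suc t := u), other t w) \<partial>\<kappa> (Suc t) (past t w)) \<in> bounded_measurable M"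
    and "w \<in> space M \<Longrightarrow> (\<lambda>u. a ((past t w)(Suc t := u), other t w)) \<in>
           bounded_measurable (\<kappa> (Suc t) (past t w))"
proof -
  have m: "(\<lambda>w. past (Suc t) w) \<in> measurable M (path_space X (Suc t))"
    using measurable_compose[OF \<xi> measurable_path_restrict] t by simp
  show "(\<lambda>w. a (past (Suc t) w, other t w)) \<in> bounded_measurable M"
    by (rule bounded_measurable_compose[OF a measurable_Pair[OF m measurable_other[OF t]]])
  note Z = measurable_Pair[OF measurable_past[OF t] measurable_other[OF t]]
  show "(\<lambda>w. \<integral>u. a ((past t w)(Suc t := u), other t w) \<partial>\<kappa> (Suc t) (past t w)) \<in> bounded_measurable M"
    using bounded_measurable_compose[OF bounded_measurable_kernel_path(1)[OF t a] Z] by simp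
  show "(\<lambda>u. a ((past t w)(Suc t := u), other t w)) \<in>
           bounded_measurable (\<kappa> (Suc t) (past t w))" if "w \<in> space M"
    using bounded_measurable_kernel_path(2)[OF t a measurable_space[OF Z that]] by simp
qed

lemma prob_space_kernel:
  assumes "1 \<le> t" "Suc t \<le> N" "w \<in> space M"
  shows "prob_space (\<kappa> (Suc t) (past t w))"
  using measurable_space[OF measurable_kernel[OF assms(1,2)] measurable_space[OF measurable_past[OF assms(1,2)] assms(3)]]
  by (simp add: space_prob_algebra)

lemma measurable_initial: "1 \<le> N \<Longrightarrow> (\<lambda>w. \<xi> w 1) \<in> measurable M (borel_of (X 1))"
  using measurable_compose[OF \<xi> measurable_path_coordinate[of 1 N X]] by simp

lemma innovations_cases:
  assumes "t \<in> {1..N}"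
  obtains "t = Suc 0" "1 \<le> N" | s where "t = Suc s" "1 \<le> s" "Suc s \<le> N"
proof (cases "t = 1")
  case True then show ?thesis using that(1) assms by simp
next
  case False then show ?thesis using that(2)[of "t - 1"] assms by auto
qed

lemma innovations_bounded_measurable:
  assumes t: "t \<in> {1..N}"
  shows "innovations X Y \<xi> \<zeta> \<kappa> t \<subseteq> bounded_measurable M"
  using t
proof (cases rule: innovations_cases)
  case 1
  then show ?thesis
    unfolding 1(1) innovations_1 using bounded_measurable_compose[OF _ measurable_initial] by auto
next
  case (2 s)
  then show ?thesis
    unfolding 2(1) innovations_Suc[OF 2(2)]
    using bounded_measurable_diff[OF bounded_measurable_present(1,2)[OF 2(2,3)]] by auto
qed

text \<open>Equality is claimed on \<open>space M\<close> only: outside it the functions need not be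
  integrable for the kernel, and the integral need not be additive.\<close>

lemma innovations_lincomb:
  assumes t: "t \<in> {1..N}" and f: "f \<in> innovations X Y \<xi> \<zeta> \<kappa> t" and g: "g \<in> innovations X Y \<xi> \<zeta> \<kappa> t"
  shows "\<exists>h\<in>innovations X Y \<xi> \<zeta> \<kappa> t. \<forall>w\<in>space M. h w = \<alpha> * f w + \<beta> * g w"
  using t
proof (cases rule: innovations_cases)
  case 1
  then obtain f' g' where "f' \<in> bounded_measurable (borel_of (X 1))" "f = (\<lambda>w. f' (\<xi> w 1))"
    "g' \<in> bounded_measurable (borel_of (X 1))" "g = (\<lambda>w. g' (\<xi> w 1))"
    using f g by (auto simp: innovations_def)
  then show ?thesis
    unfolding 1(1) innovations_1
    by (intro bexI[of _ "\<lambda>w. \<alpha> * f' (\<xi> w 1) + \<beta> * g' (\<xi> w 1)"])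
       (auto intro!: exI[of _ "\<lambda>u. \<alpha> * f' u + \<beta> * g' u"] fun_space_lincomb[OF fun_space_bounded_measurable])
next
  case (2 s)
  let ?V = "bounded_measurable (path_space X (Suc s) \<Otimes>\<^sub>M path_space Y s)"
  define I where "I = (\<lambda>a w. a (past (Suc s) w, other s w) -
       (\<integral>u. (a ((past s w)(Suc s := u), other s w) :: real) \<partial>\<kappa> (Suc s) (past s w)))"
  have inn: "innovations X Y \<xi> \<zeta> \<kappa> t = {I a | a. a \<in> ?V}"
    unfolding 2(1) innovations_Suc[OF 2(2)] I_def by simp
  obtain a b where ab: "a \<in> ?V" "f = I a" "b \<in> ?V" "g = I b" using f g inn by auto
  have c: "(\<lambda>p. \<alpha> * a p + \<beta> * b p) \<in> ?V" by (rule fun_space_lincomb[OF fun_space_bounded_measurable ab(1,3)])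
  have "I (\<lambda>p. \<alpha> * a p + \<beta> * b p) w = \<alpha> * f w + \<beta> * g w" if w: "w \<in> space M" for w
  proof -
    note int = finite_measure.integrable_bounded_measurable[OF prob_space.finite_measure[OF prob_space_kernel[OF 2(2,3) w]]]
    show ?thesis
      unfolding ab(2,4) I_def
      using int[OF bounded_measurable_present(3)[OF 2(2,3) ab(1) w]] int[OF bounded_measurable_present(3)[OF 2(2,3) ab(3) w]]
      by (simp add: algebra_simps)
  qed
  then show ?thesis using c inn by blast
qed

lemma adapted_bounded_measurable: "adapted_functions N X Y \<xi> \<zeta> \<kappa> \<subseteq> bounded_measurable M"
proof
  fix s assume "s \<in> adapted_functions N X Y \<xi> \<zeta> \<kappa>"
  then obtain f where f: "s = (\<lambda>w. \<Sum>t=1..N. f t w)" "\<And>t. t \<in> {1..N} \<Longrightarrow> f t \<in> innovations X Y \<xi> \<zeta> \<kappa> t"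
    by (auto simp: adapted_functions_def)
  have "f t \<in> bounded_measurable M" if "t \<in> {1..N}" for t
    using f(2)[OF that] innovations_bounded_measurable[OF that] by blast
  then show "s \<in> bounded_measurable M"
    unfolding f(1) using linear_on_sum[OF fun_space_bounded_measurable M.linear_on_integral finite_atLeastAtMost] by blast
qed

lemma adapted_lincomb:
  assumes "f \<in> adapted_functions N X Y \<xi> \<zeta> \<kappa>" "g \<in> adapted_functions N X Y \<xi> \<zeta> \<kappa>"
  shows "\<exists>h\<in>adapted_functions N X Y \<xi> \<zeta> \<kappa>. \<forall>w\<in>space M. h w = \<alpha> * f w + \<beta> * g w"
proof -
  obtain f' where f: "f = (\<lambda>w. \<Sum>t=1..N. f' t w)" "\<And>t. t \<in> {1..N} \<Longrightarrow> f' t \<in> innovations X Y \<xi> \<zeta> \<kappa> t"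
    using assms(1) by (auto simp: adapted_functions_def)
  obtain g' where g: "g = (\<lambda>w. \<Sum>t=1..N. g' t w)" "\<And>t. t \<in> {1..N} \<Longrightarrow> g' t \<in> innovations X Y \<xi> \<zeta> \<kappa> t"
    using assms(2) by (auto simp: adapted_functions_def)
  have "\<forall>t\<in>{1..N}. \<exists>h. h \<in> innovations X Y \<xi> \<zeta> \<kappa> t \<and> (\<forall>w\<in>space M. h w = \<alpha> * f' t w + \<beta> * g' t w)"
    using innovations_lincomb f(2) g(2) by blast
  then obtain h where h: "\<forall>t\<in>{1..N}. h t \<in> innovations X Y \<xi> \<zeta> \<kappa> t \<and> (\<forall>w\<in>space M. h t w = \<alpha> * f' t w + \<beta> * g' t w)"
    using bchoice[of "{1..N}" "\<lambda>t h. h \<in> innovations X Y \<xi> \<zeta> \<kappa> t \<and> (\<forall>w\<in>space M. h w = \<alpha> * f' t w + \<beta> * g' t w)"] by blast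
  show ?thesis
  proof (rule bexI[of _ "\<lambda>w. \<Sum>t=1..N. h t w"])
    show "\<forall>w\<in>space M. (\<Sum>t=1..N. h t w) = \<alpha> * f w + \<beta> * g w"
      using h by (auto simp: f(1) g(1) sum_distrib_left sum.distrib[symmetric] intro!: sum.cong)
    show "(\<lambda>w. \<Sum>t=1..N. h t w) \<in> adapted_functions N X Y \<xi> \<zeta> \<kappa>"
      using h by (auto simp: adapted_functions_def)
  qed
qed

lemma const_adapted: "1 \<le> N \<Longrightarrow> (\<lambda>w. k) \<in> adapted_functions N X Y \<xi> \<zeta> \<kappa>"
proof -
  assume N: "1 \<le> N"
  have "(\<lambda>w. k) \<in> innovations X Y \<xi> \<zeta> \<kappa> (Suc 0)"
    unfolding innovations_1
    by (intro CollectI exI[of _ "\<lambda>_. k"] conjI) (simp_all add: bounded_measurable_const)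
  then show ?thesis using innovations_subset_adapted[of "Suc 0" N X Y \<xi> \<zeta> \<kappa>] N by auto
qed

text \<open>An innovation is a martingale difference: by disintegration, \<open>a\<close> and its
  kernel integral have the same mean.\<close>

lemma integral_innovation:
  assumes causal: "causal_process" and t: "1 \<le> t" "Suc t \<le> N" and f: "f \<in> innovations X Y \<xi> \<zeta> \<kappa> (Suc t)"
  shows "(\<integral>w. f w \<partial>M) = 0"
proof -
  obtain a where a: "a \<in> bounded_measurable (path_space X (Suc t) \<Otimes>\<^sub>M path_space Y t)"
    "f = (\<lambda>w. a (past (Suc t) w, other t w) -
       (\<integral>u. a ((past t w)(Suc t := u), other t w) \<partial>\<kappa> (Suc t) (past t w)))"
    using f unfolding innovations_Suc[OF t(1)] by blast
  have "causal_on_rectangles t" using causal t by (simp add: causal_process_def)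
  then show ?thesis
    unfolding a(2)
    using integral_past_disintegration[OF t _ a(1)]
      M.integrable_bounded_measurable[OF bounded_measurable_present(1)[OF t a(1)]]
      M.integrable_bounded_measurable[OF bounded_measurable_present(2)[OF t a(1)]]
    by simp
qed

text \<open>All innovations after the first have mean zero, so only the first one contributes, and
  its mean depends on the initial law alone.\<close>

lemma integral_adapted:
  assumes causal: "causal_process" and N: "1 \<le> N"
    and f: "\<And>t. t \<in> {1..N} \<Longrightarrow> f t \<in> innovations X Y \<xi> \<zeta> \<kappa> t" and g: "f 1 = (\<lambda>w. g (\<xi> w 1))"
    and gm: "g \<in> bounded_measurable (borel_of (X 1))"
  shows "(\<integral>w. (\<Sum>t=1..N. f t w) \<partial>M) = (\<integral>x. g (x 1) \<partial>\<mu>)"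
proof -
  have bm: "f t \<in> bounded_measurable M" if "t \<in> {1..N}" for t
    using f[OF that] innovations_bounded_measurable[OF that] by blast
  have "(\<integral>w. (\<Sum>t=1..N. f t w) \<partial>M) = (\<Sum>t=1..N. \<integral>w. f t w \<partial>M)"
    by (intro Bochner_Integration.integral_sum M.integrable_bounded_measurable bm)
  also have "\<dots> = (\<Sum>t=1..N. if t = 1 then \<integral>w. f 1 w \<partial>M else 0)"
  proof (intro sum.cong refl)
    fix t assume t: "t \<in> {1..N}"
    show "(\<integral>w. f t w \<partial>M) = (if t = 1 then \<integral>w. f 1 w \<partial>M else 0)"
      using t by (cases rule: innovations_cases) (use f[OF t] integral_innovation[OF causal] in auto)
  qed
  also have "\<dots> = (\<integral>w. g (\<xi> w 1) \<partial>M)" using N g by simp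
  also have "\<dots> = (\<integral>x. g (x 1) \<partial>\<mu>)"
    using N measurable_compose[OF measurable_path_coordinate[of 1 N X] bounded_measurable_measurable[OF gm]]
    by (intro integral_\<xi>[where f = "\<lambda>x. g (x 1)"]) simp
  finally show ?thesis .
qed

text \<open>Independence lets the side factor be pulled out of both integrals, which reduces
  causality to the kernel property of \<open>\<mu>\<close> itself.\<close>

lemma independent_imp_causal_process:
  assumes indep: "\<And>f g. f \<in> bounded_measurable (path_space X N) \<Longrightarrow> g \<in> bounded_measurable (path_space Y N) \<Longrightarrow>
    (\<integral>w. f (\<xi> w) * g (\<zeta> w) \<partial>M) = (\<integral>w. f (\<xi> w) \<partial>M) * (\<integral>w. g (\<zeta> w) \<partial>M)"
  shows "causal_process"
  unfolding causal_process_def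
proof (intro allI impI)
  fix t assume t: "1 \<le> t" "Suc t \<le> N"
  show "causal_on_rectangles t"
    unfolding causal_on_rectangles_def[OF t]
  proof (intro ballI)
    fix A B C assume A: "A \<in> sets (path_space X t)" and B: "B \<in> sets (path_space Y t)" and C: "C \<in> sets (borel_of (X (Suc t)))"
    define g where "g = (\<lambda>y. indicator B (restrict y {1..t}) :: real)"
    define f1 where "f1 = (\<lambda>x. indicator A (restrict x {1..t}) * indicator C (x (Suc t)) :: real)"
    define f2 where "f2 = (\<lambda>x. indicator A (restrict x {1..t}) * measure (\<kappa> (Suc t) (restrict x {1..t})) C)"
    have r: "(\<lambda>x. restrict x {1..t}) \<in> measurable (path_space X N) (path_space X t)"
      "(\<lambda>x. restrict x {1..t}) \<in> measurable (path_space Y N) (path_space Y t)"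
      "(\<lambda>x. x (Suc t)) \<in> measurable (path_space X N) (borel_of (X (Suc t)))"
      using t measurable_path_restrict[of t N X] measurable_path_restrict[of t N Y]
        measurable_path_coordinate[of "Suc t" N X] by simp_all
    have bm: "g \<in> bounded_measurable (path_space Y N)" "f1 \<in> bounded_measurable (path_space X N)" "f2 \<in> bounded_measurable (path_space X N)"
      unfolding g_def f1_def f2_def
      by (intro bounded_measurable_mult bounded_measurable_compose[OF bounded_measurable_indicator[OF B] r(2)]
          bounded_measurable_compose[OF bounded_measurable_indicator[OF A] r(1)]
          bounded_measurable_compose[OF bounded_measurable_indicator[OF C] r(3)]
          bounded_measurable_compose[OF bounded_measurable_kernel_measure[OF t C] r(1)])+
    have "(\<integral>w. f1 (\<xi> w) * g (\<zeta> w) \<partial>M) = (\<integral>w. f2 (\<xi> w) * g (\<zeta> w) \<partial>M)"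
      unfolding indep[OF bm(2,1)] indep[OF bm(3,1)]
      using integral_past_present[OF t A C] by (simp add: f1_def f2_def)
    then show "(\<integral>w. indicator A (past t w) * indicator B (other t w) * indicator C (\<xi> w (Suc t)) \<partial>M) =
        (\<integral>w. indicator A (past t w) * indicator B (other t w) *
           measure (\<kappa> (Suc t) (past t w)) C \<partial>M)"
      by (simp add: f1_def f2_def g_def mult_ac)
  qed
qed

end

text \<open>The same decomposition of \<open>s\<close> is used under both measures, and in each case
  the mean is that of the first term under \<open>\<mu>\<close>.\<close>

lemma integral_adapted_eq:
  assumes "path_process M \<mu> X Y N \<kappa> \<xi> \<zeta>" "path_process.causal_process M X Y N \<kappa> \<xi> \<zeta>"
    and "path_process M' \<mu> X Y N \<kappa> \<xi> \<zeta>" "path_process.causal_process M' X Y N \<kappa> \<xi> \<zeta>"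
    and N: "1 \<le> N" and s: "s \<in> adapted_functions N X Y \<xi> \<zeta> \<kappa>"
  shows "(\<integral>w. s w \<partial>M) = (\<integral>w. s w \<partial>M')"
proof -
  obtain f where f: "s = (\<lambda>w. \<Sum>t=1..N. f t w)" "\<And>t. t \<in> {1..N} \<Longrightarrow> f t \<in> innovations X Y \<xi> \<zeta> \<kappa> t"
    using s by (auto simp: adapted_functions_def)
  obtain g where g: "f 1 = (\<lambda>w. g (\<xi> w 1))" "g \<in> bounded_measurable (borel_of (X 1))"
    using f(2)[of 1] N by (auto simp: innovations_def)
  have "(\<integral>w. (\<Sum>t=1..N. f t w) \<partial>M) = (\<integral>x. g (x 1) \<partial>\<mu>)"
    by (rule path_process.integral_adapted[where f = f and g = g, OF assms(1,2) N _ g]) (rule f(2))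
  moreover have "(\<integral>w. (\<Sum>t=1..N. f t w) \<partial>M') = (\<integral>x. g (x 1) \<partial>\<mu>)"
    by (rule path_process.integral_adapted[where f = f and g = g, OF assms(3,4) N _ g]) (rule f(2))
  ultimately show ?thesis by (simp add: f(1))
qed

section \<open>Marginals and causality recovered from a functional\<close>

context path_process
begin

text \<open>A function of the path up to time \<open>s + 1\<close> is an innovation, taken with
  \<open>a\<close> independent of the side information, plus its kernel integral, a function of the
  path up to time \<open>s\<close>. Induction descends to time 1, where every bounded measurable
  function is an innovation.\<close>

lemma functional_eq_on_past:
  assumes causal: "causal_process" and L: "linear_on (bounded_measurable M) L"
    and pos: "\<And>f. f \<in> bounded_measurable M \<Longrightarrow> (\<And>w. w \<in> space M \<Longrightarrow> 0 \<le> f w) \<Longrightarrow> 0 \<le> L f"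
    and inn: "\<And>t h. t \<in> {1..N} \<Longrightarrow> h \<in> innovations X Y \<xi> \<zeta> \<kappa> t \<Longrightarrow> L h = (\<integral>w. h w \<partial>M)"
    and "1 \<le> t" "t \<le> N" "f \<in> bounded_measurable (path_space X t)"
  shows "L (\<lambda>w. f (past t w)) = (\<integral>w. f (past t w) \<partial>M)"
  using assms(5-7)
proof (induction t arbitrary: f rule: dec_induct)
  case base
  \<comment> \<open>The argument of \<open>f\<close> is the path of length one with value
    \<open>u\<close>.\<close>
  define g where "g = (\<lambda>u. f (\<lambda>i\<in>{1..1::nat}. u))"
  have e: "(\<lambda>w. f (past 1 w)) = (\<lambda>w. g (\<xi> w 1))"
  proof
    fix w
    have "past 1 w = (\<lambda>i\<in>{1..1::nat}. \<xi> w 1)" by (auto simp: restrict_def)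
    then show "f (past 1 w) = g (\<xi> w 1)" by (simp add: g_def)
  qed
  have "(\<lambda>u. \<lambda>i\<in>{1..1::nat}. u) \<in> measurable (borel_of (X 1)) (path_space X 1)"
    unfolding path_space_def by (rule measurable_restrict) auto
  then have "g \<in> bounded_measurable (borel_of (X 1))"
    unfolding g_def by (rule bounded_measurable_compose[OF base(2)])
  then have i: "(\<lambda>w. f (past 1 w)) \<in> innovations X Y \<xi> \<zeta> \<kappa> 1"
    unfolding e by (auto simp: innovations_def)
  have "1 \<in> {1..N}" using base by simp
  from inn[OF this i] show ?case .
next
  case (step s)
  then have s: "1 \<le> s" "Suc s \<le> N" by auto
  note f = \<open>f \<in> bounded_measurable (path_space X (Suc s))\<close>
  define F where "F = (\<lambda>x. \<integral>u. f (x(Suc s := u)) \<partial>\<kappa> (Suc s) x)"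
  define a where "a = (\<lambda>p :: _ \<times> (nat \<Rightarrow> 'b). f (fst p))"
  have a: "a \<in> bounded_measurable (path_space X (Suc s) \<Otimes>\<^sub>M path_space Y s)"
    unfolding a_def by (rule bounded_measurable_compose[OF f measurable_fst])
  have "(\<lambda>p. f ((fst p)(Suc s := snd p))) \<in> bounded_measurable (path_space X s \<Otimes>\<^sub>M borel_of (X (Suc s)))"
    using bounded_measurable_compose[OF f measurable_path_extend] by (simp add: case_prod_unfold)
  from bounded_measurable_kernel_integral(1)[OF measurable_kernel[OF s] this]
  have F: "F \<in> bounded_measurable (path_space X s)" by (simp add: F_def)
  define h where "h = (\<lambda>w. f (past (Suc s) w) - F (past s w))"
  have h: "h \<in> innovations X Y \<xi> \<zeta> \<kappa> (Suc s)"
    unfolding innovations_Suc[OF s(1)] h_def F_def using a by (intro CollectI exI[of _ a]) (simp add: a_def)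
  have hb: "h \<in> bounded_measurable M" using innovations_bounded_measurable[of "Suc s"] h s by auto
  have Fb: "(\<lambda>w. F (past s w)) \<in> bounded_measurable M"
    by (rule bounded_measurable_compose[OF F measurable_past[OF s]])
  have "(\<lambda>w. f (past (Suc s) w)) = (\<lambda>w. h w + F (past s w))" by (simp add: h_def)
  moreover have "L (\<lambda>w. h w + F (past s w)) = (\<integral>w. h w + F (past s w) \<partial>M)"
  proof -
    have IH: "L (\<lambda>w. F (past s w)) = (\<integral>w. F (past s w) \<partial>M)"
      by (rule step.IH[OF _ F]) (use s in simp)
    have "Suc s \<in> {1..N}" using s by simp
    from inn[OF this h] show ?thesis
      unfolding linear_on_add[OF L hb Fb] linear_on_add[OF M.linear_on_integral hb Fb] IH by (rule arg_cong)
  qed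
  ultimately show ?case by metis
qed

text \<open>The case \<open>t = N\<close>. A path equals its restriction to \<open>{1..N}\<close>
  only if it is extensional, which holds on \<open>space M\<close>; positivity of \<open>L\<close>
  makes agreement there sufficient.\<close>

lemma functional_eq_on_paths:
  assumes "causal_process" and L: "linear_on (bounded_measurable M) L"
    and pos: "\<And>f. f \<in> bounded_measurable M \<Longrightarrow> (\<And>w. w \<in> space M \<Longrightarrow> 0 \<le> f w) \<Longrightarrow> 0 \<le> L f"
    and inn: "\<And>t h. t \<in> {1..N} \<Longrightarrow> h \<in> innovations X Y \<xi> \<zeta> \<kappa> t \<Longrightarrow> L h = (\<integral>w. h w \<partial>M)"
    and N: "1 \<le> N" and f: "f \<in> bounded_measurable (path_space X N)"
  shows "L (\<lambda>w. f (\<xi> w)) = (\<integral>w. f (\<xi> w) \<partial>M)"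
proof -
  have e: "past N w = \<xi> w" if "w \<in> space M" for w
    using measurable_space[OF \<xi> that] by (simp add: path_space_def space_PiM PiE_restrict)
  have "L (\<lambda>w. f (\<xi> w)) = L (\<lambda>w. f (past N w))"
  proof (rule linear_on_eq_positive[OF fun_space_bounded_measurable L pos])
    show "(\<lambda>w. f (\<xi> w)) \<in> bounded_measurable M" by (rule bounded_measurable_path[OF f])
    show "(\<lambda>w. f (past N w)) \<in> bounded_measurable M"
      by (rule bounded_measurable_compose[OF f measurable_compose[OF \<xi> measurable_path_restrict[OF order_refl]]])
    show "f (\<xi> w) = f (past N w)" if "w \<in> space M" for w by (simp only: e[OF that])
  qed
  also have "\<dots> = (\<integral>w. f (past N w) \<partial>M)"
    by (rule functional_eq_on_past[OF assms(1-4) N order_refl f])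
  also have "\<dots> = (\<integral>w. f (\<xi> w) \<partial>M)" by (intro Bochner_Integration.integral_cong refl) (simp only: e)
  finally show ?thesis .
qed

text \<open>The innovation built from \<open>a = 1_A * 1_C * 1_B\<close> factors on
  \<open>space M\<close> as \<open>f (\<xi> w)\<close> times an indicator of
  \<open>\<zeta> w\<close>, exactly the kind of function on which \<open>L\<close> is assumed to be
  integration. Its vanishing under \<open>L\<close> is then the rectangle identity under
  \<open>M\<close>.\<close>

lemma causal_process_if_functional:
  assumes L: "linear_on (bounded_measurable M) L"
    and pos: "\<And>f. f \<in> bounded_measurable M \<Longrightarrow> (\<And>w. w \<in> space M \<Longrightarrow> 0 \<le> f w) \<Longrightarrow> 0 \<le> L f"
    and rect: "\<And>f B. f \<in> bounded_measurable (path_space X N) \<Longrightarrow> B \<in> sets (path_space Y N) \<Longrightarrow>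
      L (\<lambda>w. f (\<xi> w) * indicator B (\<zeta> w)) = (\<integral>w. f (\<xi> w) * indicator B (\<zeta> w) \<partial>M)"
    and inn: "\<And>t h. 1 \<le> t \<Longrightarrow> Suc t \<le> N \<Longrightarrow> h \<in> innovations X Y \<xi> \<zeta> \<kappa> (Suc t) \<Longrightarrow> L h = 0"
  shows "causal_process"
  unfolding causal_process_def
proof (intro allI impI)
  fix t assume t: "1 \<le> t" "Suc t \<le> N"
  show "causal_on_rectangles t"
    unfolding causal_on_rectangles_def[OF t]
  proof (intro ballI)
    fix A B C assume A: "A \<in> sets (path_space X t)" and B: "B \<in> sets (path_space Y t)" and C: "C \<in> sets (borel_of (X (Suc t)))"
    let ?k = "\<lambda>x. measure (\<kappa> (Suc t) x) C"
    define a where "a = (\<lambda>p. indicator A (restrict (fst p) {1..t}) * indicator C (fst p (Suc t)) * indicator B (snd p) :: real)"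
    define f where "f = (\<lambda>x. indicator A (restrict x {1..t}) * indicator C (x (Suc t)) - indicator A (restrict x {1..t}) * ?k (restrict x {1..t}) :: real)"
    \<comment> \<open>The event \<open>B\<close> on initial segments, lifted to whole paths as
      \<open>rect\<close> demands.\<close>
    define B' where "B' = (\<lambda>y. restrict y {1..t}) -` B \<inter> space (path_space Y N)"
    have r: "(\<lambda>x. restrict x {1..t}) \<in> measurable (path_space X N) (path_space X t)"
      "(\<lambda>x. restrict x {1..t}) \<in> measurable (path_space X (Suc t)) (path_space X t)"
      "(\<lambda>x. restrict x {1..t}) \<in> measurable (path_space Y N) (path_space Y t)"
      "(\<lambda>x. x (Suc t)) \<in> measurable (path_space X N) (borel_of (X (Suc t)))"
      "(\<lambda>x. x (Suc t)) \<in> measurable (path_space X (Suc t)) (borel_of (X (Suc t)))"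
      using t measurable_path_restrict[of t N X] measurable_path_restrict[of t "Suc t" X] measurable_path_restrict[of t N Y]
        measurable_path_coordinate[of "Suc t" N X] measurable_path_coordinate[of "Suc t" "Suc t" X] by simp_all
    have ab: "a \<in> bounded_measurable (path_space X (Suc t) \<Otimes>\<^sub>M path_space Y t)"
      unfolding a_def
      by (intro bounded_measurable_mult
          bounded_measurable_compose[OF bounded_measurable_indicator[OF A] measurable_compose[OF measurable_fst r(2)]]
          bounded_measurable_compose[OF bounded_measurable_indicator[OF C] measurable_compose[OF measurable_fst r(5)]]
          bounded_measurable_compose[OF bounded_measurable_indicator[OF B] measurable_snd])
    have f1: "(\<lambda>x. indicator A (restrict x {1..t}) * indicator C (x (Suc t)) :: real) \<in> bounded_measurable (path_space X N)"
      and f2: "(\<lambda>x. indicator A (restrict x {1..t}) * ?k (restrict x {1..t})) \<in> bounded_measurable (path_space X N)"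
      by (intro bounded_measurable_mult
          bounded_measurable_compose[OF bounded_measurable_indicator[OF A] r(1)]
          bounded_measurable_compose[OF bounded_measurable_indicator[OF C] r(4)]
          bounded_measurable_compose[OF bounded_measurable_kernel_measure[OF t C] r(1)])+
    have fb: "f \<in> bounded_measurable (path_space X N)"
      unfolding f_def by (rule bounded_measurable_diff[OF f1 f2])
    have B': "B' \<in> sets (path_space Y N)" unfolding B'_def by (rule measurable_sets[OF r(3) B])
    have Bb: "(\<lambda>w. indicator B (other t w) :: real) \<in> bounded_measurable M"
      by (rule bounded_measurable_compose[OF bounded_measurable_indicator[OF B] measurable_other[OF t]])
    have indB: "indicator B' (\<zeta> w) = (indicator B (other t w) :: real)" if "w \<in> space M" for w
      using measurable_space[OF \<zeta> that] by (auto simp: B'_def indicator_def)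
    define h where "h = (\<lambda>w. a (past (Suc t) w, other t w) -
       (\<integral>u. a ((past t w)(Suc t := u), other t w) \<partial>\<kappa> (Suc t) (past t w)))"
    have h: "h \<in> innovations X Y \<xi> \<zeta> \<kappa> (Suc t)"
      unfolding innovations_Suc[OF t(1)] h_def using ab by blast
    have hf: "h w = f (\<xi> w) * indicator B' (\<zeta> w)" if w: "w \<in> space M" for w
    proof -
      have res: "restrict (past (Suc t) w) {1..t} = past t w"
        "restrict ((past t w)(Suc t := u)) {1..t} = past t w" for u
        by (auto simp: restrict_def fun_eq_iff)
      have "sets (\<kappa> (Suc t) (past t w)) = sets (borel_of (X (Suc t)))"
        using measurable_space[OF measurable_kernel[OF t] measurable_space[OF measurable_past[OF t] w]]
        by (simp add: space_prob_algebra)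
      then have "C \<in> sets (\<kappa> (Suc t) (past t w))" using C by simp
      moreover have "C \<inter> space (\<kappa> (Suc t) (past t w)) = C"
        using sets.sets_into_space[OF calculation] by auto
      ultimately have "(\<integral>u. indicator C u \<partial>\<kappa> (Suc t) (past t w)) = ?k (past t w)" by simp
      then show ?thesis
        unfolding indB[OF w] h_def a_def f_def by (simp add: res algebra_simps)
    qed
    have "L h = L (\<lambda>w. f (\<xi> w) * indicator B' (\<zeta> w))"
      using innovations_bounded_measurable[of "Suc t"] h t hf
      by (intro linear_on_eq_positive[OF fun_space_bounded_measurable L pos] bounded_measurable_mult
            bounded_measurable_path[OF fb] bounded_measurable_compose[OF bounded_measurable_indicator[OF B'] \<zeta>]) auto
    then have "0 = (\<integral>w. f (\<xi> w) * indicator B' (\<zeta> w) \<partial>M)" using inn[OF t h] rect[OF fb B'] by simp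
    also have "\<dots> = (\<integral>w. indicator A (past t w) * indicator C (\<xi> w (Suc t)) * indicator B (other t w) -
        indicator A (past t w) * ?k (past t w) * indicator B (other t w) \<partial>M)"
      by (intro Bochner_Integration.integral_cong) (auto simp: indB f_def left_diff_distrib)
    also have "\<dots> = (\<integral>w. indicator A (past t w) * indicator C (\<xi> w (Suc t)) * indicator B (other t w) \<partial>M) -
        (\<integral>w. indicator A (past t w) * ?k (past t w) * indicator B (other t w) \<partial>M)"
      by (intro Bochner_Integration.integral_diff M.integrable_bounded_measurable bounded_measurable_mult[OF _ Bb]
          bounded_measurable_path[OF f1] bounded_measurable_path[OF f2])
    finally show "(\<integral>w. indicator A (past t w) * indicator B (other t w) * indicator C (\<xi> w (Suc t)) \<partial>M) =
        (\<integral>w. indicator A (past t w) * indicator B (other t w) * ?k (past t w) \<partial>M)"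
      by (simp add: mult_ac)
  qed
qed

end


section \<open>Relative entropy\<close>

text \<open>A real, nonnegative version of the density. The inequality
  \<open>u * max 0 (- ln u) \<le> 1\<close> makes the negative part integrable, so the difference
  that defines \<open>KL\<close> is determinate.\<close>

lemma KL_real_density:
  assumes P: "prob_space P" and \<pi>: "prob_space \<pi>" and sets: "sets \<pi> = sets P" and ac: "absolutely_continuous P \<pi>"
  obtains D where "D \<in> borel_measurable P" "\<And>z. 0 \<le> D z" "\<pi> = density P (\<lambda>z. ennreal (D z))"
    "AE z in \<pi>. 0 < D z" "integrable P D" "(\<integral>z. D z \<partial>P) = 1"
    "KL \<pi> P = enn2ereal (\<integral>\<^sup>+ z. ennreal (ln (D z)) \<partial>\<pi>) - enn2ereal (\<integral>\<^sup>+ z. ennreal (- ln (D z)) \<partial>\<pi>)"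
    "integrable \<pi> (\<lambda>z. max 0 (- ln (D z)))"
proof -
  interpret P: prob_space P by (rule P)
  interpret \<pi>: prob_space \<pi> by (rule \<pi>)
  obtain D where D: "D \<in> borel_measurable P" "AE z in P. RN_deriv P \<pi> z = ennreal (D z)"
      "AE z in \<pi>. 0 < D z" "\<And>z. 0 \<le> D z"
    using P.real_RN_deriv[OF \<pi>.finite_measure_axioms ac sets] by blast
  have "\<pi> = density P (RN_deriv P \<pi>)" using P.density_RN_deriv[OF ac sets] by simp
  also have "\<dots> = density P (\<lambda>z. ennreal (D z))"
    using D by (intro density_cong) auto
  finally have dens: "\<pi> = density P (\<lambda>z. ennreal (D z))" .
  have "(\<integral>\<^sup>+ z. ennreal (D z) \<partial>P) = emeasure \<pi> (space \<pi>)"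
    using D(1) sets_eq_imp_space_eq[OF sets] unfolding dens by (simp add: emeasure_density)
  then have nn1: "(\<integral>\<^sup>+ z. ennreal (D z) \<partial>P) = 1" by (simp add: \<pi>.emeasure_space_1)
  have Dint: "integrable P D" using D nn1 by (intro integrableI_nonneg) auto
  have D1: "(\<integral>z. D z \<partial>P) = 1"
    using nn1 nn_integral_eq_integral[OF Dint] D(4) by (simp add: ennreal_eq_1 flip: ennreal_1)
  have aeq: "AE z in \<pi>. enn2real (RN_deriv P \<pi> z) = D z"
  proof -
    have "AE z in P. enn2real (RN_deriv P \<pi> z) = D z" using D(2) by eventually_elim (simp add: D(4))
    then show ?thesis by (rule absolutely_continuous_AE[OF sets ac])
  qed
  have KL: "KL \<pi> P = enn2ereal (\<integral>\<^sup>+ z. ennreal (ln (D z)) \<partial>\<pi>) - enn2ereal (\<integral>\<^sup>+ z. ennreal (- ln (D z)) \<partial>\<pi>)"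
  proof -
    have "(\<integral>\<^sup>+ z. ennreal (ln (enn2real (RN_deriv P \<pi> z))) \<partial>\<pi>) = (\<integral>\<^sup>+ z. ennreal (ln (D z)) \<partial>\<pi>)"
      "(\<integral>\<^sup>+ z. ennreal (- ln (enn2real (RN_deriv P \<pi> z))) \<partial>\<pi>) = (\<integral>\<^sup>+ z. ennreal (- ln (D z)) \<partial>\<pi>)"
      using aeq by (auto intro!: nn_integral_cong_AE)
    then show ?thesis using ac by (simp add: KL_def)
  qed
  have neg: "integrable \<pi> (\<lambda>z. max 0 (- ln (D z)))"
    unfolding dens
  proof (subst integrable_density)
    show "integrable P (\<lambda>z. D z *\<^sub>R max 0 (- ln (D z)))"
    proof (rule P.integrable_const_bound[of _ 1])
      show "AE z in P. norm (D z *\<^sub>R max 0 (- ln (D z))) \<le> 1"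
      proof (rule AE_I2)
        fix z
        show "norm (D z *\<^sub>R max 0 (- ln (D z))) \<le> 1"
        proof (cases "D z = 0")
          case False
          then have pos: "D z > 0" using D(4)[of z] by simp
          have "- ln (D z) \<le> 1 / D z - 1"
            using ln_le_minus_one[of "1 / D z"] pos by (simp add: ln_div)
          also have "\<dots> \<le> 1 / D z" by simp
          finally have "max 0 (- ln (D z)) \<le> 1 / D z" using pos by simp
          then have "D z * max 0 (- ln (D z)) \<le> D z * (1 / D z)" using pos by (intro mult_left_mono) auto
          moreover have "0 \<le> D z * max 0 (- ln (D z))" using pos by (intro mult_nonneg_nonneg) auto
          ultimately show ?thesis using pos by (simp only: real_norm_def real_scaleR_def) simp
        qed simp
      qed
      show "(\<lambda>z. D z *\<^sub>R max 0 (- ln (D z))) \<in> borel_measurable P" using D(1) by measurable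
    qed
    show "(\<lambda>z. max 0 (- ln (D z))) \<in> borel_measurable P" using D(1) by measurable
  qed (use D in auto)
  show thesis by (rule that[OF D(1) D(4) dens D(3) Dint D1 KL neg])
qed

text \<open>Young's inequality \<open>D (g - ln D) \<le> exp g - D\<close> for the density
  \<open>D\<close>, integrated against \<open>P\<close>. When the positive part of
  \<open>ln D\<close> has infinite integral, \<open>KL\<close> is infinite and nothing is left to
  show.\<close>

theorem KL_lower_bound:
  assumes P: "prob_space P" and \<pi>: "prob_space \<pi>" and sets: "sets \<pi> = sets P" and g: "g \<in> bounded_measurable P"
  shows "ereal ((\<integral>z. g z \<partial>\<pi>) - (\<integral>z. exp (g z) \<partial>P) + 1) \<le> KL \<pi> P"
proof (cases "absolutely_continuous P \<pi>")
  case False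
  then show ?thesis by (simp add: KL_def)
next
  case True
  interpret P: prob_space P by (rule P)
  interpret \<pi>: prob_space \<pi> by (rule \<pi>)
  obtain D where D: "D \<in> borel_measurable P" "\<And>z. 0 \<le> D z" "\<pi> = density P (\<lambda>z. ennreal (D z))"
    "AE z in \<pi>. 0 < D z" "integrable P D" "(\<integral>z. D z \<partial>P) = 1"
    "KL \<pi> P = enn2ereal (\<integral>\<^sup>+ z. ennreal (ln (D z)) \<partial>\<pi>) - enn2ereal (\<integral>\<^sup>+ z. ennreal (- ln (D z)) \<partial>\<pi>)"
    "integrable \<pi> (\<lambda>z. max 0 (- ln (D z)))"
    using KL_real_density[OF P \<pi> sets True] by metis
  have neg: "(\<integral>\<^sup>+ z. ennreal (- ln (D z)) \<partial>\<pi>) = ennreal (\<integral>z. max 0 (- ln (D z)) \<partial>\<pi>)"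
    using nn_integral_eq_integral[OF D(8)] by (simp add: ennreal_max_0)
  show ?thesis
  proof (cases "(\<integral>\<^sup>+ z. ennreal (ln (D z)) \<partial>\<pi>) = \<infinity>")
    case True
    then show ?thesis unfolding D(7) neg by simp
  next
    case fin: False
    have lnm: "(\<lambda>z. ln (D z)) \<in> borel_measurable \<pi>"
      using D(1) unfolding measurable_cong_sets[OF sets refl] by measurable
    have pos: "integrable \<pi> (\<lambda>z. max 0 (ln (D z)))"
    proof (rule integrableI_nonneg)
      show "(\<lambda>z. max 0 (ln (D z))) \<in> borel_measurable \<pi>" using lnm by measurable
      show "(\<integral>\<^sup>+ z. ennreal (max 0 (ln (D z))) \<partial>\<pi>) < \<infinity>"
        using fin by (simp add: ennreal_max_0 top.not_eq_extremum)
    qed simp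
    have eq: "(\<lambda>z. max 0 (ln (D z)) - max 0 (- ln (D z))) = (\<lambda>z. ln (D z))" by (auto simp: max_def)
    have lni: "integrable \<pi> (\<lambda>z. ln (D z))"
      using Bochner_Integration.integrable_diff[OF pos D(8)] unfolding eq .
    have lnv: "(\<integral>z. ln (D z) \<partial>\<pi>) = (\<integral>z. max 0 (ln (D z)) \<partial>\<pi>) - (\<integral>z. max 0 (- ln (D z)) \<partial>\<pi>)"
      using Bochner_Integration.integral_diff[OF pos D(8)] unfolding eq .
    have posv: "(\<integral>\<^sup>+ z. ennreal (ln (D z)) \<partial>\<pi>) = ennreal (\<integral>z. max 0 (ln (D z)) \<partial>\<pi>)"
      using nn_integral_eq_integral[OF pos] by (simp add: ennreal_max_0)
    have nn: "0 \<le> (\<integral>z. max 0 (ln (D z)) \<partial>\<pi>)" "0 \<le> (\<integral>z. max 0 (- ln (D z)) \<partial>\<pi>)"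
      by (auto intro!: Bochner_Integration.integral_nonneg)
    have KL: "KL \<pi> P = ereal (\<integral>z. ln (D z) \<partial>\<pi>)"
      unfolding D(7) neg posv lnv using nn by (simp add: enn2ereal_ennreal)
    have gm: "g \<in> borel_measurable P" using g by (rule bounded_measurable_measurable)
    have gi: "integrable \<pi> g"
      using g bounded_measurable_sets_cong[OF sets] by (intro \<pi>.integrable_bounded_measurable) simp
    have gl: "integrable \<pi> (\<lambda>z. g z - ln (D z))" using gi lni by simp
    have dm: "(\<lambda>z. g z - ln (D z)) \<in> borel_measurable P" using gm D(1) by measurable
    have egi: "integrable P (\<lambda>z. exp (g z))"
    proof -
      obtain K where K: "K \<ge> 0" "\<And>z. z \<in> space P \<Longrightarrow> \<bar>g z\<bar> \<le> K" using bounded_measurable_bound[OF g] by blast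
      have "g z \<le> K" if "z \<in> space P" for z using K(2)[OF that] by simp
      then show ?thesis using gm by (intro P.integrable_const_bound[of _ "exp K"]) auto
    qed
    have dens_i: "integrable P (\<lambda>z. D z *\<^sub>R (g z - ln (D z)))"
      using gl integrable_density[OF dm D(1)] D(2) unfolding D(3)[symmetric] by simp
    have "(\<integral>z. g z - ln (D z) \<partial>\<pi>) = (\<integral>z. D z *\<^sub>R (g z - ln (D z)) \<partial>P)"
      using integral_density[OF dm D(1)] D(2) unfolding D(3)[symmetric] by simp
    also have "\<dots> \<le> (\<integral>z. exp (g z) - D z \<partial>P)"
    proof (rule integral_mono[OF dens_i])
      show "integrable P (\<lambda>z. exp (g z) - D z)" using egi D(5) by simp
      fix z
      show "D z *\<^sub>R (g z - ln (D z)) \<le> exp (g z) - D z"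
      proof (cases "D z = 0")
        case False
        then have p: "D z > 0" using D(2)[of z] by simp
        have "D z * (1 + (g z - ln (D z))) \<le> D z * exp (g z - ln (D z))"
          using p by (intro mult_left_mono exp_ge_add_one_self) auto
        also have "\<dots> = exp (g z)" using p by (simp add: exp_diff)
        finally show ?thesis by (simp add: algebra_simps)
      qed simp
    qed
    also have "\<dots> = (\<integral>z. exp (g z) \<partial>P) - 1" using egi D(5,6) by simp
    finally show ?thesis unfolding KL using gi lni by simp
  qed
qed

text \<open>The ideal test function \<open>ln D\<close> may be unbounded, so it is truncated to
  \<open>[- m, m]\<close>. The lower cut raises the integral of \<open>exp h\<close> by at most
  \<open>exp (- m)\<close>, and the upper cut only lowers it; the summand 1 in the bound is the
  total mass of \<open>D\<close>.\<close>

theorem KL_upper_bound: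
  assumes P: "prob_space P" and \<pi>: "prob_space \<pi>" and sets: "sets \<pi> = sets P" and ac: "absolutely_continuous P \<pi>"
    and bound: "\<And>h. h \<in> bounded_measurable P \<Longrightarrow> (\<integral>z. h z \<partial>\<pi>) - (\<integral>z. exp (h z) \<partial>P) \<le> C"
  shows "KL \<pi> P \<le> ereal (C + 1)"
proof -
  interpret P: prob_space P by (rule P)
  interpret \<pi>: prob_space \<pi> by (rule \<pi>)
  obtain D where D: "D \<in> borel_measurable P" "\<And>z. 0 \<le> D z" "\<pi> = density P (\<lambda>z. ennreal (D z))"
    "AE z in \<pi>. 0 < D z" "integrable P D" "(\<integral>z. D z \<partial>P) = 1"
    "KL \<pi> P = enn2ereal (\<integral>\<^sup>+ z. ennreal (ln (D z)) \<partial>\<pi>) - enn2ereal (\<integral>\<^sup>+ z. ennreal (- ln (D z)) \<partial>\<pi>)"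
    "integrable \<pi> (\<lambda>z. max 0 (- ln (D z)))"
    using KL_real_density[OF P \<pi> sets ac] by metis
  have D\<pi>: "D \<in> borel_measurable \<pi>" using D(1) unfolding measurable_cong_sets[OF sets refl] .
  have neg: "(\<integral>\<^sup>+ z. ennreal (- ln (D z)) \<partial>\<pi>) = ennreal (\<integral>z. max 0 (- ln (D z)) \<partial>\<pi>)"
    using nn_integral_eq_integral[OF D(8)] by (simp add: ennreal_max_0)
  define q where "q = (\<integral>z. max 0 (- ln (D z)) \<partial>\<pi>)"
  \<comment> \<open>Truncations of the positive part of \<open>ln D\<close> only; the negative part
    has finite integral \<open>q\<close> and is carried along untruncated.\<close>
  define p where "p = (\<lambda>n::nat. \<lambda>z. min (real n) (max 0 (ln (D z))))"
  have pb: "p n \<in> bounded_measurable \<pi>" for n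
    unfolding p_def by (rule bounded_measurableI[of _ _ "real n"]) (use D\<pi> in auto)
  have step: "(\<integral>z. p m z \<partial>\<pi>) \<le> C + 1 + q + exp (- real m)" for m
  proof -
    \<comment> \<open>The case distinction is on \<open>D z\<close> rather than on
      \<open>ln (D z)\<close>, because \<open>ln 0\<close> is a default value: where
      \<open>D z = 0\<close> the intended value is the lower cut \<open>- m\<close>.\<close>
    define h where "h = (\<lambda>z. if D z \<le> exp (- real m) then - real m else min (real m) (ln (D z)))"
    have h: "h \<in> bounded_measurable P"
    proof (rule bounded_measurableI[of _ _ "real m"])
      show "h \<in> borel_measurable P" unfolding h_def using D(1) by measurable
      fix z
      show "\<bar>h z\<bar> \<le> real m"
      proof (cases "D z \<le> exp (- real m)")
        case False
        then have "D z > 0" using exp_gt_zero[of "- real m"] by linarith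
        then have "ln (exp (- real m)) \<le> ln (D z)" using False by (subst ln_le_cancel_iff) auto
        then show ?thesis using False by (auto simp: h_def)
      qed (simp add: h_def)
    qed
    have hi: "integrable \<pi> h" using h bounded_measurable_sets_cong[OF sets] by (intro \<pi>.integrable_bounded_measurable) simp
    have le: "exp (h z) \<le> exp (- real m) + D z" for z
    proof (cases "D z \<le> exp (- real m)")
      case False
      then have "D z > 0" using exp_gt_zero[of "- real m"] by linarith
      then have "exp (h z) \<le> exp (ln (D z))" using False by (subst exp_le_cancel_iff) (simp add: h_def)
      also have "\<dots> = D z" using \<open>D z > 0\<close> by simp
      finally show ?thesis using exp_gt_zero[of "- real m"] by linarith
    qed (use D(2)[of z] in \<open>simp add: h_def\<close>)
    have "(\<integral>z. exp (h z) \<partial>P) \<le> (\<integral>z. exp (- real m) + D z \<partial>P)"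
      by (rule integral_mono_AE'[OF _ AE_I2[OF le]]) (use D(2,5) in \<open>auto intro!: AE_I2 add_nonneg_nonneg\<close>)
    also have "\<dots> = exp (- real m) + 1" using D(5,6) by (simp add: P.prob_space)
    finally have 1: "(\<integral>z. h z \<partial>\<pi>) \<le> C + 1 + exp (- real m)" using bound[OF h] by simp
    have "(\<integral>z. p m z \<partial>\<pi>) \<le> (\<integral>z. h z + max 0 (- ln (D z)) \<partial>\<pi>)"
    proof (rule integral_mono_AE[OF \<pi>.integrable_bounded_measurable[OF pb]])
      show "integrable \<pi> (\<lambda>z. h z + max 0 (- ln (D z)))" using hi D(8) by simp
      show "AE z in \<pi>. p m z \<le> h z + max 0 (- ln (D z))"
        using D(4)
      proof eventually_elim
        case (elim z)
        show ?case
        proof (cases "D z \<le> exp (- real m)")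
          case True
          then have "ln (D z) \<le> ln (exp (- real m))" using elim by (subst ln_le_cancel_iff) auto
          then show ?thesis using True by (simp add: h_def p_def)
        next
          case False
          then show ?thesis by (simp add: h_def p_def)
        qed
      qed
    qed
    also have "\<dots> = (\<integral>z. h z \<partial>\<pi>) + q" using hi D(8) by (simp add: q_def)
    finally show ?thesis using 1 by simp
  qed
  \<comment> \<open>\<open>p n\<close> increases in \<open>n\<close>, so \<open>n\<close> stays
    fixed while the error \<open>exp (- m)\<close> of \<open>step\<close> tends to 0.\<close>
  have bnd: "(\<integral>z. p n z \<partial>\<pi>) \<le> C + 1 + q" for n
  proof -
    have "(\<lambda>m. C + 1 + q + exp (- real m)) \<longlonglongrightarrow> C + 1 + q + 0"
      by (intro tendsto_add tendsto_const filterlim_compose[OF exp_at_bot]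
            filterlim_compose[OF filterlim_uminus_at_bot_at_top filterlim_real_sequentially])
    moreover have "(\<integral>z. p n z \<partial>\<pi>) \<le> C + 1 + q + exp (- real m)" if "m \<ge> n" for m
    proof -
      have "(\<integral>z. p n z \<partial>\<pi>) \<le> (\<integral>z. p m z \<partial>\<pi>)"
        by (intro integral_mono \<pi>.integrable_bounded_measurable pb) (use that in \<open>auto simp: p_def\<close>)
      then show ?thesis using step[of m] by simp
    qed
    ultimately show ?thesis using LIMSEQ_le_const[of _ "C + 1 + q" "\<integral>z. p n z \<partial>\<pi>"] by auto
  qed
  have K0: "0 \<le> C + 1 + q" using bnd[of 0] by (simp add: p_def)
  \<comment> \<open>\<open>ennreal\<close> sends negative reals to 0, so both sides see only the
    positive part.\<close>
  have sup: "ennreal (ln (D z)) = (SUP n. ennreal (p n z))" for z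
  proof (rule antisym)
    obtain n :: nat where "ln (D z) \<le> real n" using real_arch_simple by blast
    then have "ennreal (ln (D z)) \<le> ennreal (p n z)" by (auto simp: p_def intro!: ennreal_leI)
    then show "ennreal (ln (D z)) \<le> (SUP n. ennreal (p n z))" by (meson SUP_upper2 UNIV_I)
    have "ennreal (p n z) \<le> ennreal (max 0 (ln (D z)))" for n
      by (intro ennreal_leI) (simp add: p_def)
    then have "ennreal (p n z) \<le> ennreal (ln (D z))" for n by (simp only: ennreal_max_0)
    then show "(SUP n. ennreal (p n z)) \<le> ennreal (ln (D z))" by (intro SUP_least)
  qed
  have "(\<integral>\<^sup>+ z. ennreal (ln (D z)) \<partial>\<pi>) = (\<integral>\<^sup>+ z. (SUP n. ennreal (p n z)) \<partial>\<pi>)" by (simp add: sup)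
  also have "\<dots> = (SUP n. \<integral>\<^sup>+ z. ennreal (p n z) \<partial>\<pi>)"
    using pb by (intro nn_integral_monotone_convergence_SUP)
      (auto simp: incseq_def le_fun_def p_def bounded_measurable_def intro!: ennreal_leI)
  also have "\<dots> \<le> ennreal (C + 1 + q)"
  proof (rule SUP_least)
    fix n
    have "(\<integral>\<^sup>+ z. ennreal (p n z) \<partial>\<pi>) = ennreal (\<integral>z. p n z \<partial>\<pi>)"
      by (intro nn_integral_eq_integral \<pi>.integrable_bounded_measurable pb) (auto simp: p_def)
    then show "(\<integral>\<^sup>+ z. ennreal (p n z) \<partial>\<pi>) \<le> ennreal (C + 1 + q)" using bnd[of n] by (simp add: ennreal_leI)
  qed
  finally have "enn2ereal (\<integral>\<^sup>+ z. ennreal (ln (D z)) \<partial>\<pi>) \<le> ereal (C + 1 + q)"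
    using K0 by (metis enn2ereal_ennreal less_eq_ennreal.rep_eq)
  then have "KL \<pi> P \<le> ereal (C + 1 + q) - enn2ereal (ennreal q)"
    unfolding D(7) neg q_def[symmetric] by (rule ereal_minus_mono) simp
  also have "\<dots> = ereal (C + 1)"
    using Bochner_Integration.integral_nonneg[of \<pi> "\<lambda>z. max 0 (- ln (D z))"] by (simp add: q_def enn2ereal_ennreal)
  finally show ?thesis .
qed


section \<open>Duality\<close>

text \<open>One flag per side reduces the four versions to pairs of components, each of which is
  treated once for both orders of the two paths.\<close>

definition dual_component ::
  "bool \<Rightarrow> nat \<Rightarrow> (nat \<Rightarrow> 'a topology) \<Rightarrow> (nat \<Rightarrow> 'b topology) \<Rightarrow> ('w \<Rightarrow> nat \<Rightarrow> 'a) \<Rightarrow> ('w \<Rightarrow> nat \<Rightarrow> 'b) \<Rightarrow>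
     (nat \<Rightarrow> (nat \<Rightarrow> 'a) \<Rightarrow> 'a measure) \<Rightarrow> ('w \<Rightarrow> real) set" where
  "dual_component b N X Y \<xi> \<zeta> \<kappa> = (if b then adapted_functions N X Y \<xi> \<zeta> \<kappa> else path_functions N X \<xi>)"

context path_process
begin

lemma component_bounded_measurable: "dual_component b N X Y \<xi> \<zeta> \<kappa> \<subseteq> bounded_measurable M"
  using adapted_bounded_measurable bounded_measurable_path by (auto simp: dual_component_def path_functions_def)

lemma component_lincomb:
  assumes "f \<in> dual_component b N X Y \<xi> \<zeta> \<kappa>" "g \<in> dual_component b N X Y \<xi> \<zeta> \<kappa>"
  shows "\<exists>h\<in>dual_component b N X Y \<xi> \<zeta> \<kappa>. \<forall>w\<in>space M. h w = \<alpha> * f w + \<beta> * g w"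
proof (cases b)
  case True
  then show ?thesis using adapted_lincomb assms by (simp add: dual_component_def)
next
  case False
  then obtain f' g' where "f' \<in> bounded_measurable (path_space X N)" "f = (\<lambda>w. f' (\<xi> w))"
    "g' \<in> bounded_measurable (path_space X N)" "g = (\<lambda>w. g' (\<xi> w))"
    using assms by (auto simp: dual_component_def path_functions_def)
  then have "(\<lambda>w. \<alpha> * f w + \<beta> * g w) \<in> dual_component b N X Y \<xi> \<zeta> \<kappa>"
    using False
    by (auto simp: dual_component_def path_functions_def
        intro!: exI[of _ "\<lambda>x. \<alpha> * f' x + \<beta> * g' x"] fun_space_lincomb[OF fun_space_bounded_measurable])
  then show ?thesis by (rule bexI[rotated]) simp
qed

lemma component_const: "1 \<le> N \<Longrightarrow> (\<lambda>w. k) \<in> dual_component b N X Y \<xi> \<zeta> \<kappa>"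
  using const_adapted by (auto simp: dual_component_def path_functions_def intro!: exI[of _ "\<lambda>_. k"] bounded_measurable_const)

text \<open>Either component determines \<open>L\<close> on all functions of the path: directly, or
  by way of the innovations.\<close>

lemma component_functional_on_paths:
  assumes causal: "causal_process" and L: "linear_on (bounded_measurable M) L"
    and pos: "\<And>f. f \<in> bounded_measurable M \<Longrightarrow> (\<And>w. w \<in> space M \<Longrightarrow> 0 \<le> f w) \<Longrightarrow> 0 \<le> L f"
    and eq: "\<And>s. s \<in> dual_component b N X Y \<xi> \<zeta> \<kappa> \<Longrightarrow> L s = (\<integral>w. s w \<partial>M)"
    and N: "1 \<le> N" and f: "f \<in> bounded_measurable (path_space X N)"
  shows "L (\<lambda>w. f (\<xi> w)) = (\<integral>x. f x \<partial>\<mu>)"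
proof -
  have "L (\<lambda>w. f (\<xi> w)) = (\<integral>w. f (\<xi> w) \<partial>M)"
  proof (cases b)
    case True
    have "L h = (\<integral>w. h w \<partial>M)" if "t \<in> {1..N}" "h \<in> innovations X Y \<xi> \<zeta> \<kappa> t" for t h
      using subsetD[OF innovations_subset_adapted[OF that(1)] that(2)] True by (intro eq) (simp add: dual_component_def)
    from functional_eq_on_paths[OF causal L pos this N f] show ?thesis .
  next
    case False
    then show ?thesis using f by (intro eq) (auto simp: dual_component_def path_functions_def)
  qed
  then show ?thesis using integral_\<xi>[OF bounded_measurable_measurable[OF f]] by simp
qed

end

lemma component_integral_eq:
  assumes p: "path_process M \<mu> X Y N \<kappa> \<xi> \<zeta>" and q: "path_process M' \<mu> X Y N \<kappa> \<xi> \<zeta>"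
    and causal: "b \<Longrightarrow> path_process.causal_process M X Y N \<kappa> \<xi> \<zeta>" "b \<Longrightarrow> path_process.causal_process M' X Y N \<kappa> \<xi> \<zeta>"
    and N: "1 \<le> N" and s: "s \<in> dual_component b N X Y \<xi> \<zeta> \<kappa>"
  shows "(\<integral>w. s w \<partial>M) = (\<integral>w. s w \<partial>M')"
proof (cases b)
  case True
  then show ?thesis using s integral_adapted_eq[OF p causal(1) q causal(2) N] by (simp add: dual_component_def)
next
  case False
  then obtain f where "s = (\<lambda>w. f (\<xi> w))" "f \<in> bounded_measurable (path_space X N)"
    using s by (auto simp: dual_component_def path_functions_def)
  then show ?thesis
    using path_process.integral_\<xi>[OF p] path_process.integral_\<xi>[OF q] by (simp add: bounded_measurable_measurable)
qed

text \<open>\<open>M\<close> is a causal reference measure, which forces \<open>L\<close> to vanish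
  on the later innovations. Agreement with \<open>M'\<close> on rectangles extends, for fixed
  \<open>B\<close>, to all \<open>f (\<xi> w) * indicator B (\<zeta> w)\<close> by uniform
  approximation in \<open>f\<close> alone, without countable additivity of \<open>L\<close>.\<close>

lemma causal_process_of_functional:
  assumes p: "path_process M \<mu> X Y N \<kappa> \<xi> \<zeta>" and causal: "path_process.causal_process M X Y N \<kappa> \<xi> \<zeta>"
    and q: "path_process M' \<mu> X Y N \<kappa> \<xi> \<zeta>" and sets: "sets M' = sets M"
    and L: "linear_on (bounded_measurable M) L"
    and pos: "\<And>f. f \<in> bounded_measurable M \<Longrightarrow> (\<And>w. w \<in> space M \<Longrightarrow> 0 \<le> f w) \<Longrightarrow> 0 \<le> L f"
    and eq: "\<And>s. s \<in> adapted_functions N X Y \<xi> \<zeta> \<kappa> \<Longrightarrow> L s = (\<integral>w. s w \<partial>M)"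
    and rect: "\<And>A B. A \<in> sets (path_space X N) \<Longrightarrow> B \<in> sets (path_space Y N) \<Longrightarrow>
      L (\<lambda>w. indicator A (\<xi> w) * indicator B (\<zeta> w)) = (\<integral>w. indicator A (\<xi> w) * indicator B (\<zeta> w) \<partial>M')"
  shows "path_process.causal_process M' X Y N \<kappa> \<xi> \<zeta>"
proof -
  interpret p: path_process M \<mu> X Y N \<kappa> \<xi> \<zeta> by (rule p)
  interpret q: path_process M' \<mu> X Y N \<kappa> \<xi> \<zeta> by (rule q)
  note V = bounded_measurable_sets_cong[OF sets] and sp = sets_eq_imp_space_eq[OF sets]
  show ?thesis
  proof (rule q.causal_process_if_functional[of L])
    show "linear_on (bounded_measurable M') L" unfolding V by (rule L)
    show "0 \<le> L f" if "f \<in> bounded_measurable M'" "\<And>w. w \<in> space M' \<Longrightarrow> 0 \<le> f w" for f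
      using that unfolding V sp by (rule pos)
    show "L h = 0" if t: "1 \<le> t" "Suc t \<le> N" and h: "h \<in> innovations X Y \<xi> \<zeta> \<kappa> (Suc t)" for t h
    proof -
      have "h \<in> adapted_functions N X Y \<xi> \<zeta> \<kappa>"
        using innovations_subset_adapted[of "Suc t" N X Y \<xi> \<zeta> \<kappa>] t h by auto
      then show ?thesis using eq p.integral_innovation[OF causal t h] by simp
    qed
    show "L (\<lambda>w. f (\<xi> w) * indicator B (\<zeta> w)) = (\<integral>w. f (\<xi> w) * indicator B (\<zeta> w) \<partial>M')"
      if f: "f \<in> bounded_measurable (path_space X N)" and B: "B \<in> sets (path_space Y N)" for f B
    proof -
      have Bp: "(\<lambda>w. indicator B (\<zeta> w) :: real) \<in> bounded_measurable M"
        by (rule bounded_measurable_compose[OF bounded_measurable_indicator[OF B] p.\<zeta>])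
      then have Bq: "(\<lambda>w. indicator B (\<zeta> w) :: real) \<in> bounded_measurable M'" by (simp only: V)
      have fp: "(\<lambda>w. g (\<xi> w) * indicator B (\<zeta> w)) \<in> bounded_measurable M"
        if "g \<in> bounded_measurable (path_space X N)" for g
        by (rule bounded_measurable_mult[OF p.bounded_measurable_path[OF that] Bp])
      have fi: "integrable M' (\<lambda>w. g (\<xi> w) * indicator B (\<zeta> w))"
        if "g \<in> bounded_measurable (path_space X N)" for g
        by (rule q.M.integrable_bounded_measurable[OF bounded_measurable_mult[OF q.bounded_measurable_path[OF that] Bq]])
      show ?thesis
      proof (rule positive_functional_eq_indicators[where ?L1.0 = "\<lambda>g. L (\<lambda>w. g (\<xi> w) * indicator B (\<zeta> w))"
            and ?L2.0 = "\<lambda>g. \<integral>w. g (\<xi> w) * indicator B (\<zeta> w) \<partial>M'", OF _ _ _ _ _ f])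
        show "linear_on (bounded_measurable (path_space X N)) (\<lambda>g. L (\<lambda>w. g (\<xi> w) * indicator B (\<zeta> w)))"
          unfolding linear_on_def
        proof (intro ballI allI)
          fix g h a b assume gh: "g \<in> bounded_measurable (path_space X N)" "h \<in> bounded_measurable (path_space X N)"
          have "L (\<lambda>w. (a * g (\<xi> w) + b * h (\<xi> w)) * indicator B (\<zeta> w)) =
              L (\<lambda>w. a * (g (\<xi> w) * indicator B (\<zeta> w)) + b * (h (\<xi> w) * indicator B (\<zeta> w)))"
            by (simp add: algebra_simps)
          also have "\<dots> = a * L (\<lambda>w. g (\<xi> w) * indicator B (\<zeta> w)) + b * L (\<lambda>w. h (\<xi> w) * indicator B (\<zeta> w))"
            by (rule linear_on_lincomb[OF L fp[OF gh(1)] fp[OF gh(2)]])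
          finally show "L (\<lambda>w. (a * g (\<xi> w) + b * h (\<xi> w)) * indicator B (\<zeta> w)) =
              a * L (\<lambda>w. g (\<xi> w) * indicator B (\<zeta> w)) + b * L (\<lambda>w. h (\<xi> w) * indicator B (\<zeta> w))" .
        qed
        show "linear_on (bounded_measurable (path_space X N)) (\<lambda>g. \<integral>w. g (\<xi> w) * indicator B (\<zeta> w) \<partial>M')"
          unfolding linear_on_def
        proof (intro ballI allI)
          fix g h a b assume gh: "g \<in> bounded_measurable (path_space X N)" "h \<in> bounded_measurable (path_space X N)"
          have "(\<integral>w. (a * g (\<xi> w) + b * h (\<xi> w)) * indicator B (\<zeta> w) \<partial>M') =
              (\<integral>w. a * (g (\<xi> w) * indicator B (\<zeta> w)) + b * (h (\<xi> w) * indicator B (\<zeta> w)) \<partial>M')"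
            by (simp add: algebra_simps)
          also have "\<dots> = a * (\<integral>w. g (\<xi> w) * indicator B (\<zeta> w) \<partial>M') + b * (\<integral>w. h (\<xi> w) * indicator B (\<zeta> w) \<partial>M')"
            using fi[OF gh(1)] fi[OF gh(2)] by simp
          finally show "(\<integral>w. (a * g (\<xi> w) + b * h (\<xi> w)) * indicator B (\<zeta> w) \<partial>M') =
              a * (\<integral>w. g (\<xi> w) * indicator B (\<zeta> w) \<partial>M') + b * (\<integral>w. h (\<xi> w) * indicator B (\<zeta> w) \<partial>M')" .
        qed
        show "0 \<le> L (\<lambda>w. g (\<xi> w) * indicator B (\<zeta> w))"
          if "g \<in> bounded_measurable (path_space X N)" "\<And>x. x \<in> space (path_space X N) \<Longrightarrow> 0 \<le> g x" for g
          using that measurable_space[OF p.\<xi>] by (intro pos fp mult_nonneg_nonneg) auto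
        show "0 \<le> (\<integral>w. g (\<xi> w) * indicator B (\<zeta> w) \<partial>M')"
          if "\<And>x. x \<in> space (path_space X N) \<Longrightarrow> 0 \<le> g x" for g :: "_ \<Rightarrow> real"
          using that measurable_space[OF q.\<xi>] by (intro Bochner_Integration.integral_nonneg mult_nonneg_nonneg) auto
        show "L (\<lambda>w. indicator A (\<xi> w) * indicator B (\<zeta> w)) = (\<integral>w. indicator A (\<xi> w) * indicator B (\<zeta> w) \<partial>M')"
          if "A \<in> sets (path_space X N)" for A
          using rect[OF that B] .
      qed
    qed
  qed
qed

section \<open>The four versions as pairs of components\<close>

lemma A_X_eq_innovations: "A_X X Y \<kappa> t = innovations X Y fst snd \<kappa> t"
  by (simp add: A_X_def innovations_def case_prod_unfold)

lemma bounded_measurable_swap: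
  "f \<in> bounded_measurable (A \<Otimes>\<^sub>M B) \<Longrightarrow> (\<lambda>p. f (snd p, fst p)) \<in> bounded_measurable (B \<Otimes>\<^sub>M A)"
  using bounded_measurable_compose[OF _ measurable_Pair[OF measurable_snd measurable_fst]] .

text \<open>The generic innovations list the observed path first, so the two arguments of
  \<open>a\<close> have to be exchanged.\<close>

lemma A_Y_eq_innovations: "A_Y X Y \<eta> t = innovations Y X snd fst \<eta> t"
proof (cases "t = 1")
  case True
  then show ?thesis by (simp add: A_Y_def innovations_def case_prod_unfold)
next
  case False
  define I where "I = (\<lambda>(a :: (nat \<Rightarrow> 'a) \<times> (nat \<Rightarrow> 'b) \<Rightarrow> real) w. a (restrict (fst w) {1..t-1}, restrict (snd w) {1..t}) -
     (\<integral>u. a (restrict (fst w) {1..t-1}, (restrict (snd w) {1..t-1})(t := u)) \<partial>\<eta> t (restrict (snd w) {1..t-1})))"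
  have A: "A_Y X Y \<eta> t = {I a | a. a \<in> bounded_measurable (path_space X (t - 1) \<Otimes>\<^sub>M path_space Y t)}"
    using False by (simp add: A_Y_def I_def case_prod_unfold)
  have B: "innovations Y X snd fst \<eta> t =
      {I (\<lambda>p. a (snd p, fst p)) | a. a \<in> bounded_measurable (path_space Y t \<Otimes>\<^sub>M path_space X (t - 1))}"
    using False by (simp add: innovations_def I_def)
  show ?thesis
    unfolding A B
  proof (intro equalityI subsetI)
    fix f assume "f \<in> {I a | a. a \<in> bounded_measurable (path_space X (t - 1) \<Otimes>\<^sub>M path_space Y t)}"
    then obtain a where a: "f = I a" "a \<in> bounded_measurable (path_space X (t - 1) \<Otimes>\<^sub>M path_space Y t)" by blast
    then show "f \<in> {I (\<lambda>p. a (snd p, fst p)) | a. a \<in> bounded_measurable (path_space Y t \<Otimes>\<^sub>M path_space X (t - 1))}"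
      using bounded_measurable_swap[OF a(2)] by (intro CollectI exI[of _ "\<lambda>p. a (snd p, fst p)"]) simp
  next
    fix f assume "f \<in> {I (\<lambda>p. a (snd p, fst p)) | a. a \<in> bounded_measurable (path_space Y t \<Otimes>\<^sub>M path_space X (t - 1))}"
    then show "f \<in> {I a | a. a \<in> bounded_measurable (path_space X (t - 1) \<Otimes>\<^sub>M path_space Y t)}"
      using bounded_measurable_swap by blast
  qed
qed

definition causal_version :: "version \<Rightarrow> bool" where
  "causal_version v \<longleftrightarrow> v = Causal \<or> v = Bicausal"

definition anticausal_version :: "version \<Rightarrow> bool" where
  "anticausal_version v \<longleftrightarrow> v = Anticausal \<or> v = Bicausal"

lemma dual_space_eq_components:
  fixes X :: "nat \<Rightarrow> 'a topology" and Y :: "nat \<Rightarrow> 'b topology"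
  shows "dual_space v N X Y \<kappa> \<eta> = fun_sum (dual_component (causal_version v) N X Y fst snd \<kappa>)
     (dual_component (anticausal_version v) N Y X snd fst \<eta>)"
proof -
  have "(S_X N X :: (('a, 'b) paths \<Rightarrow> real) set) = path_functions N X fst"
    "(S_Y N Y :: (('a, 'b) paths \<Rightarrow> real) set) = path_functions N Y snd"
    by (auto simp: S_X_def S_Y_def path_functions_def case_prod_unfold)
  moreover have "S_X_adapted N X Y \<kappa> = adapted_functions N X Y fst snd \<kappa>"
    "S_Y_adapted N X Y \<eta> = adapted_functions N Y X snd fst \<eta>"
    by (simp_all add: S_X_adapted_def S_Y_adapted_def adapted_functions_def A_X_eq_innovations A_Y_eq_innovations)
  ultimately show ?thesis
    by (cases v) (simp_all add: dual_component_def causal_version_def anticausal_version_def)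
qed

lemma couplings_of_iff:
  "\<pi> \<in> couplings_of v N X Y \<mu> \<nu> \<longleftrightarrow> \<pi> \<in> couplings \<mu> \<nu> \<and>
     (causal_version v \<longrightarrow> causal N X Y \<pi>) \<and> (anticausal_version v \<longrightarrow> anticausal N X Y \<pi>)"
  by (cases v) (auto simp: causal_version_def anticausal_version_def)

lemma polish_path_topology:
  assumes "\<And>t. t \<in> {1..N} \<Longrightarrow> polish_topology (X t)"
  shows "polish_topology (path_topology X N)"
proof -
  have "countable {i \<in> {1..N}. \<not> (\<exists>a. topspace (X i) \<subseteq> {a})}" by (intro countable_finite) simp
  then have "completely_metrizable_space (path_topology X N)"
    unfolding path_topology_def completely_metrizable_space_product_topology
    using assms by (auto simp: polish_topology_def)
  then show ?thesis
    using second_countable_path_topology[of N X] assms by (auto simp: polish_topology_def)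
qed

section \<open>The transport problem, its plans, and functionals that determine a plan\<close>

locale transport_problem =
  fixes X :: "nat \<Rightarrow> 'a topology" and Y :: "nat \<Rightarrow> 'b topology" and N :: nat
    and \<mu> :: "(nat \<Rightarrow> 'a) measure" and \<nu> :: "(nat \<Rightarrow> 'b) measure"
    and \<kappa> :: "nat \<Rightarrow> (nat \<Rightarrow> 'a) \<Rightarrow> 'a measure" and \<eta> :: "nat \<Rightarrow> (nat \<Rightarrow> 'b) \<Rightarrow> 'b measure"
  assumes N: "1 \<le> N"
    and polish_X: "\<And>t. t \<in> {1..N} \<Longrightarrow> polish_topology (X t)"
    and polish_Y: "\<And>t. t \<in> {1..N} \<Longrightarrow> polish_topology (Y t)"
    and \<mu>: "prob_space \<mu>" "sets \<mu> = sets (path_space X N)"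
    and \<nu>: "prob_space \<nu>" "sets \<nu> = sets (path_space Y N)"
    and \<kappa>: "\<And>t. t \<in> {2..N} \<Longrightarrow> regular_cond_law X \<mu> t (\<kappa> t)"
    and \<eta>: "\<And>t. t \<in> {2..N} \<Longrightarrow> regular_cond_law Y \<nu> t (\<eta> t)"
begin

definition "P = \<mu> \<Otimes>\<^sub>M \<nu>"

lemma prob_P: "prob_space P"
proof -
  interpret \<mu>: prob_space \<mu> by (rule \<mu>)
  interpret \<nu>: prob_space \<nu> by (rule \<nu>)
  interpret pair_prob_space \<mu> \<nu> ..
  show ?thesis unfolding P_def by unfold_locales
qed

lemma fst_measurable: "sets \<pi> = sets P \<Longrightarrow> fst \<in> measurable \<pi> (path_space X N)"
  using measurable_fst[of \<mu> \<nu>] measurable_cong_sets[of \<pi> P \<mu> "path_space X N"] \<mu>(2) by (simp add: P_def)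

lemma snd_measurable: "sets \<pi> = sets P \<Longrightarrow> snd \<in> measurable \<pi> (path_space Y N)"
  using measurable_snd[of \<mu> \<nu>] measurable_cong_sets[of \<pi> P \<nu> "path_space Y N"] \<nu>(2) by (simp add: P_def)

lemma couplingsD:
  assumes "\<pi> \<in> couplings \<mu> \<nu>"
  shows "prob_space \<pi>" "sets \<pi> = sets P" "distr \<pi> \<mu> fst = \<mu>" "distr \<pi> \<nu> snd = \<nu>"
  using assms by (auto simp: couplings_def P_def)

lemma coupling_path_process:
  assumes "\<pi> \<in> couplings \<mu> \<nu>"
  shows "path_process \<pi> \<mu> X Y N \<kappa> fst snd"
proof -
  note c = couplingsD[OF assms]
  show ?thesis
    unfolding path_process_def path_process_axioms_def
    using \<mu> \<kappa> c fst_measurable[OF c(2)] snd_measurable[OF c(2)] by blast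
qed

lemma coupling_path_process':
  assumes "\<pi> \<in> couplings \<mu> \<nu>"
  shows "path_process \<pi> \<nu> Y X N \<eta> snd fst"
proof -
  note c = couplingsD[OF assms]
  show ?thesis
    unfolding path_process_def path_process_axioms_def
    using \<nu> \<eta> c fst_measurable[OF c(2)] snd_measurable[OF c(2)] by blast
qed

abbreviation "plans v \<equiv> couplings_of v N X Y \<mu> \<nu>"
abbreviation "dual v \<equiv> dual_space v N X Y \<kappa> \<eta>"

lemma couplings_of_iff_causal_process:
  "\<pi> \<in> plans v \<longleftrightarrow> \<pi> \<in> couplings \<mu> \<nu> \<and>
     (causal_version v \<longrightarrow> path_process.causal_process \<pi> X Y N \<kappa> fst snd) \<and>
     (anticausal_version v \<longrightarrow> path_process.causal_process \<pi> Y X N \<eta> snd fst)"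
proof (cases "\<pi> \<in> couplings \<mu> \<nu>")
  case True
  show ?thesis
    unfolding couplings_of_iff causal_def anticausal_def case_prod_unfold
      path_process.causal_process_iff_cond_indep[OF coupling_path_process[OF True]]
      path_process.causal_process_iff_cond_indep[OF coupling_path_process'[OF True]] ..
qed (simp add: couplings_of_iff)

lemma P_coupling: "P \<in> couplings \<mu> \<nu>"
proof -
  interpret \<mu>: prob_space \<mu> by (rule \<mu>)
  interpret \<nu>: prob_space \<nu> by (rule \<nu>)
  interpret pair_prob_space \<mu> \<nu> ..
  have "distr P \<mu> fst = \<mu>" unfolding P_def by (rule \<nu>.distr_pair_fst)
  moreover have "distr P \<nu> snd = \<nu>"
  proof (rule measure_eqI)
    fix B assume "B \<in> sets (distr P \<nu> snd)"
    then have B: "B \<in> sets \<nu>" by simp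
    have "snd -` B \<inter> space P = space \<mu> \<times> B"
      using sets.sets_into_space[OF B] by (auto simp: P_def space_pair_measure)
    then show "emeasure (distr P \<nu> snd) B = emeasure \<nu> B"
      using B \<nu>.emeasure_pair_measure_Times[of "space \<mu>" \<mu> B]
      by (simp add: P_def emeasure_distr \<mu>.emeasure_space_1)
  qed simp
  ultimately show ?thesis using prob_P by (simp add: couplings_def P_def)
qed

lemma integral_product:
  assumes f: "f \<in> bounded_measurable (path_space X N)" and g: "g \<in> bounded_measurable (path_space Y N)"
  shows "(\<integral>z. f (fst z) * g (snd z) \<partial>P) = (\<integral>z. f (fst z) \<partial>P) * (\<integral>z. g (snd z) \<partial>P)"
proof -
  interpret \<mu>: prob_space \<mu> by (rule \<mu>)
  interpret \<nu>: prob_space \<nu> by (rule \<nu>)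
  interpret pair_prob_space \<mu> \<nu> ..
  interpret x: path_process P \<mu> X Y N \<kappa> fst snd by (rule coupling_path_process[OF P_coupling])
  interpret y: path_process P \<nu> Y X N \<eta> snd fst by (rule coupling_path_process'[OF P_coupling])
  have int: "integrable (\<mu> \<Otimes>\<^sub>M \<nu>) (\<lambda>z. f (fst z) * g (snd z))"
    using x.M.integrable_bounded_measurable[OF bounded_measurable_mult[OF x.bounded_measurable_path[OF f] y.bounded_measurable_path[OF g]]]
    by (simp add: P_def)
  have "(\<integral>z. f (fst z) * g (snd z) \<partial>P) = (\<integral>x. (\<integral>y. f x * g y \<partial>\<nu>) \<partial>\<mu>)"
    using integral_fst'[OF int] by (simp add: P_def)
  also have "\<dots> = (\<integral>x. f x \<partial>\<mu>) * (\<integral>y. g y \<partial>\<nu>)" by simp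
  finally show ?thesis
    by (simp add: x.integral_\<xi>[OF bounded_measurable_measurable[OF f]] y.integral_\<xi>[OF bounded_measurable_measurable[OF g]])
qed

lemma P_causal: "path_process.causal_process P X Y N \<kappa> fst snd"
  by (rule path_process.independent_imp_causal_process[OF coupling_path_process[OF P_coupling]])
     (rule integral_product)

lemma P_anticausal: "path_process.causal_process P Y X N \<eta> snd fst"
proof (rule path_process.independent_imp_causal_process[OF coupling_path_process'[OF P_coupling]])
  fix f g assume "f \<in> bounded_measurable (path_space Y N)" "g \<in> bounded_measurable (path_space X N)"
  from integral_product[OF this(2,1)]
  show "(\<integral>z. f (snd z) * g (fst z) \<partial>P) = (\<integral>z. f (snd z) \<partial>P) * (\<integral>z. g (fst z) \<partial>P)"
    by (simp only: mult.commute)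
qed

lemma dual_spaceE:
  assumes "s \<in> dual v"
  obtains f g where "f \<in> dual_component (causal_version v) N X Y fst snd \<kappa>"
    "g \<in> dual_component (anticausal_version v) N Y X snd fst \<eta>" "s = (\<lambda>z. f z + g z)"
  using assms unfolding dual_space_eq_components fun_sum_def by blast

lemma dual_spaceI:
  assumes "f \<in> dual_component (causal_version v) N X Y fst snd \<kappa>"
    "g \<in> dual_component (anticausal_version v) N Y X snd fst \<eta>"
  shows "(\<lambda>z. f z + g z) \<in> dual v"
  using assms unfolding dual_space_eq_components fun_sum_def by blast

lemma component_subset_dual_space:
  "dual_component (causal_version v) N X Y fst snd \<kappa> \<subseteq> dual v"
  "dual_component (anticausal_version v) N Y X snd fst \<eta> \<subseteq> dual v"
  using dual_spaceI[OF _ path_process.component_const[OF coupling_path_process'[OF P_coupling] N, of 0]]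
    dual_spaceI[OF path_process.component_const[OF coupling_path_process[OF P_coupling] N, of 0]]
  by (simp_all add: subsetI)

lemma dual_space_const: "(\<lambda>z. k) \<in> dual v"
  using component_subset_dual_space(1) path_process.component_const[OF coupling_path_process[OF P_coupling] N]
  by blast

lemma dual_space_bounded_measurable: "dual v \<subseteq> bounded_measurable P"
  using path_process.component_bounded_measurable[OF coupling_path_process[OF P_coupling]]
    path_process.component_bounded_measurable[OF coupling_path_process'[OF P_coupling]]
  by (blast elim: dual_spaceE intro: bounded_measurable_add)

lemma dual_space_lincomb:
  assumes s: "s \<in> dual v" and u: "u \<in> dual v"
  shows "\<exists>w\<in>dual v. \<forall>z\<in>space P. w z = a * s z + b * u z"
proof -
  obtain f g where fg: "f \<in> dual_component (causal_version v) N X Y fst snd \<kappa>"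
    "g \<in> dual_component (anticausal_version v) N Y X snd fst \<eta>" "s = (\<lambda>z. f z + g z)" by (rule dual_spaceE[OF s])
  obtain f' g' where fg': "f' \<in> dual_component (causal_version v) N X Y fst snd \<kappa>"
    "g' \<in> dual_component (anticausal_version v) N Y X snd fst \<eta>" "u = (\<lambda>z. f' z + g' z)" by (rule dual_spaceE[OF u])
  obtain f'' where f'': "f'' \<in> dual_component (causal_version v) N X Y fst snd \<kappa>"
    "\<forall>z\<in>space P. f'' z = a * f z + b * f' z"
    using path_process.component_lincomb[OF coupling_path_process[OF P_coupling] fg(1) fg'(1)] by blast
  obtain g'' where g'': "g'' \<in> dual_component (anticausal_version v) N Y X snd fst \<eta>"
    "\<forall>z\<in>space P. g'' z = a * g z + b * g' z"
    using path_process.component_lincomb[OF coupling_path_process'[OF P_coupling] fg(2) fg'(2)] by blast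
  show ?thesis
    using f'' g'' by (intro bexI[OF _ dual_spaceI[OF f''(1) g''(1)]]) (simp add: fg(3) fg'(3) algebra_simps)
qed

text \<open>The core of weak duality. The two components are compared separately: plain functions of
  one path by the marginals, sums of innovations by causality, both of which \<open>P\<close> shares
  with \<open>\<pi>\<close>.\<close>

lemma integral_dual_space:
  assumes \<pi>: "\<pi> \<in> plans v" and s: "s \<in> dual v"
  shows "(\<integral>z. s z \<partial>\<pi>) = (\<integral>z. s z \<partial>P)"
proof -
  obtain f g where fg: "f \<in> dual_component (causal_version v) N X Y fst snd \<kappa>"
    "g \<in> dual_component (anticausal_version v) N Y X snd fst \<eta>" "s = (\<lambda>z. f z + g z)" by (rule dual_spaceE[OF s])
  have c: "\<pi> \<in> couplings \<mu> \<nu>" using \<pi> by (simp add: couplings_of_iff)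
  interpret x: path_process \<pi> \<mu> X Y N \<kappa> fst snd by (rule coupling_path_process[OF c])
  interpret P: prob_space P by (rule prob_P)
  have bm: "f \<in> bounded_measurable P" "g \<in> bounded_measurable P"
    using fg component_subset_dual_space dual_space_bounded_measurable by blast+
  then have "f \<in> bounded_measurable \<pi>" "g \<in> bounded_measurable \<pi>"
    using bounded_measurable_sets_cong[OF couplingsD(2)[OF c]] by simp_all
  then have "(\<integral>z. s z \<partial>\<pi>) = (\<integral>z. f z \<partial>\<pi>) + (\<integral>z. g z \<partial>\<pi>)"
    by (simp add: fg(3) x.M.integrable_bounded_measurable)
  also have "(\<integral>z. f z \<partial>\<pi>) = (\<integral>z. f z \<partial>P)"
    using \<pi> P_causal
    by (intro component_integral_eq[OF coupling_path_process[OF c] coupling_path_process[OF P_coupling] _ _ N fg(1)])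
       (simp_all add: couplings_of_iff_causal_process)
  also have "(\<integral>z. g z \<partial>\<pi>) = (\<integral>z. g z \<partial>P)"
    using \<pi> P_anticausal
    by (intro component_integral_eq[OF coupling_path_process'[OF c] coupling_path_process'[OF P_coupling] _ _ N fg(2)])
       (simp_all add: couplings_of_iff_causal_process)
  finally show ?thesis using bm by (simp add: fg(3) P.integrable_bounded_measurable)
qed

context
  fixes v L
  assumes L: "linear_on (bounded_measurable P) L"
    and pos: "\<And>f. f \<in> bounded_measurable P \<Longrightarrow> (\<And>z. z \<in> space P \<Longrightarrow> 0 \<le> f z) \<Longrightarrow> 0 \<le> L f"
    and L_dual: "\<And>s. s \<in> dual v \<Longrightarrow> L s = (\<integral>z. s z \<partial>P)"
begin

lemma functional_one: "L (\<lambda>z. 1) = 1"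
  using L_dual[OF dual_space_const[of 1]] prob_space.prob_space[OF prob_P] by simp

text \<open>Each component of the dual space determines \<open>L\<close> on functions of its own
  path, and on \<open>space P\<close> the indicator of a cylinder is such a function.\<close>

lemma functional_marginals:
  assumes "A \<in> sets \<mu>" "B \<in> sets \<nu>"
  shows "L (indicator (A \<times> space \<nu>)) = measure \<mu> A" "L (indicator (space \<mu> \<times> B)) = measure \<nu> B"
proof -
  note px = coupling_path_process[OF P_coupling] and py = coupling_path_process'[OF P_coupling]
  note V = fun_space_bounded_measurable[of P]
  have A: "indicator A \<in> bounded_measurable (path_space X N)" and B: "indicator B \<in> bounded_measurable (path_space Y N)"
    using assms \<mu> \<nu> by (auto intro: bounded_measurable_indicator)
  have rect: "indicator (A \<times> space \<nu>) \<in> bounded_measurable P" "indicator (space \<mu> \<times> B) \<in> bounded_measurable P"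
    using assms by (auto simp: P_def intro!: bounded_measurable_indicator)
  have "L (indicator (A \<times> space \<nu>)) = L (\<lambda>z. indicator A (fst z))"
    by (rule linear_on_eq_positive[where \<Omega> = "space P", OF V L pos rect(1) path_process.bounded_measurable_path[OF px A]])
       (auto simp: P_def space_pair_measure indicator_def)
  also have "\<dots> = (\<integral>x. indicator A x \<partial>\<mu>)"
    by (rule path_process.component_functional_on_paths[OF px P_causal L pos L_dual N A])
       (use component_subset_dual_space in blast)+
  finally show "L (indicator (A \<times> space \<nu>)) = measure \<mu> A" using assms by simp
  have "L (indicator (space \<mu> \<times> B)) = L (\<lambda>z. indicator B (snd z))"
    by (rule linear_on_eq_positive[where \<Omega> = "space P", OF V L pos rect(2) path_process.bounded_measurable_path[OF py B]])
       (auto simp: P_def space_pair_measure indicator_def)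
  also have "\<dots> = (\<integral>x. indicator B x \<partial>\<nu>)"
    by (rule path_process.component_functional_on_paths[OF py P_anticausal L pos L_dual N B])
       (use component_subset_dual_space in blast)+
  finally show "L (indicator (space \<mu> \<times> B)) = measure \<nu> B" using assms by simp
qed

text \<open>Agreement of \<open>\<pi>\<close> and \<open>L\<close> is asked on rectangles only,
  since in the transport problem they may differ elsewhere. Rectangles suffice both for the
  marginals and for causality.\<close>

lemma coupling_of_functional:
  assumes \<pi>: "prob_space \<pi>" "sets \<pi> = sets P"
    and rect: "\<And>A B. A \<in> sets \<mu> \<Longrightarrow> B \<in> sets \<nu> \<Longrightarrow> measure \<pi> (A \<times> B) = L (indicator (A \<times> B))"
  shows "\<pi> \<in> plans v"
proof -
  interpret \<mu>: prob_space \<mu> by (rule \<mu>)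
  interpret \<nu>: prob_space \<nu> by (rule \<nu>)
  interpret \<pi>: prob_space \<pi> by (rule \<pi>)
  have sp: "space \<pi> = space \<mu> \<times> space \<nu>"
    using sets_eq_imp_space_eq[OF \<pi>(2)] by (simp add: P_def space_pair_measure)
  have m: "fst \<in> measurable \<pi> \<mu>" "snd \<in> measurable \<pi> \<nu>"
    unfolding measurable_cong_sets[OF \<pi>(2) refl] by (simp_all add: P_def)
  have "distr \<pi> \<mu> fst = \<mu>"
  proof (rule measure_eqI)
    fix A assume "A \<in> sets (distr \<pi> \<mu> fst)"
    then have A: "A \<in> sets \<mu>" by simp
    have "fst -` A \<inter> space \<pi> = A \<times> space \<nu>" using sets.sets_into_space[OF A] sp by auto
    then show "emeasure (distr \<pi> \<mu> fst) A = emeasure \<mu> A"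
      using A m rect[OF A sets.top] functional_marginals(1)[OF A sets.top]
      by (simp add: emeasure_distr \<pi>.emeasure_eq_measure \<mu>.emeasure_eq_measure)
  qed simp
  moreover have "distr \<pi> \<nu> snd = \<nu>"
  proof (rule measure_eqI)
    fix B assume "B \<in> sets (distr \<pi> \<nu> snd)"
    then have B: "B \<in> sets \<nu>" by simp
    have "snd -` B \<inter> space \<pi> = space \<mu> \<times> B" using sets.sets_into_space[OF B] sp by auto
    then show "emeasure (distr \<pi> \<nu> snd) B = emeasure \<nu> B"
      using B m rect[OF sets.top B] functional_marginals(2)[OF sets.top B]
      by (simp add: emeasure_distr \<pi>.emeasure_eq_measure \<nu>.emeasure_eq_measure)
  qed simp
  ultimately have c: "\<pi> \<in> couplings \<mu> \<nu>" using \<pi> by (simp add: couplings_def P_def)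
  note V = fun_space_bounded_measurable[of P]
  have rect': "L (\<lambda>z. indicator A (fst z) * indicator B (snd z)) = (\<integral>z. indicator A (fst z) * indicator B (snd z) \<partial>\<pi>)"
    if "A \<in> sets (path_space X N)" "B \<in> sets (path_space Y N)" for A B
  proof -
    have AB: "A \<in> sets \<mu>" "B \<in> sets \<nu>" using that \<mu> \<nu> by auto
    have e: "(\<lambda>z. indicator A (fst z) * indicator B (snd z) :: real) = indicator (A \<times> B)"
      by (auto simp: indicator_def fun_eq_iff)
    have "A \<times> B \<in> sets \<pi>" using AB by (simp add: \<pi> P_def)
    then show ?thesis unfolding e using rect[OF AB] by simp
  qed
  have "path_process.causal_process \<pi> X Y N \<kappa> fst snd" if "causal_version v"
  proof (rule causal_process_of_functional[OF coupling_path_process[OF P_coupling] P_causal coupling_path_process[OF c] \<pi>(2) L pos _ rect'])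
    show "L s = (\<integral>z. s z \<partial>P)" if "s \<in> adapted_functions N X Y fst snd \<kappa>" for s
      using component_subset_dual_space(1)[of v] that \<open>causal_version v\<close> by (intro L_dual) (auto simp: dual_component_def)
  qed
  moreover have "path_process.causal_process \<pi> Y X N \<eta> snd fst" if "anticausal_version v"
  proof (rule causal_process_of_functional[OF coupling_path_process'[OF P_coupling] P_anticausal coupling_path_process'[OF c] \<pi>(2) L pos])
    show "L s = (\<integral>z. s z \<partial>P)" if "s \<in> adapted_functions N Y X snd fst \<eta>" for s
      using component_subset_dual_space(2)[of v] that \<open>anticausal_version v\<close> by (intro L_dual) (auto simp: dual_component_def)
    show "L (\<lambda>z. indicator B (snd z) * indicator A (fst z)) = (\<integral>z. indicator B (snd z) * indicator A (fst z) \<partial>\<pi>)"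
      if "B \<in> sets (path_space Y N)" "A \<in> sets (path_space X N)" for A B
      using rect'[OF that(2,1)] by (simp add: mult.commute)
  qed
  ultimately show ?thesis using c by (simp add: couplings_of_iff_causal_process)
qed

end

end

lemma exp_convex_combination:
  fixes x y a b :: real
  assumes "a \<ge> 0" "b \<ge> 0" "a + b = 1"
  shows "exp (a * x + b * y) \<le> a * exp x + b * exp y"
proof -
  have a: "a = 1 - b" using assms by simp
  show ?thesis unfolding a using convex_onD[OF exp_convex, of b x y] assms by simp
qed

lemma bounded_measurable_exp:
  assumes "f \<in> bounded_measurable M"
  shows "(\<lambda>z. exp (f z)) \<in> bounded_measurable M"
proof -
  obtain K where K: "K \<ge> 0" "\<And>z. z \<in> space M \<Longrightarrow> \<bar>f z\<bar> \<le> K" using bounded_measurable_bound[OF assms] by blast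
  show ?thesis
  proof (rule bounded_measurableI[of _ _ "exp K"])
    show "(\<lambda>z. exp (f z)) \<in> borel_measurable M" using bounded_measurable_measurable[OF assms] by measurable
    show "\<bar>exp (f z)\<bar> \<le> exp K" if "z \<in> space M" for z using K(2)[OF that] by simp
  qed
qed

section \<open>The two duality theorems\<close>

context transport_problem
begin

abbreviation "W \<equiv> prod_topology (path_topology X N) (path_topology Y N)"

lemma dual_functional:
  assumes mono: "\<And>f g. f \<in> bounded_measurable P \<Longrightarrow> g \<in> bounded_measurable P \<Longrightarrow>
      (\<And>z. z \<in> space P \<Longrightarrow> f z \<le> g z) \<Longrightarrow> F f \<le> F g"
    and conv: "\<And>f g a b. f \<in> bounded_measurable P \<Longrightarrow> g \<in> bounded_measurable P \<Longrightarrow> a > 0 \<Longrightarrow> b > 0 \<Longrightarrow> a + b = 1 \<Longrightarrow>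
      F (\<lambda>z. a * f z + b * g z) \<le> a * F f + b * F g"
    and D: "\<And>s. s \<in> dual v \<Longrightarrow> (\<integral>z. s z \<partial>P) - F s \<le> D"
  obtains L where "linear_on (bounded_measurable P) L"
    "\<And>f. f \<in> bounded_measurable P \<Longrightarrow> (\<And>z. z \<in> space P \<Longrightarrow> 0 \<le> f z) \<Longrightarrow> 0 \<le> L f"
    "\<And>s. s \<in> dual v \<Longrightarrow> L s = (\<integral>z. s z \<partial>P)"
    "\<And>f. f \<in> bounded_measurable P \<Longrightarrow> L f \<le> F f + D"
proof -
  interpret P: prob_space P by (rule prob_P)
  show thesis
  proof (rule fenchel_duality[where \<Omega> = "space P" and H = "dual v" and l = "\<lambda>f. \<integral>z. f z \<partial>P"
        and V = "bounded_measurable P" and F = F and D = D])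
    show "\<exists>K. \<forall>z\<in>space P. \<bar>f z\<bar> \<le> K" if "f \<in> bounded_measurable P" for f
      using that by (simp add: bounded_measurable_iff)
    show "\<exists>w\<in>dual v. \<forall>z\<in>space P. w z = k" for k
      using dual_space_const[of k] by (rule bexI[rotated]) simp
    show "0 \<le> (\<integral>z. f z \<partial>P)" if "\<And>z. z \<in> space P \<Longrightarrow> 0 \<le> f z" for f :: "_ \<Rightarrow> real"
      using that by (intro Bochner_Integration.integral_nonneg) auto
    show "(\<integral>z. 1 \<partial>P) = (1::real)" by (simp add: P.prob_space)
  qed (fact fun_space_bounded_measurable bounded_measurable_const dual_space_bounded_measurable
      dual_space_lincomb P.linear_on_integral mono conv D that)+
qed

context
  fixes c :: "('a, 'b) paths \<Rightarrow> real"
  assumes c_cont: "continuous_map W euclideanreal c"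
    and c_bdd: "bounded (c ` topspace W)"
begin

lemma sets_P: "sets P = sets (borel_of W)"
proof -
  have "sets P = sets (path_space X N \<Otimes>\<^sub>M path_space Y N)"
    unfolding P_def by (intro sets_pair_measure_cong \<mu> \<nu>)
  also have "\<dots> = sets (borel_of W)"
    using polish_X polish_Y by (intro sets_path_space_pair_eq_borel) (auto simp: polish_topology_def)
  finally show ?thesis .
qed

lemma space_P: "space P = topspace W"
  using sets_eq_imp_space_eq[OF sets_P] by simp

lemma c_bounded_measurable: "c \<in> bounded_measurable P"
proof -
  have "borel_of (euclideanreal) = (borel :: real measure)"
    by (simp add: borel_of_def borel_def)
  then have "c \<in> borel_measurable (borel_of W)"
    using continuous_map_measurable_borel_of[OF c_cont] by simp
  then show ?thesis
    using c_bdd unfolding measurable_cong_sets[OF sets_P[symmetric] refl]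
    by (simp add: bounded_measurable_def space_P)
qed

lemma c_coupling_bounded_measurable: "\<pi> \<in> couplings \<mu> \<nu> \<Longrightarrow> c \<in> bounded_measurable \<pi>"
  using c_bounded_measurable bounded_measurable_sets_cong[OF couplingsD(2)] by simp

lemma transport_weak_duality:
  assumes \<pi>: "\<pi> \<in> plans v" and s: "s \<in> dual v" "\<forall>z\<in>space P. s z \<le> c z"
  shows "(\<integral>z. s z \<partial>P) \<le> (\<integral>z. c z \<partial>\<pi>)"
proof -
  have cp: "\<pi> \<in> couplings \<mu> \<nu>" using \<pi> by (simp add: couplings_of_iff)
  interpret \<pi>: prob_space \<pi> by (rule couplingsD(1)[OF cp])
  have "s \<in> bounded_measurable P" using s dual_space_bounded_measurable by blast
  then have "s \<in> bounded_measurable \<pi>" using bounded_measurable_sets_cong[OF couplingsD(2)[OF cp]] by simp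
  then have "(\<integral>z. s z \<partial>\<pi>) \<le> (\<integral>z. c z \<partial>\<pi>)"
    using s(2) c_coupling_bounded_measurable[OF cp] sets_eq_imp_space_eq[OF couplingsD(2)[OF cp]]
    by (intro integral_mono \<pi>.integrable_bounded_measurable) auto
  then show ?thesis using integral_dual_space[OF \<pi> s(1)] by simp
qed

text \<open>The functional \<open>h \<mapsto> sup (h - c)\<close> encodes the constraint \<open>s \<le> c\<close>: subtracting the constant
  \<open>sup (s - c)\<close> makes any \<open>s\<close> feasible.\<close>

lemma transport_strong_duality:
  assumes D: "\<And>s. s \<in> dual v \<Longrightarrow> \<forall>z\<in>space P. s z \<le> c z \<Longrightarrow> (\<integral>z. s z \<partial>P) \<le> D"
  shows "\<exists>\<pi>\<in>plans v. (\<integral>z. c z \<partial>\<pi>) \<le> D"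
proof -
  interpret P: prob_space P by (rule prob_P)
  define F where "F = (\<lambda>h. SUP z\<in>space P. h z - c z)"
  have ne: "space P \<noteq> {}" by (rule P.not_empty)
  have bdd: "bdd_above ((\<lambda>z. h z - c z) ` space P)" if h: "h \<in> bounded_measurable P" for h
  proof -
    obtain K where "K \<ge> 0" "\<And>z. z \<in> space P \<Longrightarrow> \<bar>h z - c z\<bar> \<le> K"
      using bounded_measurable_bound[OF bounded_measurable_diff[OF h c_bounded_measurable]] by blast
    then have "h z - c z \<le> K" if "z \<in> space P" for z using that by (meson abs_le_D1)
    then show ?thesis by (intro bdd_aboveI2)
  qed
  have le: "h z - c z \<le> F h" if "h \<in> bounded_measurable P" "z \<in> space P" for h z
    unfolding F_def using that bdd by (intro cSUP_upper) auto
  show ?thesis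
  proof (rule dual_functional[where F = F and D = D and v = v])
    show "F f \<le> F g" if "f \<in> bounded_measurable P" "g \<in> bounded_measurable P" "\<And>z. z \<in> space P \<Longrightarrow> f z \<le> g z" for f g
      unfolding fun_cong[OF F_def, of f] using ne
    proof (rule cSUP_least)
      fix z assume "z \<in> space P"
      then show "f z - c z \<le> F g" using le[OF that(2)] that(3) by (meson diff_right_mono order_trans)
    qed
    show "F (\<lambda>z. a * f z + b * g z) \<le> a * F f + b * F g"
      if fg: "f \<in> bounded_measurable P" "g \<in> bounded_measurable P" and ab: "a > 0" "b > 0" "a + b = 1" for f g a b
      unfolding fun_cong[OF F_def, of "\<lambda>z. a * f z + b * g z"] using ne
    proof (rule cSUP_least)
      fix z assume z: "z \<in> space P"
      have "a * f z + b * g z - (a + b) * c z = a * (f z - c z) + b * (g z - c z)" by (simp add: algebra_simps)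
      also have "\<dots> \<le> a * F f + b * F g" using le[OF fg(1) z] le[OF fg(2) z] ab by (intro add_mono mult_left_mono) auto
      finally show "a * f z + b * g z - c z \<le> a * F f + b * F g" using ab by simp
    qed
    show "(\<integral>z. s z \<partial>P) - F s \<le> D" if s: "s \<in> dual v" for s
    proof -
      obtain w where w: "w \<in> dual v" "\<forall>z\<in>space P. w z = 1 * s z + (- F s) * 1"
        using dual_space_lincomb[OF s dual_space_const[of 1]] by blast
      have sb: "s \<in> bounded_measurable P" using s dual_space_bounded_measurable by blast
      have "\<forall>z\<in>space P. w z \<le> c z"
      proof
        fix z assume z: "z \<in> space P"
        show "w z \<le> c z" using w(2) z le[OF sb z] by simp
      qed
      then have "(\<integral>z. w z \<partial>P) \<le> D" by (rule D[OF w(1)])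
      moreover have "(\<integral>z. w z \<partial>P) = (\<integral>z. s z - F s \<partial>P)"
        using w(2) by (intro Bochner_Integration.integral_cong) auto
      ultimately show ?thesis using P.integrable_bounded_measurable[OF sb] by (simp add: P.prob_space)
    qed
  next
  fix L
  assume L: "linear_on (bounded_measurable P) L"
    "\<And>f. f \<in> bounded_measurable P \<Longrightarrow> (\<And>z. z \<in> space P \<Longrightarrow> 0 \<le> f z) \<Longrightarrow> 0 \<le> L f"
    "\<And>s. s \<in> dual v \<Longrightarrow> L s = (\<integral>z. s z \<partial>P)"
    "\<And>f. f \<in> bounded_measurable P \<Longrightarrow> L f \<le> F f + D"
  note one = functional_one[OF L(1-3)]
  show "\<exists>\<pi>\<in>plans v. (\<integral>z. c z \<partial>\<pi>) \<le> D"
  proof (rule countably_additive_coupling[where S = "path_topology X N" and T = "path_topology Y N"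
        and \<mu> = \<mu> and \<nu> = \<nu> and L = L, folded P_def])
    show "polish_topology (path_topology X N)" by (rule polish_path_topology) (rule polish_X)
    show "polish_topology (path_topology Y N)" by (rule polish_path_topology) (rule polish_Y)
    show "sets \<mu> = sets (borel_of (path_topology X N))"
      using \<mu>(2) polish_X sets_path_space_eq_borel[of N X] by (simp add: polish_topology_def)
    show "sets \<nu> = sets (borel_of (path_topology Y N))"
      using \<nu>(2) polish_Y sets_path_space_eq_borel[of N Y] by (simp add: polish_topology_def)
    show "L (indicator (A \<times> space \<nu>)) = measure \<mu> A" if "A \<in> sets \<mu>" for A
      using functional_marginals(1)[OF L(1-3) that sets.top] .
    show "L (indicator (space \<mu> \<times> B)) = measure \<nu> B" if "B \<in> sets \<nu>" for B
      using functional_marginals(2)[OF L(1-3) sets.top that] .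
    show "0 \<le> L f" if "f \<in> bounded_measurable P" "\<And>z. z \<in> space P \<Longrightarrow> 0 \<le> f z" for f using L(2) that .
    show "prob_space \<mu>" by (rule \<mu>)
    show "prob_space \<nu>" by (rule \<nu>)
    show "linear_on (bounded_measurable P) L" by (rule L)
    show "L (\<lambda>z. 1) = 1" by (rule one)
  next
  fix \<pi>
  assume \<pi>: "prob_space \<pi>" "sets \<pi> = sets P"
    "\<And>A B. A \<in> sets \<mu> \<Longrightarrow> B \<in> sets \<nu> \<Longrightarrow> measure \<pi> (A \<times> B) = L (indicator (A \<times> B))"
    "\<And>U. openin W U \<Longrightarrow> measure \<pi> U \<le> L (indicator U)"
  have c\<pi>: "\<pi> \<in> plans v" by (rule coupling_of_functional[OF L(1-3) \<pi>(1-3)])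
  interpret \<pi>: prob_space \<pi> by (rule \<pi>)
  note V = bounded_measurable_sets_cong[OF \<pi>(2)] and sp = sets_eq_imp_space_eq[OF \<pi>(2)]
  \<comment> \<open>Continuity of \<open>c\<close> enters through its strict superlevel sets: they
    are open, and on open sets \<open>\<pi>\<close> is dominated by \<open>L\<close>.\<close>
  have "(\<integral>z. c z \<partial>\<pi>) \<le> L c"
  proof (rule positive_functional_mono_level_sets[OF _ _ L(1) L(2) _ c_bounded_measurable, where ?L1.0 = "\<lambda>f. \<integral>z. f z \<partial>\<pi>"])
    show "linear_on (bounded_measurable P) (\<lambda>f. \<integral>z. f z \<partial>\<pi>)" using \<pi>.linear_on_integral by (simp add: V)
    show "0 \<le> (\<integral>z. g z \<partial>\<pi>)" if "\<And>z. z \<in> space P \<Longrightarrow> 0 \<le> g z" for g :: "_ \<Rightarrow> real"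
      using that sp by (intro Bochner_Integration.integral_nonneg) auto
    show "(\<integral>z. 1 \<partial>\<pi>) = L (\<lambda>z. 1)" using one by (simp add: \<pi>.prob_space)
    fix a
    have "openin W {z \<in> space P. c z \<in> {a<..}}"
      unfolding space_P by (rule openin_continuous_map_preimage[OF c_cont]) simp
    then have U: "openin W {z \<in> space P. a < c z}" by simp
    have "{z \<in> space P. a < c z} \<in> sets \<pi>" using U by (simp add: \<pi> sets_P openin_sets_borel_of)
    then show "(\<integral>z. indicator {z \<in> space P. a < c z} z \<partial>\<pi>) \<le> L (indicator {z \<in> space P. a < c z})"
      using \<pi>(4)[OF U] by simp
  qed
  also have "L c \<le> F c + D" by (rule L(4)[OF c_bounded_measurable])
  \<comment> \<open>The supremum of \<open>c - c\<close>, so the bound on \<open>L\<close> at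
    \<open>c\<close> is \<open>D\<close> itself.\<close>
  also have "F c = 0" using ne by (simp add: F_def)
  finally show "\<exists>\<pi>\<in>plans v. (\<integral>z. c z \<partial>\<pi>) \<le> D"
    using c\<pi> by (intro bexI[of _ \<pi>]) simp_all
  qed
  qed
qed

theorem transport_duality:
  "transport_value v N X Y \<mu> \<nu> c =
     (SUP s\<in>{s \<in> dual v. \<forall>z\<in>space P. s z \<le> c z}. ereal (\<integral>z. s z \<partial>P))"
proof (rule antisym)
  show "transport_value v N X Y \<mu> \<nu> c \<le> (SUP s\<in>{s \<in> dual v. \<forall>z\<in>space P. s z \<le> c z}. ereal (\<integral>z. s z \<partial>P))"
  \<comment> \<open>Comparing with real upper bounds \<open>D\<close> of the supremum also covers
    the value \<open>\<infinity>\<close>, for which there is no such \<open>D\<close>.\<close>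
  proof (rule ereal_le_real)
    fix D assume D: "(SUP s\<in>{s \<in> dual v. \<forall>z\<in>space P. s z \<le> c z}. ereal (\<integral>z. s z \<partial>P)) \<le> ereal D"
    have "(\<integral>z. s z \<partial>P) \<le> D" if "s \<in> dual v" "\<forall>z\<in>space P. s z \<le> c z" for s
    proof -
      have "ereal (\<integral>z. s z \<partial>P) \<le> ereal D" by (rule order_trans[OF SUP_upper D]) (use that in simp)
      then show ?thesis by simp
    qed
    from transport_strong_duality[OF this]
    obtain \<pi> where \<pi>: "\<pi> \<in> plans v" "(\<integral>z. c z \<partial>\<pi>) \<le> D" by blast
    then show "transport_value v N X Y \<mu> \<nu> c \<le> ereal D"
      unfolding transport_value_def by (intro INF_lower2[OF \<pi>(1)]) simp
  qed
  show "(SUP s\<in>{s \<in> dual v. \<forall>z\<in>space P. s z \<le> c z}. ereal (\<integral>z. s z \<partial>P)) \<le> transport_value v N X Y \<mu> \<nu> c"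
    unfolding transport_value_def using transport_weak_duality by (intro SUP_least INF_greatest) auto
qed

context
  fixes \<epsilon> :: real assumes \<epsilon>: "\<epsilon> > 0"
begin

lemma scaled_bounded_measurable:
  "f \<in> bounded_measurable P \<Longrightarrow> (\<lambda>z. (f z - c z) / \<epsilon>) \<in> bounded_measurable P"
  using bounded_measurable_cmult[OF bounded_measurable_diff[OF _ c_bounded_measurable], of f "1 / \<epsilon>"] by simp

text \<open>The bound \<open>KL_lower_bound\<close> with \<open>g = (s - c) / \<epsilon>\<close>,
  multiplied by \<open>\<epsilon>\<close>; its constant 1 becomes the summand
  \<open>\<epsilon>\<close> of the dual formula.\<close>

lemma entropic_weak_duality:
  assumes \<pi>: "\<pi> \<in> plans v" and s: "s \<in> dual v"
  shows "ereal (\<integral>z. (s z - \<epsilon> * exp ((s z - c z) / \<epsilon>)) \<partial>P) + ereal \<epsilon> \<le> ereal (\<integral>z. c z \<partial>\<pi>) + ereal \<epsilon> * KL \<pi> P"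
proof -
  interpret P: prob_space P by (rule prob_P)
  have cp: "\<pi> \<in> couplings \<mu> \<nu>" using \<pi> by (simp add: couplings_of_iff)
  interpret \<pi>: prob_space \<pi> by (rule couplingsD(1)[OF cp])
  have sb: "s \<in> bounded_measurable P" using s dual_space_bounded_measurable by blast
  define g where "g = (\<lambda>z. (s z - c z) / \<epsilon>)"
  have g: "g \<in> bounded_measurable P" unfolding g_def by (rule scaled_bounded_measurable[OF sb])
  have i: "integrable P s" "integrable P (\<lambda>z. exp (g z))" "integrable \<pi> s" "integrable \<pi> c"
    using sb c_coupling_bounded_measurable[OF cp] bounded_measurable_exp[OF g] bounded_measurable_sets_cong[OF couplingsD(2)[OF cp]]
    by (auto intro: P.integrable_bounded_measurable \<pi>.integrable_bounded_measurable)
  have KL: "ereal ((\<integral>z. g z \<partial>\<pi>) - (\<integral>z. exp (g z) \<partial>P) + 1) \<le> KL \<pi> P"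
    by (rule KL_lower_bound[OF prob_P couplingsD(1,2)[OF cp] g])
  have "(\<integral>z. g z \<partial>\<pi>) = ((\<integral>z. s z \<partial>\<pi>) - (\<integral>z. c z \<partial>\<pi>)) / \<epsilon>" using i by (simp add: g_def)
  then have "\<epsilon> * (\<integral>z. g z \<partial>\<pi>) = (\<integral>z. s z \<partial>P) - (\<integral>z. c z \<partial>\<pi>)"
    using \<epsilon> integral_dual_space[OF \<pi> s] by simp
  then have "(\<integral>z. (s z - \<epsilon> * exp ((s z - c z) / \<epsilon>)) \<partial>P) + \<epsilon> =
      (\<integral>z. c z \<partial>\<pi>) + \<epsilon> * ((\<integral>z. g z \<partial>\<pi>) - (\<integral>z. exp (g z) \<partial>P) + 1)"
    using i by (simp add: g_def[symmetric, THEN fun_cong] algebra_simps)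
  then have "ereal (\<integral>z. (s z - \<epsilon> * exp ((s z - c z) / \<epsilon>)) \<partial>P) + ereal \<epsilon> =
      ereal (\<integral>z. c z \<partial>\<pi>) + ereal \<epsilon> * ereal ((\<integral>z. g z \<partial>\<pi>) - (\<integral>z. exp (g z) \<partial>P) + 1)"
    by simp
  also have "\<dots> \<le> ereal (\<integral>z. c z \<partial>\<pi>) + ereal \<epsilon> * KL \<pi> P"
    using KL \<epsilon> by (intro add_left_mono ereal_mult_left_mono) auto
  finally show ?thesis .
qed

lemma entropic_strong_duality:
  assumes D: "\<And>s. s \<in> dual v \<Longrightarrow> (\<integral>z. (s z - \<epsilon> * exp ((s z - c z) / \<epsilon>)) \<partial>P) \<le> D"
  shows "\<exists>\<pi>\<in>plans v. ereal (\<integral>z. c z \<partial>\<pi>) + ereal \<epsilon> * KL \<pi> P \<le> ereal D + ereal \<epsilon>"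
proof -
  interpret P: prob_space P by (rule prob_P)
  note bm = scaled_bounded_measurable and int = P.integrable_bounded_measurable
  define F where "F = (\<lambda>h. \<epsilon> * (\<integral>z. exp ((h z - c z) / \<epsilon>) \<partial>P))"
  show ?thesis
  proof (rule dual_functional[where F = F and D = D and v = v])
    show "F f \<le> F g" if "f \<in> bounded_measurable P" "g \<in> bounded_measurable P" "\<And>z. z \<in> space P \<Longrightarrow> f z \<le> g z" for f g
      unfolding F_def using \<epsilon> that
      by (intro mult_left_mono integral_mono int bounded_measurable_exp bm) (auto intro: divide_right_mono)
    show "F (\<lambda>z. a * f z + b * g z) \<le> a * F f + b * F g"
      if fg: "f \<in> bounded_measurable P" "g \<in> bounded_measurable P" and ab: "a > 0" "b > 0" "a + b = 1" for f g a b
    proof -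
      have "(\<integral>z. exp ((a * f z + b * g z - c z) / \<epsilon>) \<partial>P) \<le>
          (\<integral>z. a * exp ((f z - c z) / \<epsilon>) + b * exp ((g z - c z) / \<epsilon>) \<partial>P)"
      proof (rule integral_mono)
        show "integrable P (\<lambda>z. exp ((a * f z + b * g z - c z) / \<epsilon>))"
          by (intro int bounded_measurable_exp bm fun_space_lincomb[OF fun_space_bounded_measurable] fg)
        show "integrable P (\<lambda>z. a * exp ((f z - c z) / \<epsilon>) + b * exp ((g z - c z) / \<epsilon>))"
          by (intro int fun_space_lincomb[OF fun_space_bounded_measurable] bounded_measurable_exp bm fg)
        fix z
        have "(a * f z + b * g z - (a + b) * c z) / \<epsilon> = a * ((f z - c z) / \<epsilon>) + b * ((g z - c z) / \<epsilon>)"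
          using \<epsilon> by (simp add: field_simps)
        then show "exp ((a * f z + b * g z - c z) / \<epsilon>) \<le> a * exp ((f z - c z) / \<epsilon>) + b * exp ((g z - c z) / \<epsilon>)"
          using exp_convex_combination[of a b "(f z - c z) / \<epsilon>" "(g z - c z) / \<epsilon>"] ab by simp
      qed
      also have "\<dots> = a * (\<integral>z. exp ((f z - c z) / \<epsilon>) \<partial>P) + b * (\<integral>z. exp ((g z - c z) / \<epsilon>) \<partial>P)"
        using int[OF bounded_measurable_exp[OF bm[OF fg(1)]]] int[OF bounded_measurable_exp[OF bm[OF fg(2)]]] by simp
      finally have "F (\<lambda>z. a * f z + b * g z) \<le> \<epsilon> * (a * (\<integral>z. exp ((f z - c z) / \<epsilon>) \<partial>P) + b * (\<integral>z. exp ((g z - c z) / \<epsilon>) \<partial>P))"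
        unfolding F_def using \<epsilon> by (intro mult_left_mono) auto
      then show ?thesis by (simp add: F_def algebra_simps)
    qed
    show "(\<integral>z. s z \<partial>P) - F s \<le> D" if s: "s \<in> dual v" for s
    proof -
      have sb: "s \<in> bounded_measurable P" using s dual_space_bounded_measurable by blast
      show ?thesis
        using D[OF s] int[OF sb] int[OF bounded_measurable_exp[OF bm[OF sb]]] by (simp add: F_def)
    qed
  next
  fix L
  assume L: "linear_on (bounded_measurable P) L"
    "\<And>f. f \<in> bounded_measurable P \<Longrightarrow> (\<And>z. z \<in> space P \<Longrightarrow> 0 \<le> f z) \<Longrightarrow> 0 \<le> L f"
    "\<And>s. s \<in> dual v \<Longrightarrow> L s = (\<integral>z. s z \<partial>P)"
    "\<And>f. f \<in> bounded_measurable P \<Longrightarrow> L f \<le> F f + D"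
  note V = fun_space_bounded_measurable[of P]
  obtain K where K: "K \<ge> 0" "\<And>z. z \<in> space P \<Longrightarrow> \<bar>c z\<bar> \<le> K" using bounded_measurable_bound[OF c_bounded_measurable] by blast
  \<comment> \<open>An upper bound for \<open>F\<close> at the zero function, as
    \<open>- c \<le> K\<close> on \<open>space P\<close>.\<close>
  define C where "C = \<epsilon> * exp (K / \<epsilon>)"
  have C: "C \<ge> 0" using \<epsilon> by (simp add: C_def)
  \<comment> \<open>Dividing by \<open>n\<close> leaves \<open>(C + D) / n\<close>, small for large
    \<open>n\<close>, plus a multiple of \<open>measure P A\<close>. Choosing \<open>n\<close> first
    and \<open>A\<close> second yields both absolute continuity and continuity at the empty
    set.\<close>
  have small: "real n * L (indicator A) \<le> C + D + C * exp (real n / \<epsilon>) * measure P A" if A: "A \<in> sets P" for A and n :: nat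
  proof -
    have iA: "indicator A \<in> bounded_measurable P" by (rule bounded_measurable_indicator[OF A])
    have nA: "(\<lambda>z. real n * indicator A z) \<in> bounded_measurable P" by (rule bounded_measurable_cmult[OF iA])
    have "(\<integral>z. exp ((real n * indicator A z - c z) / \<epsilon>) \<partial>P) \<le>
        (\<integral>z. exp (K / \<epsilon>) + exp (K / \<epsilon>) * exp (real n / \<epsilon>) * indicator A z \<partial>P)"
    proof (rule integral_mono)
      show "integrable P (\<lambda>z. exp ((real n * indicator A z - c z) / \<epsilon>))"
        by (intro int bounded_measurable_exp bm nA)
      show "integrable P (\<lambda>z. exp (K / \<epsilon>) + exp (K / \<epsilon>) * exp (real n / \<epsilon>) * indicator A z)"
        by (intro int bounded_measurable_add bounded_measurable_const bounded_measurable_cmult iA)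
      fix z assume z: "z \<in> space P"
      have "- c z \<le> K" using K(2)[OF z] by simp
      then have "exp ((real n * indicator A z - c z) / \<epsilon>) \<le> exp ((real n * indicator A z + K) / \<epsilon>)"
        using \<epsilon> by (simp add: divide_right_mono)
      also have "\<dots> \<le> exp (K / \<epsilon>) + exp (K / \<epsilon>) * exp (real n / \<epsilon>) * indicator A z"
        by (cases "z \<in> A") (simp_all add: add_divide_distrib exp_add)
      finally show "exp ((real n * indicator A z - c z) / \<epsilon>) \<le> exp (K / \<epsilon>) + exp (K / \<epsilon>) * exp (real n / \<epsilon>) * indicator A z" .
    qed
    also have "\<dots> = exp (K / \<epsilon>) + exp (K / \<epsilon>) * exp (real n / \<epsilon>) * measure P A"
      using int[OF iA] A by (simp add: P.prob_space)
    finally have "F (\<lambda>z. real n * indicator A z) \<le> \<epsilon> * (exp (K / \<epsilon>) + exp (K / \<epsilon>) * exp (real n / \<epsilon>) * measure P A)"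
      unfolding F_def using \<epsilon> by (intro mult_left_mono) auto
    also have "\<dots> = C + C * exp (real n / \<epsilon>) * measure P A" by (simp add: C_def algebra_simps)
    finally show ?thesis
      using L(4)[OF nA] linear_on_cmult[OF L(1) iA, of "real n"] by simp
  qed
  have nonneg: "0 \<le> L (indicator A)" if "A \<in> sets P" for A
    by (rule L(2)[OF bounded_measurable_indicator[OF that]]) simp
  have null: "L (indicator A) = 0" if A: "A \<in> sets P" and "measure P A = 0" for A
  proof (rule antisym[OF _ nonneg[OF A]])
    show "L (indicator A) \<le> 0"
    proof (rule ccontr)
      assume "\<not> L (indicator A) \<le> 0"
      then obtain n :: nat where "C + D < real n * L (indicator A)" using reals_Archimedean3[of "L (indicator A)"] by auto
      then show False using small[OF A, of n] that by simp
    qed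
  qed
  have cont: "(\<lambda>i. L (indicator (E i))) \<longlonglongrightarrow> 0"
    if E: "range E \<subseteq> sets P" "decseq E" "(\<Inter>i. E i) = {}" for E
  proof (rule LIMSEQ_I)
    fix e :: real assume e: "e > 0"
    \<comment> \<open>The 1 is reserved for the term with \<open>measure P (E i)\<close>, which
      drops below 1 for large \<open>i\<close> once \<open>n\<close> is fixed.\<close>
    obtain n :: nat where n: "C + D + 1 < real n * e" using reals_Archimedean3[OF e] by blast
    have "(\<lambda>i. measure P (E i)) \<longlonglongrightarrow> 0" using P.finite_Lim_measure_decseq[OF E(1,2)] E(3) by simp
    then have "(\<lambda>i. C * exp (real n / \<epsilon>) * measure P (E i)) \<longlonglongrightarrow> C * exp (real n / \<epsilon>) * 0" by (intro tendsto_mult tendsto_const)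
    then have "\<forall>\<^sub>F i in sequentially. C * exp (real n / \<epsilon>) * measure P (E i) < 1" by (intro order_tendstoD(2)) auto
    then obtain i0 where i0: "\<And>i. i \<ge> i0 \<Longrightarrow> C * exp (real n / \<epsilon>) * measure P (E i) < 1"
      by (auto simp: eventually_sequentially)
    have "norm (L (indicator (E i)) - 0) < e" if "i \<ge> i0" for i
    proof -
      have Ei: "E i \<in> sets P" using E(1) by auto
      \<comment> \<open>\<open>small\<close> at the empty set with \<open>n = 0\<close> shows
        \<open>C + D \<ge> 0\<close>, which forces the chosen \<open>n\<close> to be
        positive.\<close>
      have "0 \<le> C + D + C * exp (real 0 / \<epsilon>) * measure P {}" using small[of "{}" 0] by simp
      then have "0 < real n * e" using n by simp
      then have n0: "real n > 0" using e by (simp add: zero_less_mult_iff)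
      have "real n * L (indicator (E i)) < real n * e" using small[OF Ei, of n] i0[OF that] n by simp
      then have "L (indicator (E i)) < e" using n0 by simp
      then show ?thesis using nonneg[OF Ei] by simp
    qed
    then show "\<exists>i0. \<forall>i\<ge>i0. norm (L (indicator (E i)) - 0) < e" by blast
  qed
  have alg: "algebra (space P) (sets P)" by (rule sets.algebra_axioms)
  have gen: "sets P \<subseteq> sigma_sets (space P) (sets P)" by (auto intro: sigma_sets.Basic)
  note one = functional_one[OF L(1-3)]
  obtain \<pi> where \<pi>: "prob_space \<pi>" "sets \<pi> = sets P" "\<And>E. E \<in> sets P \<Longrightarrow> measure \<pi> E = L (indicator E)"
    by (rule measure_of_positive_functional[OF L(1) L(2) one alg subset_refl gen cont]; (assumption | (rule that; blast)))
  interpret \<pi>: prob_space \<pi> by (rule \<pi>)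
  have V\<pi>: "bounded_measurable \<pi> = bounded_measurable P" by (rule bounded_measurable_sets_cong[OF \<pi>(2)])
  have L\<pi>: "L f = (\<integral>z. f z \<partial>\<pi>)" if f: "f \<in> bounded_measurable P" for f
  proof (rule positive_functional_eq_indicators[OF L(1) L(2) _ _ _ f, where ?L2.0 = "\<lambda>f. \<integral>z. f z \<partial>\<pi>"])
    show "linear_on (bounded_measurable P) (\<lambda>f. \<integral>z. f z \<partial>\<pi>)" using \<pi>.linear_on_integral by (simp add: V\<pi>)
    show "0 \<le> (\<integral>z. g z \<partial>\<pi>)" if "\<And>z. z \<in> space P \<Longrightarrow> 0 \<le> g z" for g :: "_ \<Rightarrow> real"
      using that sets_eq_imp_space_eq[OF \<pi>(2)] by (intro Bochner_Integration.integral_nonneg) auto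
    show "L (indicator A) = (\<integral>z. indicator A z \<partial>\<pi>)" if "A \<in> sets P" for A
      using \<pi>(3)[OF that] that \<pi>(2) by simp
  qed
  have c\<pi>: "\<pi> \<in> plans v"
  proof (rule coupling_of_functional[OF L(1-3) \<pi>(1,2)])
    show "measure \<pi> (A \<times> B) = L (indicator (A \<times> B))" if "A \<in> sets \<mu>" "B \<in> sets \<nu>" for A B
      using that by (intro \<pi>(3)) (simp add: P_def)
  qed
  have ac: "absolutely_continuous P \<pi>"
    unfolding absolutely_continuous_def
  proof
    fix A assume A: "A \<in> null_sets P"
    then have A': "A \<in> sets P" "measure P A = 0" by (auto simp: null_sets_def measure_def)
    then have "measure \<pi> A = 0" using \<pi>(3) null by simp
    then show "A \<in> null_sets \<pi>" using A \<pi>(2) by (auto simp: \<pi>.emeasure_eq_measure intro!: null_setsI)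
  qed
  have ci: "integrable \<pi> c" using c_bounded_measurable V\<pi> by (intro \<pi>.integrable_bounded_measurable) simp
  have "KL \<pi> P \<le> ereal ((D - (\<integral>z. c z \<partial>\<pi>)) / \<epsilon> + 1)"
  proof (rule KL_upper_bound[OF prob_P \<pi>(1,2) ac])
    fix h assume h: "h \<in> bounded_measurable P"
    have hi: "integrable \<pi> h" using h V\<pi> by (intro \<pi>.integrable_bounded_measurable) simp
    \<comment> \<open>The substitution of \<open>c + \<epsilon> * h\<close> for \<open>h\<close>
      removes \<open>c\<close> from the exponent, turning the bound on \<open>L\<close> into the
      hypothesis of \<open>KL_upper_bound\<close>.\<close>
    have ch: "(\<lambda>z. c z + \<epsilon> * h z) \<in> bounded_measurable P"
      by (intro bounded_measurable_add bounded_measurable_cmult c_bounded_measurable h)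
    have "(\<integral>z. c z \<partial>\<pi>) + \<epsilon> * (\<integral>z. h z \<partial>\<pi>) = L (\<lambda>z. c z + \<epsilon> * h z)" using L\<pi>[OF ch] ci hi by simp
    also have "\<dots> \<le> F (\<lambda>z. c z + \<epsilon> * h z) + D" by (rule L(4)[OF ch])
    also have "F (\<lambda>z. c z + \<epsilon> * h z) = \<epsilon> * (\<integral>z. exp (h z) \<partial>P)" using \<epsilon> by (simp add: F_def)
    finally show "(\<integral>z. h z \<partial>\<pi>) - (\<integral>z. exp (h z) \<partial>P) \<le> (D - (\<integral>z. c z \<partial>\<pi>)) / \<epsilon>"
      using \<epsilon> by (simp add: field_simps)
  qed
  then have "ereal (\<integral>z. c z \<partial>\<pi>) + ereal \<epsilon> * KL \<pi> P \<le> ereal (\<integral>z. c z \<partial>\<pi>) + ereal \<epsilon> * ereal ((D - (\<integral>z. c z \<partial>\<pi>)) / \<epsilon> + 1)"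
    using \<epsilon> by (intro add_left_mono ereal_mult_left_mono) auto
  also have "\<dots> = ereal D + ereal \<epsilon>" using \<epsilon> by (simp add: field_simps)
  finally show "\<exists>\<pi>\<in>plans v. ereal (\<integral>z. c z \<partial>\<pi>) + ereal \<epsilon> * KL \<pi> P \<le> ereal D + ereal \<epsilon>"
    using c\<pi> by blast
  qed
qed

theorem entropic_duality:
  "entropic_value v N X Y P \<epsilon> \<mu> \<nu> c =
     (SUP s\<in>dual v. ereal (\<integral>z. (s z - \<epsilon> * exp ((s z - c z) / \<epsilon>)) \<partial>P)) + ereal \<epsilon>"
proof (rule antisym)
  let ?S = "SUP s\<in>dual v. ereal (\<integral>z. (s z - \<epsilon> * exp ((s z - c z) / \<epsilon>)) \<partial>P)"
  \<comment> \<open>Moving \<open>\<epsilon>\<close> to the left leaves the bare supremum on the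
    right, to which the comparison with real upper bounds \<open>D\<close> applies.\<close>
  have "entropic_value v N X Y P \<epsilon> \<mu> \<nu> c - ereal \<epsilon> \<le> ?S"
  proof (rule ereal_le_real)
    fix D assume D: "?S \<le> ereal D"
    have "(\<integral>z. (s z - \<epsilon> * exp ((s z - c z) / \<epsilon>)) \<partial>P) \<le> D" if "s \<in> dual v" for s
    proof -
      have "ereal (\<integral>z. (s z - \<epsilon> * exp ((s z - c z) / \<epsilon>)) \<partial>P) \<le> ereal D"
        by (rule order_trans[OF SUP_upper D]) (rule that)
      then show ?thesis by simp
    qed
    from entropic_strong_duality[OF this]
    obtain \<pi> where \<pi>: "\<pi> \<in> plans v" "ereal (\<integral>z. c z \<partial>\<pi>) + ereal \<epsilon> * KL \<pi> P \<le> ereal D + ereal \<epsilon>" by blast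
    have "entropic_value v N X Y P \<epsilon> \<mu> \<nu> c \<le> ereal D + ereal \<epsilon>"
      unfolding entropic_value_def using \<pi>(2) by (rule INF_lower2[OF \<pi>(1)])
    then show "entropic_value v N X Y P \<epsilon> \<mu> \<nu> c - ereal \<epsilon> \<le> ereal D" by (simp add: ereal_minus_le)
  qed
  then show "entropic_value v N X Y P \<epsilon> \<mu> \<nu> c \<le> ?S + ereal \<epsilon>" by (simp add: ereal_minus_le)
  have "?S \<le> entropic_value v N X Y P \<epsilon> \<mu> \<nu> c - ereal \<epsilon>"
  proof (rule SUP_least)
    fix s assume s: "s \<in> dual v"
    have "ereal (\<integral>z. (s z - \<epsilon> * exp ((s z - c z) / \<epsilon>)) \<partial>P) + ereal \<epsilon> \<le> entropic_value v N X Y P \<epsilon> \<mu> \<nu> c"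
      unfolding entropic_value_def using s by (intro INF_greatest entropic_weak_duality)
    then show "ereal (\<integral>z. (s z - \<epsilon> * exp ((s z - c z) / \<epsilon>)) \<partial>P) \<le> entropic_value v N X Y P \<epsilon> \<mu> \<nu> c - ereal \<epsilon>"
      by (subst ereal_le_minus) auto
  qed
  then show "?S + ereal \<epsilon> \<le> entropic_value v N X Y P \<epsilon> \<mu> \<nu> c" by (subst (asm) ereal_le_minus) auto
qed

end

end

end

theorem proposition5p2:
  fixes X :: "nat \<Rightarrow> 'a topology" and Y :: "nat \<Rightarrow> 'b topology"
    and N :: nat and v :: version and \<epsilon> :: real
    and \<mu> :: "(nat \<Rightarrow> 'a) measure" and \<nu> :: "(nat \<Rightarrow> 'b) measure"
    and \<kappa> :: "nat \<Rightarrow> (nat \<Rightarrow> 'a) \<Rightarrow> 'a measure" and \<eta> :: "nat \<Rightarrow> (nat \<Rightarrow> 'b) \<Rightarrow> 'b measure"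
    and c :: "('a, 'b) paths \<Rightarrow> real" and P :: "('a, 'b) paths measure"
  assumes N: "N \<ge> 1"
    and polish_X: "\<And>t. t \<in> {1..N} \<Longrightarrow> polish_topology (X t)"
    and polish_Y: "\<And>t. t \<in> {1..N} \<Longrightarrow> polish_topology (Y t)"
    and \<mu>: "prob_space \<mu>" "sets \<mu> = sets (path_space X N)"
    and \<nu>: "prob_space \<nu>" "sets \<nu> = sets (path_space Y N)"
    and \<kappa>: "\<And>t. t \<in> {2..N} \<Longrightarrow> regular_cond_law X \<mu> t (\<kappa> t)"
    and \<eta>: "\<And>t. t \<in> {2..N} \<Longrightarrow> regular_cond_law Y \<nu> t (\<eta> t)"
    and c_cont: "continuous_map (prod_topology (path_topology X N) (path_topology Y N)) euclideanreal c"
    and c_bdd: "bounded (c ` topspace (prod_topology (path_topology X N) (path_topology Y N)))"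
    and \<epsilon>: "\<epsilon> > 0"
    and P: "P = \<mu> \<Otimes>\<^sub>M \<nu>"
  shows "transport_value v N X Y \<mu> \<nu> c =
           (SUP s\<in>{s \<in> dual_space v N X Y \<kappa> \<eta>. \<forall>z\<in>space P. s z \<le> c z}. ereal (\<integral>z. s z \<partial>P)) \<and>
         entropic_value v N X Y P \<epsilon> \<mu> \<nu> c =
           (SUP s\<in>dual_space v N X Y \<kappa> \<eta>. ereal (\<integral>z. (s z - \<epsilon> * exp ((s z - c z) / \<epsilon>)) \<partial>P)) + ereal \<epsilon>"
proof -
  interpret transport_problem X Y N \<mu> \<nu> \<kappa> \<eta>
    by (rule transport_problem.intro) (fact N polish_X polish_Y \<mu> \<nu> \<kappa> \<eta>)+
  show ?thesis
    using transport_duality[OF c_cont c_bdd] entropic_duality[OF c_cont c_bdd \<epsilon>]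
    unfolding P P_def by blast
qed

end
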